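(* Let $1\le s\le r$ be integers and let $n$ be large enough compared to $r$. Then: (1) if $s=o(\sqrt r)$, then $g(n,r,s)=\frac{(1+o_r(1))s}{\sqrt r}\cdot n$; (2) if $s=\Theta(\sqrt r)$, then $g(n,r,s)=\Theta(n)$; (3) if $s\ge\sqrt{r\log r}$, then $g(n,r,s)=\left(1-e^{-\Theta(s^2/r)}\right) n$; (4) if $s\ge (1-o_r(1))\frac r2$, then $g(n,r,s)=\left(1-(1-o_r(1))\binom{r-s-1}{s}\Big/\binom{r}{s}\right) n$; (5) if $r$ is odd and $s=\frac{r-1}{2}$, then $g(n,r,s)=\left\lceil\left(1-1\big/\binom{r}{s}\right)n\right\rceil$; (6) if $s\ge \frac r2$, then $g(n,r,s)=n$.
   Context: An $r$-edge colouring of $K_n$ assigns to each edge one of $r$ colours. $g(n,r,s)$ denotes the largest integer $m$ such that in every $r$-edge colouring of $K_n$ there is a set $S$ of at most $s$ colours such that at least $m$ vertices of $K_n$ are incident to at least one edge whose colour lies in $S$. Logarithms are base $2$. $o_r(1)$ denotes a quantity tending to $0$ as $r\to\infty$; $\Theta(\cdot)$ hides absolute positive constants; $s=o(\sqrt r)$ means $s/\sqrt r\to0$.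
   Formalization: In (3) the upper bound is claimed only for s < r/2, since for s ≥ r/2 part (6) gives g(n,r,s) = n, which no (1 − e^{−Θ(s²/r)})n can equal; in (4) the binomial (r−s−1 choose s) is read as 0 when s = r. *)

theory Defs
  imports Complex_Main
begin

definition K_edges :: "nat \<Rightarrow> nat set set" where
  "K_edges n = {e. e \<subseteq> {..<n} \<and> card e = 2}"

text \<open>Values of a colouring outside the edge set of \<open>K\<^sub>n\<close> are unconstrained and never used.\<close>

definition edge_colouring :: "nat \<Rightarrow> nat \<Rightarrow> (nat set \<Rightarrow> nat) \<Rightarrow> bool" where
  "edge_colouring n r c \<longleftrightarrow> (\<forall>e\<in>K_edges n. c e < r)"

definition touched :: "nat \<Rightarrow> (nat set \<Rightarrow> nat) \<Rightarrow> nat set \<Rightarrow> nat set" where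
  "touched n c S = {v. v < n \<and> (\<exists>e\<in>K_edges n. v \<in> e \<and> c e \<in> S)}"

definition g :: "nat \<Rightarrow> nat \<Rightarrow> nat \<Rightarrow> nat" where
  "g n r s = (GREATEST m. \<forall>c. edge_colouring n r c \<longrightarrow>
      (\<exists>S\<subseteq>{..<r}. card S \<le> s \<and> m \<le> card (touched n c S)))"

text \<open>The error terms \<open>o\<^sub>r(1)\<close> may depend on \<open>n\<close> as well as on \<open>r\<close>; they tend to \<open>0\<close> as
  \<open>r \<rightarrow> \<infinity>\<close> uniformly in the admissible \<open>n\<close>, i.e. those with \<open>n \<ge> N r\<close>.\<close>

definition vanishing :: "(nat \<Rightarrow> nat) \<Rightarrow> (nat \<Rightarrow> nat \<Rightarrow> real) \<Rightarrow> bool" where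
  "vanishing N \<eta> \<longleftrightarrow> (\<forall>\<epsilon>>0. \<forall>\<^sub>F r in at_top. \<forall>n\<ge>N r. \<bar>\<eta> r n\<bar> < \<epsilon>)"

end

theory Submission
  imports Defs "HOL-Real_Asymp.Real_Asymp" "HOL-Number_Theory.Cong"
begin

text \<open>
  Let \<open>A\<^sub>v\<close> be the set of colours at the vertex \<open>v\<close>. These sets pairwise intersect, and conversely a
  weighted intersecting family of colour sets yields a colouring of \<open>K\<^sub>n\<close> for large \<open>n\<close>; so \<open>n - g(n,r,s)\<close>
  is the largest value of the minimum, over the \<open>s\<close>-sets \<open>S\<close>, of the weight of the members disjoint from \<open>S\<close>.

  Lower bounds: if some \<open>A\<^sub>v\<close> is small, then \<open>A\<^sub>v\<close> itself (or a random \<open>s\<close>-subset of it) meets many of the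
  other sets; otherwise a random \<open>s\<close>-set does.

  Upper bounds: a transversal design for (1); one row and one column of a square array of cells combined
  with a majority family for (3); all \<open>(s+1)\<close>-sets for (5).

  The hard case is (4), with \<open>r = 2s + 1 + d\<close> and \<open>d = o(s)\<close>. One needs an independent set \<open>F\<close> of the
  Kneser graph on the \<open>(s+1)\<close>-sets which is spread evenly over the sets \<open>e\<^sub>T = {A. A \<subseteq> T}\<close>,
  \<open>|T| = s + 1 + d\<close>. An exceptional \<open>T\<close> can be repaired by adding \<open>T\<close> itself to the family, since \<open>T\<close> meets
  every \<open>(s+1)\<close>-set; this is affordable if the proportion of such \<open>T\<close> is below \<open>\<epsilon>/K\<close>, where
  \<open>K = |e\<^sub>T|\<close>. Picking \<open>F\<close> at random with the trivial density \<open>1/D\<close>, \<open>D\<close> the degree of the Kneser graph, is not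
  enough for that, but a semi-random greedy choice (a nibble with equalising coin flips) gains a
  factor of order \<open>ln D\<close>, which is. The nibble is derandomised by a potential function.
\<close>

section \<open>Random subsets of a finite set\<close>

text \<open>The obstacle in (4): the ratio \<kappa> = K/D = (s + 1 + d)/d is only known to be a
  large constant, while K may be arbitrarily large. At density 1/D each e_T expects \<kappa> chosen
  sets and is missed with probability about exp(- const \<kappa>), far above 1/K. With m = 4 ln K /
  \<epsilon>^2 expected chosen sets the failure probability becomes a power of 1/K. An independent
  set of density m/K = (m/\<kappa>)/D exists since the Kneser graph is locally sparse: the relevant
  sums of squared codegrees are at most 4^d K^2 and 4^d D^2, and K >= \<kappa>^d >= 256^d gives 4^d
  <= K^(1/4). The shrinking of the degrees costs factors exp(const m/\<kappa>), again a small power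
  of K once \<kappa> >= 128/\<epsilon>^2.

  The other parts are cheap: (2) combines the lower bound of (1) with g <= n, and (6) is the lower
  bound of (4) with numerator 0. In (3) the upper bound is stated for s < r/2, since g = n beyond. A
  family with k members is spread over the n vertices in classes of size at least n div k; n >= 16^r
  makes this rounding negligible.\<close>

text \<open>The expectation of \<open>f Y\<close> for a random \<open>Y \<subseteq> \<Omega>\<close> that contains each \<open>w\<close> independently with
  probability \<open>q w\<close>.\<close>

definition rsub :: "('w \<Rightarrow> real) \<Rightarrow> 'w set \<Rightarrow> ('w set \<Rightarrow> real) \<Rightarrow> real" where
  "rsub q \<Omega> f = (\<Sum>Y\<in>Pow \<Omega>. (\<Prod>w\<in>Y. q w) * (\<Prod>w\<in>\<Omega> - Y. 1 - q w) * f Y)"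

lemma rsub_empty [simp]: "rsub q {} f = f {}"
  by (simp add: rsub_def)

lemma rsub_insert:
  assumes "finite \<Omega>" "w \<notin> \<Omega>"
  shows "rsub q (insert w \<Omega>) f = q w * rsub q \<Omega> (\<lambda>Y. f (insert w Y)) + (1 - q w) * rsub q \<Omega> f"
proof -
  have inj: "inj_on (insert w) (Pow \<Omega>)"
    using assms(2) by (auto simp: inj_on_def)
  have disj: "Pow \<Omega> \<inter> insert w ` Pow \<Omega> = {}"
    using assms(2) by auto
  have fin: "finite (Pow \<Omega>)" using assms(1) by simp
  have "rsub q (insert w \<Omega>) f =
      (\<Sum>Y\<in>Pow \<Omega>. (\<Prod>v\<in>Y. q v) * (\<Prod>v\<in>insert w \<Omega> - Y. 1 - q v) * f Y) +
      (\<Sum>Y\<in>Pow \<Omega>. (\<Prod>v\<in>insert w Y. q v) * (\<Prod>v\<in>insert w \<Omega> - insert w Y. 1 - q v) * f (insert w Y))"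
    unfolding rsub_def Pow_insert sum.union_disjoint[OF fin finite_imageI[OF fin] disj] sum.reindex[OF inj] comp_def ..
  also have "(\<Sum>Y\<in>Pow \<Omega>. (\<Prod>v\<in>Y. q v) * (\<Prod>v\<in>insert w \<Omega> - Y. 1 - q v) * f Y) = (1 - q w) * rsub q \<Omega> f"
    unfolding rsub_def sum_distrib_left
  proof (rule sum.cong[OF refl])
    fix Y assume Y: "Y \<in> Pow \<Omega>"
    then have "insert w \<Omega> - Y = insert w (\<Omega> - Y)" using assms(2) by auto
    then show "(\<Prod>v\<in>Y. q v) * (\<Prod>v\<in>insert w \<Omega> - Y. 1 - q v) * f Y =
        (1 - q w) * ((\<Prod>v\<in>Y. q v) * (\<Prod>v\<in>\<Omega> - Y. 1 - q v) * f Y)"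
      using assms by simp
  qed
  also have "(\<Sum>Y\<in>Pow \<Omega>. (\<Prod>v\<in>insert w Y. q v) * (\<Prod>v\<in>insert w \<Omega> - insert w Y. 1 - q v) * f (insert w Y)) =
      q w * rsub q \<Omega> (\<lambda>Y. f (insert w Y))"
    unfolding rsub_def sum_distrib_left
  proof (rule sum.cong[OF refl])
    fix Y assume Y: "Y \<in> Pow \<Omega>"
    have "insert w \<Omega> - insert w Y = \<Omega> - Y" using assms(2) by auto
    moreover have "finite Y" "w \<notin> Y" using Y assms by (auto intro: finite_subset)
    ultimately show "(\<Prod>v\<in>insert w Y. q v) * (\<Prod>v\<in>insert w \<Omega> - insert w Y. 1 - q v) * f (insert w Y) =
        q w * ((\<Prod>v\<in>Y. q v) * (\<Prod>v\<in>\<Omega> - Y. 1 - q v) * f (insert w Y))"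
      by simp
  qed
  finally show ?thesis by simp
qed

lemma rsub_const: "finite \<Omega> \<Longrightarrow> rsub q \<Omega> (\<lambda>_. c) = c"
  by (induction \<Omega> rule: finite_induct) (simp_all add: rsub_insert algebra_simps)

lemma rsub_add: "rsub q \<Omega> (\<lambda>Y. f Y + h Y) = rsub q \<Omega> f + rsub q \<Omega> h"
  by (simp add: rsub_def algebra_simps sum.distrib)

lemma rsub_cmult: "rsub q \<Omega> (\<lambda>Y. c * f Y) = c * rsub q \<Omega> f"
  by (simp add: rsub_def sum_distrib_left algebra_simps)

lemma rsub_sum: "rsub q \<Omega> (\<lambda>Y. \<Sum>i\<in>I. f i Y) = (\<Sum>i\<in>I. rsub q \<Omega> (f i))"
  unfolding rsub_def sum_distrib_left by (rule sum.swap)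

lemma rsub_mono:
  assumes "\<And>w. w \<in> \<Omega> \<Longrightarrow> 0 \<le> q w \<and> q w \<le> 1" "\<And>Y. Y \<subseteq> \<Omega> \<Longrightarrow> f Y \<le> h Y"
  shows "rsub q \<Omega> f \<le> rsub q \<Omega> h"
  unfolding rsub_def
proof (rule sum_mono)
  fix Y assume "Y \<in> Pow \<Omega>"
  then have Y: "Y \<subseteq> \<Omega>" by simp
  have "0 \<le> (\<Prod>w\<in>Y. q w) * (\<Prod>w\<in>\<Omega> - Y. 1 - q w)"
    using assms(1) Y by (intro mult_nonneg_nonneg prod_nonneg) auto
  then show "(\<Prod>w\<in>Y. q w) * (\<Prod>w\<in>\<Omega> - Y. 1 - q w) * f Y \<le> (\<Prod>w\<in>Y. q w) * (\<Prod>w\<in>\<Omega> - Y. 1 - q w) * h Y"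
    by (rule mult_left_mono[OF assms(2)[OF Y]])
qed

lemma rsub_cong:
  assumes "\<And>Y. Y \<subseteq> \<Omega> \<Longrightarrow> f Y = h Y"
  shows "rsub q \<Omega> f = rsub q \<Omega> h"
  unfolding rsub_def by (rule sum.cong) (use assms in auto)

lemma rsub_exists:
  assumes "finite \<Omega>" "\<And>w. w \<in> \<Omega> \<Longrightarrow> 0 \<le> q w \<and> q w \<le> 1" "rsub q \<Omega> f \<le> c"
  shows "\<exists>Y\<subseteq>\<Omega>. f Y \<le> c"
proof (rule ccontr)
  assume "\<not> ?thesis"
  then have gt: "c < f Y" if "Y \<in> Pow \<Omega>" for Y using that not_le by blast
  have fin: "finite (Pow \<Omega>)" using assms(1) by simp
  \<comment> \<open>\<open>rsub_mono\<close> gives only a weak inequality; the least excess over the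
    finitely many \<open>Y\<close> makes the contradiction strict.\<close>
  define e where "e = Min ((\<lambda>Y. f Y - c) ` Pow \<Omega>)"
  have "e \<in> (\<lambda>Y. f Y - c) ` Pow \<Omega>" unfolding e_def using fin by (intro Min_in) auto
  then have e: "0 < e" using gt by force
  have "c + e = rsub q \<Omega> (\<lambda>_. c + e)" using assms(1) by (simp add: rsub_const)
  also have "\<dots> \<le> rsub q \<Omega> f"
  proof (rule rsub_mono[OF assms(2)])
    fix Y assume "Y \<subseteq> \<Omega>"
    then have "e \<le> f Y - c" unfolding e_def using fin by (intro Min_le finite_imageI imageI) simp_all
    then show "c + e \<le> f Y" by simp
  qed
  finally show False using assms(3) e by simp
qed

text \<open>Fubini for independent choices. It lets \<open>step_edge\<close> reveal the killers in
  \<open>O2\<close> first and then average over \<open>O1\<close> with the survivors of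
  \<open>O2\<close> held fixed.\<close>

lemma rsub_union:
  assumes "finite A" "finite B" "A \<inter> B = {}"
  shows "rsub q (A \<union> B) f = rsub q A (\<lambda>Y. rsub q B (\<lambda>Z. f (Y \<union> Z)))"
  using assms(1,3)
proof (induction A arbitrary: f rule: finite_induct)
  case empty
  then show ?case by simp
next
  case (insert w A)
  then have "rsub q (insert w A \<union> B) f = q w * rsub q (A \<union> B) (\<lambda>Y. f (insert w Y)) + (1 - q w) * rsub q (A \<union> B) f"
    using assms(2) by (simp add: rsub_insert)
  also have "\<dots> = rsub q (insert w A) (\<lambda>Y. rsub q B (\<lambda>Z. f (Y \<union> Z)))"
    using insert by (simp add: rsub_insert)
  finally show ?case .
qed

lemma rsub_prod:
  assumes "finite G"
  shows "rsub (\<lambda>_. p) G (\<lambda>Y. \<Prod>w\<in>G. if w \<in> Y then u w else v w) = (\<Prod>w\<in>G. p * u w + (1 - p) * v w)"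
  using assms
proof (induction G rule: finite_induct)
  case empty
  then show ?case by simp
next
  case (insert g G)
  have 1: "rsub (\<lambda>_. p) G (\<lambda>Y. \<Prod>w\<in>insert g G. if w \<in> insert g Y then u w else v w)
      = rsub (\<lambda>_. p) G (\<lambda>Y. u g * (\<Prod>w\<in>G. if w \<in> Y then u w else v w))"
  proof (rule rsub_cong)
    fix Y
    have "(\<Prod>w\<in>G. if w \<in> insert g Y then u w else v w) = (\<Prod>w\<in>G. if w \<in> Y then u w else v w)"
      using insert.hyps by (intro prod.cong) auto
    then show "(\<Prod>w\<in>insert g G. if w \<in> insert g Y then u w else v w) = u g * (\<Prod>w\<in>G. if w \<in> Y then u w else v w)"
      using insert.hyps by simp
  qed
  have 2: "rsub (\<lambda>_. p) G (\<lambda>Y. \<Prod>w\<in>insert g G. if w \<in> Y then u w else v w)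
      = rsub (\<lambda>_. p) G (\<lambda>Y. v g * (\<Prod>w\<in>G. if w \<in> Y then u w else v w))"
    by (rule rsub_cong) (use insert.hyps in auto)
  show ?case
    unfolding rsub_insert[OF insert.hyps] 1 2 rsub_cmult insert.IH
    using insert.hyps by (simp add: algebra_simps)
qed

lemma rsub_member:
  assumes "finite \<Omega>" "w \<in> \<Omega>"
  shows "rsub q \<Omega> (\<lambda>Y. if w \<in> Y then 1 else 0) = q w"
proof -
  obtain \<Omega>' where \<Omega>: "\<Omega> = insert w \<Omega>'" "w \<notin> \<Omega>'" using assms(2) by (meson mk_disjoint_insert)
  then have "finite \<Omega>'" using assms(1) by simp
  then have "rsub q \<Omega> (\<lambda>Y. if w \<in> Y then 1 else 0) = q w * rsub q \<Omega>' (\<lambda>_. 1) + (1 - q w) * rsub q \<Omega>' (\<lambda>Y. if w \<in> Y then 1 else 0)"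
    using \<Omega> by (simp add: rsub_insert)
  moreover have "rsub q \<Omega>' (\<lambda>Y. if w \<in> Y then 1 else 0) = rsub q \<Omega>' (\<lambda>_. 0)"
    by (rule rsub_cong) (use \<Omega> in auto)
  ultimately show ?thesis using \<open>finite \<Omega>'\<close> by (simp add: rsub_const)
qed

section \<open>Exponential moments of the number of survivors of a random killing\<close>

text \<open>Each \<open>w\<close> in the random set \<open>Y\<close> kills the elements of \<open>k w\<close>.\<close>

definition surv :: "('w \<Rightarrow> 'a set) \<Rightarrow> 'a set \<Rightarrow> 'w set \<Rightarrow> 'a set" where
  "surv k e Y = {A\<in>e. \<forall>w\<in>Y. A \<notin> k w}"

lemma surv_insert: "surv k e (insert w Y) = surv k (e - k w) Y"
  by (auto simp: surv_def)

lemma surv_subset: "surv k e Y \<subseteq> e"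
  by (auto simp: surv_def)

text \<open>Both tail bounds are proved by revealing \<open>Y\<close> one element at a time; no independence of the
  kill sets is needed, the sum of the squares of their sizes controls the error.\<close>

lemma surv_lower_tail:
  fixes a :: real
  assumes "finite \<Omega>" "finite e" "\<And>w. w \<in> \<Omega> \<Longrightarrow> 0 \<le> q w \<and> q w \<le> 1" "0 \<le> a"
  shows "rsub q \<Omega> (\<lambda>Y. exp (- a * card (surv k e Y))) \<le>
    exp (- a * (\<Sum>A\<in>e. 1 - (\<Sum>w | w \<in> \<Omega> \<and> A \<in> k w. q w)) +
      (\<Sum>w\<in>\<Omega>. q w * (exp (a * card (k w \<inter> e)) - 1 - a * card (k w \<inter> e))))"
proof -
  let ?c = "\<lambda>w. real (card (k w \<inter> e))"
  \<comment> \<open>Revealing \<open>w\<close> replaces \<open>e'\<close> by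
    \<open>e' - k w\<close>, so the induction runs over all subsets of \<open>e\<close>; the error
    terms keep referring to the full \<open>e\<close>.\<close>
  have main: "rsub q \<Omega> (\<lambda>Y. exp (- a * card (surv k e' Y))) \<le>
      exp (- a * card e') * exp (\<Sum>w\<in>\<Omega>. q w * (exp (a * ?c w) - 1))" if "e' \<subseteq> e" for e'
    using assms(1,3) that
  proof (induction \<Omega> arbitrary: e' rule: finite_induct)
    case empty
    then show ?case by (simp add: surv_def)
  next
    case (insert w \<Omega>)
    have q: "0 \<le> q w" "q w \<le> 1" using insert.prems(1) by auto
    have fe: "finite e'" using insert.prems(2) assms(2) finite_subset by blast
    let ?S = "exp (\<Sum>w\<in>\<Omega>. q w * (exp (a * ?c w) - 1))"
    have c: "real (card e') \<le> real (card (e' - k w)) + ?c w"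
    proof -
      have "card e' = card (e' - k w) + card (e' \<inter> k w)"
        using card_Un_disjoint[of "e' - k w" "e' \<inter> k w"] fe by (metis Diff_Diff_Int Diff_disjoint Int_Diff_disjoint Un_Diff_Int finite_Diff finite_Int inf_commute)
      moreover have "card (e' \<inter> k w) \<le> card (k w \<inter> e)"
        using insert.prems(2) assms(2) by (intro card_mono) auto
      ultimately show ?thesis by linarith
    qed
    have IH1: "rsub q \<Omega> (\<lambda>Y. exp (- a * card (surv k (e' - k w) Y))) \<le> exp (- a * card (e' - k w)) * ?S"
      using insert.prems by (intro insert.IH) auto
    have IH2: "rsub q \<Omega> (\<lambda>Y. exp (- a * card (surv k e' Y))) \<le> exp (- a * card e') * ?S"
      using insert.prems by (intro insert.IH) auto
    have "exp (- a * card (e' - k w)) \<le> exp (- a * card e' + a * ?c w)"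
      using mult_left_mono[OF c assms(4)] by (simp add: algebra_simps)
    then have b1: "rsub q \<Omega> (\<lambda>Y. exp (- a * card (surv k (e' - k w) Y))) \<le> exp (- a * card e') * exp (a * ?c w) * ?S"
      using IH1 by (smt (verit) exp_add mult_right_mono exp_ge_zero)
    have "rsub q (insert w \<Omega>) (\<lambda>Y. exp (- a * card (surv k e' Y))) =
        q w * rsub q \<Omega> (\<lambda>Y. exp (- a * card (surv k (e' - k w) Y))) + (1 - q w) * rsub q \<Omega> (\<lambda>Y. exp (- a * card (surv k e' Y)))"
      using insert.hyps by (simp add: rsub_insert surv_insert)
    also have "\<dots> \<le> q w * (exp (- a * card e') * exp (a * ?c w) * ?S) + (1 - q w) * (exp (- a * card e') * ?S)"
      using q b1 IH2 by (intro add_mono mult_left_mono) auto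
    also have "\<dots> = (1 + q w * (exp (a * ?c w) - 1)) * (exp (- a * card e') * ?S)"
      by (simp add: algebra_simps)
    also have "\<dots> \<le> exp (q w * (exp (a * ?c w) - 1)) * (exp (- a * card e') * ?S)"
      by (intro mult_right_mono exp_ge_add_one_self) auto
    also have "\<dots> = exp (- a * card e') * exp (\<Sum>u\<in>insert w \<Omega>. q u * (exp (a * ?c u) - 1))"
      using insert.hyps by (simp add: exp_add)
    finally show ?case .
  qed
  \<comment> \<open>Double counting moves the first-order part of the exponent from the killers to
    the elements they kill.\<close>
  have dc: "(\<Sum>A\<in>e. \<Sum>w | w \<in> \<Omega> \<and> A \<in> k w. q w) = (\<Sum>w\<in>\<Omega>. q w * ?c w)"
  proof -
    have "(\<Sum>A\<in>e. \<Sum>w | w \<in> \<Omega> \<and> A \<in> k w. q w) = (\<Sum>A\<in>e. \<Sum>w\<in>\<Omega>. if A \<in> k w then q w else 0)"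
      using assms(1) by (intro sum.cong[OF refl] sum.inter_filter) auto
    also have "\<dots> = (\<Sum>w\<in>\<Omega>. \<Sum>A\<in>e. if A \<in> k w then q w else 0)" by (rule sum.swap)
    also have "\<dots> = (\<Sum>w\<in>\<Omega>. q w * ?c w)"
      using assms(2) by (intro sum.cong refl) (simp add: sum.If_cases Int_commute)
    finally show ?thesis .
  qed
  have "- a * card e + (\<Sum>w\<in>\<Omega>. q w * (exp (a * ?c w) - 1)) =
      - a * (\<Sum>A\<in>e. 1 - (\<Sum>w | w \<in> \<Omega> \<and> A \<in> k w. q w)) + (\<Sum>w\<in>\<Omega>. q w * (exp (a * ?c w) - 1 - a * ?c w))"
  proof -
    have "(\<Sum>w\<in>\<Omega>. q w * (exp (a * ?c w) - 1)) = (\<Sum>w\<in>\<Omega>. q w * (exp (a * ?c w) - 1 - a * ?c w)) + a * (\<Sum>w\<in>\<Omega>. q w * ?c w)"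
      unfolding sum_distrib_left sum.distrib[symmetric] by (intro sum.cong[OF refl]) (simp add: algebra_simps)
    then show ?thesis unfolding sum_subtractf dc by (simp add: right_diff_distrib)
  qed
  then show ?thesis using main[OF order_refl] by (simp add: exp_add[symmetric])
qed

lemma one_minus_exp_neg_ge: "x - x\<^sup>2 / 2 \<le> 1 - exp (- x)" if "0 \<le> x" for x :: real
proof -
  define f where "f = (\<lambda>x::real. 1 - exp (- x) - x + x\<^sup>2 / 2)"
  have "f 0 \<le> f x"
  proof (rule DERIV_nonneg_imp_nondecreasing[OF that])
    fix y :: real assume y: "0 \<le> y" "y \<le> x"
    have "(f has_real_derivative exp (- y) - 1 + y) (at y)"
      unfolding f_def by (auto intro!: derivative_eq_intros)
    moreover have "0 \<le> exp (- y) - 1 + y" using exp_ge_add_one_self[of "- y"] by simp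
    ultimately show "\<exists>z. (f has_real_derivative z) (at y) \<and> 0 \<le> z" by blast
  qed
  then show ?thesis by (simp add: f_def)
qed

lemma surv_upper_tail:
  fixes b :: real
  assumes "finite \<Omega>" "finite e" "\<And>w. w \<in> \<Omega> \<Longrightarrow> 0 \<le> q w \<and> q w \<le> 1" "0 \<le> b"
    and \<theta>: "\<And>A. A \<in> e \<Longrightarrow> (\<Sum>w | w \<in> \<Omega> \<and> A \<in> k w. q w) \<le> \<theta>" "0 \<le> \<theta>" "\<theta> \<le> 1"
  shows "rsub q \<Omega> (\<lambda>Y. exp (b * card (surv k e Y))) \<le>
    exp (b * (\<Sum>A\<in>e. 1 - (1 - \<theta>) * (\<Sum>w | w \<in> \<Omega> \<and> A \<in> k w. q w)) +
      b\<^sup>2 / 2 * (\<Sum>w\<in>\<Omega>. q w * (card (k w \<inter> e))\<^sup>2))"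
  using assms
proof (induction \<Omega> arbitrary: e rule: finite_induct)
  case empty
  then show ?case by (simp add: surv_def)
next
  case (insert w \<Omega>)
  have q: "0 \<le> q w" "q w \<le> 1" using insert.prems(2) by auto
  have q\<Omega>: "0 \<le> q v \<and> q v \<le> 1" if "v \<in> \<Omega>" for v using insert.prems(2) that by auto
  \<comment> \<open>\<open>v A\<close> stands in for the survival probability of \<open>A\<close>.
    As \<open>v A \<ge> 1 - \<theta>\<close>, removing \<open>k w\<close> lowers the sum of
    \<open>v\<close> by at least \<open>1 - \<theta>\<close> per element; the factor
    \<open>1 - \<theta>\<close> inside \<open>v\<close> is what makes this gain match the increase
    of \<open>v\<close> when \<open>w\<close> is dropped.\<close>
  define v where "v A = 1 - (1 - \<theta>) * (\<Sum>w | w \<in> \<Omega> \<and> A \<in> k w. q w)" for A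
  have sub: "(\<Sum>u | u \<in> \<Omega> \<and> A \<in> k u. q u) \<le> (\<Sum>u | u \<in> insert w \<Omega> \<and> A \<in> k u. q u)" for A
  proof (rule sum_mono2)
    show "finite {u \<in> insert w \<Omega>. A \<in> k u}" using insert.hyps(1) by simp
  qed (use insert.prems(2) in auto)
  have \<theta>': "(\<Sum>w | w \<in> \<Omega> \<and> A \<in> k w. q w) \<le> \<theta>" if "A \<in> e" for A
    using insert.prems(4)[OF that] sub[of A] by linarith
  have v_ge: "1 - \<theta> \<le> v A" if "A \<in> e" for A
  proof -
    have "(1 - \<theta>) * (\<Sum>w | w \<in> \<Omega> \<and> A \<in> k w. q w) \<le> 1 * (\<Sum>w | w \<in> \<Omega> \<and> A \<in> k w. q w)"
      using insert.prems(5) q\<Omega> by (intro mult_right_mono sum_nonneg) auto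
    then show ?thesis using \<theta>'[OF that] by (simp add: v_def)
  qed
  let ?c = "real (card (k w \<inter> e))"
  let ?S = "exp (b\<^sup>2 / 2 * (\<Sum>w\<in>\<Omega>. q w * (card (k w \<inter> e))\<^sup>2))"
  have IH2: "rsub q \<Omega> (\<lambda>Y. exp (b * card (surv k e Y))) \<le> exp (b * (\<Sum>A\<in>e. v A)) * ?S"
    using insert.IH[OF insert.prems(1) q\<Omega> insert.prems(3) \<theta>' insert.prems(5,6)] by (simp add: exp_add v_def)
  have IH1: "rsub q \<Omega> (\<lambda>Y. exp (b * card (surv k (e - k w) Y))) \<le> exp (b * (\<Sum>A\<in>e - k w. v A)) * ?S"
  proof -
    have "rsub q \<Omega> (\<lambda>Y. exp (b * card (surv k (e - k w) Y))) \<le> exp (b * (\<Sum>A\<in>e - k w. v A) +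
        b\<^sup>2 / 2 * (\<Sum>w'\<in>\<Omega>. q w' * (card (k w' \<inter> (e - k w)))\<^sup>2))"
      unfolding v_def by (rule insert.IH[OF _ q\<Omega> insert.prems(3) \<theta>' insert.prems(5,6)]) (use insert.prems(1) in auto)
    also have "\<dots> \<le> exp (b * (\<Sum>A\<in>e - k w. v A) + b\<^sup>2 / 2 * (\<Sum>w\<in>\<Omega>. q w * (card (k w \<inter> e))\<^sup>2))"
      using q\<Omega> insert.prems(1)
      by (intro iffD2[OF exp_le_cancel_iff] add_left_mono mult_left_mono sum_mono of_nat_mono power_mono card_mono) auto
    finally show ?thesis by (simp add: exp_add)
  qed
  have split: "(\<Sum>A\<in>e. v A) = (\<Sum>A\<in>e - k w. v A) + (\<Sum>A\<in>k w \<inter> e. v A)"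
    using sum.Int_Diff[OF insert.prems(1), of v "k w"] by (simp add: Int_commute)
  have "(1 - \<theta>) * ?c \<le> (\<Sum>A\<in>k w \<inter> e. v A)"
    using sum_mono[of "k w \<inter> e" "\<lambda>_. 1 - \<theta>" v] v_ge by (simp add: mult.commute)
  then have "b * ((1 - \<theta>) * ?c) \<le> b * (\<Sum>A\<in>k w \<inter> e. v A)"
    using insert.prems(3) by (rule mult_left_mono)
  then have "exp (b * (\<Sum>A\<in>e - k w. v A)) \<le> exp (b * (\<Sum>A\<in>e. v A) - b * (1 - \<theta>) * ?c)"
    unfolding split by (simp add: distrib_left mult.assoc)
  also have "\<dots> = exp (b * (\<Sum>A\<in>e. v A)) * exp (- (b * (1 - \<theta>) * ?c))"
    by (simp add: exp_add[symmetric])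
  finally have k1: "exp (b * (\<Sum>A\<in>e - k w. v A)) \<le> exp (b * (\<Sum>A\<in>e. v A)) * exp (- (b * (1 - \<theta>) * ?c))" .
  let ?x = "b * (1 - \<theta>) * ?c"
  have x0: "0 \<le> ?x" using insert.prems(3,6) by simp
  have xle: "?x \<le> b * ?c"
  proof -
    have "b * (1 - \<theta>) \<le> b * 1" using insert.prems(3,5) by (intro mult_left_mono) auto
    then show ?thesis using mult_right_mono[of "b * (1 - \<theta>)" "b * 1" ?c] by simp
  qed
  have x2: "?x - (b * ?c)\<^sup>2 / 2 \<le> 1 - exp (- ?x)"
    using one_minus_exp_neg_ge[OF x0] power_mono[OF xle x0, of 2] by linarith
  have "rsub q (insert w \<Omega>) (\<lambda>Y. exp (b * card (surv k e Y))) =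
      q w * rsub q \<Omega> (\<lambda>Y. exp (b * card (surv k (e - k w) Y))) + (1 - q w) * rsub q \<Omega> (\<lambda>Y. exp (b * card (surv k e Y)))"
    using insert.hyps by (simp add: rsub_insert surv_insert)
  also have "\<dots> \<le> q w * (exp (b * (\<Sum>A\<in>e. v A)) * exp (- ?x) * ?S) + (1 - q w) * (exp (b * (\<Sum>A\<in>e. v A)) * ?S)"
    using q by (intro add_mono mult_left_mono IH2 order_trans[OF IH1 mult_right_mono[OF k1]]) simp_all
  also have "\<dots> = (1 + - (q w * (1 - exp (- ?x)))) * (exp (b * (\<Sum>A\<in>e. v A)) * ?S)"
    by (simp add: algebra_simps)
  also have "\<dots> \<le> exp (- (q w * (1 - exp (- ?x)))) * (exp (b * (\<Sum>A\<in>e. v A)) * ?S)"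
    by (intro mult_right_mono exp_ge_add_one_self) auto
  also have "\<dots> \<le> exp (- (q w * (?x - (b * ?c)\<^sup>2 / 2))) * (exp (b * (\<Sum>A\<in>e. v A)) * ?S)"
    using x2 q by (intro mult_right_mono) (auto intro!: mult_left_mono)
  also have "\<dots> = exp (b * ((\<Sum>A\<in>e. v A) - (1 - \<theta>) * q w * ?c) +
      b\<^sup>2 / 2 * (\<Sum>u\<in>insert w \<Omega>. q u * (card (k u \<inter> e))\<^sup>2))"
  proof -
    have "b\<^sup>2 / 2 * (\<Sum>u\<in>insert w \<Omega>. q u * (card (k u \<inter> e))\<^sup>2) =
        q w * ((b * ?c)\<^sup>2 / 2) + b\<^sup>2 / 2 * (\<Sum>u\<in>\<Omega>. q u * (card (k u \<inter> e))\<^sup>2)"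
      using insert.hyps by (simp add: distrib_left power_mult_distrib)
    moreover have *: "- (q w * (b * (1 - \<theta>) * c - (b * c)\<^sup>2 / 2)) + (b * V + S) =
        b * (V - (1 - \<theta>) * q w * c) + (q w * ((b * c)\<^sup>2 / 2) + S)" for c V S :: real
      by (simp add: algebra_simps)
    ultimately show ?thesis
      unfolding exp_add[symmetric] by (simp only: *)
  qed
  also have "(\<Sum>A\<in>e. v A) - (1 - \<theta>) * q w * ?c = (\<Sum>A\<in>e. 1 - (1 - \<theta>) * (\<Sum>u | u \<in> insert w \<Omega> \<and> A \<in> k u. q u))"
  proof -
    have s: "(\<Sum>w' | w' \<in> insert w \<Omega> \<and> A \<in> k w'. q w') = (\<Sum>w' | w' \<in> \<Omega> \<and> A \<in> k w'. q w') + (if A \<in> k w then q w else 0)" for A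
    proof (cases "A \<in> k w")
      case True
      then have "{w' \<in> insert w \<Omega>. A \<in> k w'} = insert w {w'\<in>\<Omega>. A \<in> k w'}" by auto
      then show ?thesis using True insert.hyps by simp
    next
      case False
      then have "{w' \<in> insert w \<Omega>. A \<in> k w'} = {w'\<in>\<Omega>. A \<in> k w'}" by auto
      then show ?thesis using False by simp
    qed
    have "(\<Sum>A\<in>e. if A \<in> k w then q w else 0) = q w * ?c"
      using insert.prems(1) by (simp add: sum.If_cases Int_commute)
    then have "(\<Sum>A\<in>e. (1 - \<theta>) * (if A \<in> k w then q w else 0)) = (1 - \<theta>) * (q w * ?c)"
      by (simp only: sum_distrib_left[symmetric])
    then show ?thesis
      unfolding s v_def by (simp add: distrib_left sum_subtractf sum.distrib)
  qed
  finally show ?case by simp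
qed

section \<open>A semi-random construction of independent sets\<close>

lemma rsub_cong_prob:
  assumes "\<And>w. w \<in> \<Omega> \<Longrightarrow> q w = q' w"
  shows "rsub q \<Omega> f = rsub q' \<Omega> f"
  unfolding rsub_def
proof (rule sum.cong[OF refl])
  fix Y assume "Y \<in> Pow \<Omega>"
  then have "(\<Prod>w\<in>Y. q w) = (\<Prod>w\<in>Y. q' w)" "(\<Prod>w\<in>\<Omega> - Y. 1 - q w) = (\<Prod>w\<in>\<Omega> - Y. 1 - q' w)"
    using assms by (auto intro!: prod.cong)
  then show "(\<Prod>w\<in>Y. q w) * (\<Prod>w\<in>\<Omega> - Y. 1 - q w) * f Y = (\<Prod>w\<in>Y. q' w) * (\<Prod>w\<in>\<Omega> - Y. 1 - q' w) * f Y"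
    by simp
qed

text \<open>The survival probability is the product of the \<open>1 - q w\<close> over the killers
  of \<open>A\<close>, and each factor is at most \<open>exp (- q w)\<close>.\<close>

lemma surv_prob:
  assumes "finite \<Omega>" "\<And>w. w \<in> \<Omega> \<Longrightarrow> 0 \<le> q w \<and> q w \<le> 1"
  shows "rsub q \<Omega> (\<lambda>Y. if \<forall>w\<in>Y. A \<notin> k w then 1 else 0) \<le> exp (- (\<Sum>w | w \<in> \<Omega> \<and> A \<in> k w. q w))"
  using assms
proof (induction \<Omega> rule: finite_induct)
  case empty
  then show ?case by simp
next
  case (insert w \<Omega>)
  let ?f = "\<lambda>Y. if \<forall>w\<in>Y. A \<notin> k w then 1 else (0::real)"
  let ?s = "\<Sum>u | u \<in> \<Omega> \<and> A \<in> k u. q u"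
  have q: "0 \<le> q w" "q w \<le> 1" using insert.prems by auto
  have IH: "rsub q \<Omega> ?f \<le> exp (- ?s)" using insert by simp
  show ?case
  proof (cases "A \<in> k w")
    case True
    have "{u. u \<in> insert w \<Omega> \<and> A \<in> k u} = insert w {u. u \<in> \<Omega> \<and> A \<in> k u}" using True by auto
    then have s: "(\<Sum>u | u \<in> insert w \<Omega> \<and> A \<in> k u. q u) = q w + ?s" using insert.hyps by simp
    have "rsub q (insert w \<Omega>) ?f = q w * rsub q \<Omega> (\<lambda>_. 0) + (1 - q w) * rsub q \<Omega> ?f"
      using True insert.hyps by (simp add: rsub_insert)
    also have "\<dots> = (1 + - q w) * rsub q \<Omega> ?f" using insert.hyps by (simp add: rsub_const)
    also have "\<dots> \<le> (1 + - q w) * exp (- ?s)" using q by (intro mult_left_mono[OF IH]) simp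
    also have "\<dots> \<le> exp (- q w) * exp (- ?s)" by (intro mult_right_mono exp_ge_add_one_self) simp
    finally show ?thesis unfolding s by (simp add: exp_add[symmetric])
  next
    case False
    then have s: "{u. u \<in> insert w \<Omega> \<and> A \<in> k u} = {u. u \<in> \<Omega> \<and> A \<in> k u}" by auto
    have "rsub q (insert w \<Omega>) ?f = q w * rsub q \<Omega> ?f + (1 - q w) * rsub q \<Omega> ?f"
      using False insert.hyps by (simp add: rsub_insert)
    then show ?thesis unfolding s using IH by (simp add: algebra_simps)
  qed
qed

lemma exp_minus_one_minus_le: "exp y - 1 - y \<le> y\<^sup>2 / 2 * exp y" if "0 \<le> y" for y :: real
proof -
  define f where "f = (\<lambda>y::real. y\<^sup>2 / 2 * exp y - exp y + 1 + y)"
  have "f 0 \<le> f y"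
  proof (rule DERIV_nonneg_imp_nondecreasing[OF that])
    fix z :: real assume z: "0 \<le> z" "z \<le> y"
    have df: "(f has_real_derivative (z * exp z + z\<^sup>2 / 2 * exp z - exp z + 1)) (at z)"
      unfolding f_def by (auto intro!: derivative_eq_intros simp: algebra_simps)
    have "exp z * (1 - z) \<le> 1"
    proof -
      have "1 - z \<le> exp (- z)" using exp_ge_add_one_self[of "- z"] by simp
      then have "exp z * (1 - z) \<le> exp z * exp (- z)" by (intro mult_left_mono) auto
      then show ?thesis by (simp add: exp_add[symmetric])
    qed
    moreover have "0 \<le> z\<^sup>2 / 2 * exp z" by simp
    ultimately have "0 \<le> z * exp z + z\<^sup>2 / 2 * exp z - exp z + 1"
      by (simp only: right_diff_distrib mult.commute[of "exp z"] mult_1_left)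
    with df show "\<exists>d. (f has_real_derivative d) (at z) \<and> 0 \<le> d" by blast
  qed
  then show ?thesis by (simp add: f_def)
qed

text \<open>\<open>N\<close> is the neighbourhood function of a graph of degree at most
  \<open>D\<close>; the \<open>e T\<close> are independent sets of size \<open>K\<close>, to be hit
  evenly by the chosen set. \<open>S\<close> and \<open>S'\<close> express local sparsity through
  squared codegrees. \<open>x\<close> is the exponential weight of a chosen element of an
  \<open>e T\<close>, \<open>b0\<close> the initial weight of a degree, \<open>\<epsilon>\<close>
  the tolerance for degrees, \<open>\<sigma>\<close> the second-order loss granted per round and
  \<open>E0\<close> a cap on exponents.\<close>

locale nibble =
  fixes U :: "'a set" and N :: "'a \<Rightarrow> 'a set" and TT :: "'t set" and e :: "'t \<Rightarrow> 'a set"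
    and D K S S' \<theta> \<epsilon> x b0 \<rho> \<sigma> E0 :: real and L :: nat
  assumes finU: "finite U" and finT: "finite TT"
    and N_sub: "\<And>A. A \<in> U \<Longrightarrow> N A \<subseteq> U"
    and N_sym: "\<And>A B. A \<in> U \<Longrightarrow> B \<in> U \<Longrightarrow> B \<in> N A \<longleftrightarrow> A \<in> N B"
    and N_card: "\<And>A. A \<in> U \<Longrightarrow> card (N A) \<le> D"
    and e_sub: "\<And>T. T \<in> TT \<Longrightarrow> e T \<subseteq> U"
    and e_card: "\<And>T. T \<in> TT \<Longrightarrow> card (e T) = K"
    and e_indep: "\<And>T A B. T \<in> TT \<Longrightarrow> A \<in> e T \<Longrightarrow> B \<in> e T \<Longrightarrow> B \<notin> N A"
    and S: "\<And>T. T \<in> TT \<Longrightarrow> (\<Sum>B\<in>U. (real (card (N B \<inter> e T)))\<^sup>2) \<le> S"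
    and S': "\<And>A. A \<in> U \<Longrightarrow> (\<Sum>B\<in>U. (real (card (N B \<inter> N A)))\<^sup>2) \<le> S'"
    and D_pos: "0 < D" and K_nn: "0 \<le> K" and \<theta>: "0 < \<theta>" "\<theta> \<le> 1 / 2" and \<epsilon>: "0 < \<epsilon>" and x: "0 \<le> x"
    and b0: "0 \<le> b0" and \<rho>: "0 \<le> \<rho>" "\<rho> \<le> 1" and \<sigma>: "0 \<le> \<sigma>"
begin

text \<open>In each round an element survives with probability about \<open>1 - \<theta> \<le> \<omega>\<close>. In round \<open>i\<close> all degrees
  are at most \<open>Dg i\<close> and elements are selected with probability \<open>p i\<close>; \<open>a\<close>, \<open>r\<close> and \<open>b\<close> are the weights
  of the three parts of the potential below, chosen to satisfy the recursions \<open>a_rec\<close>, \<open>r_rec\<close>, \<open>b_rec\<close>.\<close>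

definition "\<omega> = 1 - \<theta> + \<theta>\<^sup>2"
definition "Dg i = (1 + \<epsilon>) * D * \<omega> ^ i"
definition "p i = \<theta> / Dg i"
definition "x' = 1 - exp (- x)"
definition "\<tau> = (1 - \<theta>) * (1 - \<rho>)"
definition "a i = (\<Sum>l = i..<L. p l * x' * \<tau> ^ (l - i + 1))"
definition "r i = real (L - i) * \<theta> / ((1 + \<epsilon>) * D * \<omega> ^ i)"
definition "b i = b0 / \<omega> ^ i"

text \<open>What one round consumes: valid probabilities;
  \<open>p i + a (Suc i) \<le> \<rho>\<close> for \<open>choice_exponent\<close>; a cap on the
  exponent caused by one killer, which hits at most \<open>Dg i\<close> elements (selection) or one
  (coin); and second-order errors of at most \<open>\<sigma>\<close>, for the edges and for the
  degrees.\<close>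

definition "params \<longleftrightarrow> (\<forall>i<L. p i \<le> 1 \<and> p i + a (Suc i) \<le> \<rho> \<and>
   (let c = (1 - \<rho>) * (a (Suc i) + p i * x') in c * Dg i \<le> E0 \<and> c \<le> E0 \<and> exp E0 / 2 * c\<^sup>2 * (p i * S + \<theta> * K) \<le> \<sigma>) \<and>
   (b (Suc i))\<^sup>2 / 2 * (p i * S' + \<theta> * D) \<le> \<sigma>)"

lemma \<omega>_pos: "0 < \<omega>" and \<omega>_le: "\<omega> \<le> 1"
proof -
  have "\<theta>\<^sup>2 \<le> \<theta> * 1" unfolding power2_eq_square using \<theta> by (intro mult_left_mono) auto
  then show "\<omega> \<le> 1" by (simp add: \<omega>_def)
  show "0 < \<omega>" unfolding \<omega>_def using \<theta> zero_le_power2[of \<theta>] by linarith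
qed

lemma Dg_pos: "0 < Dg i"
  unfolding Dg_def using D_pos \<epsilon> \<omega>_pos by simp

lemma p_pos: "0 < p i"
  unfolding p_def using Dg_pos \<theta> by simp

lemma x'_nn: "0 \<le> x'"
  using x by (simp add: x'_def)

lemma \<tau>_nn: "0 \<le> \<tau>"
  using \<theta> \<rho> by (simp add: \<tau>_def)

lemma a_nn: "0 \<le> a i"
  unfolding a_def using p_pos x'_nn \<tau>_nn by (intro sum_nonneg mult_nonneg_nonneg) (auto intro: less_imp_le)

lemma a_rec: "i < L \<Longrightarrow> a i = \<tau> * (a (Suc i) + p i * x')"
proof -
  assume i: "i < L"
  have "a i = p i * x' * \<tau> ^ (i - i + 1) + (\<Sum>l = Suc i..<L. p l * x' * \<tau> ^ (l - i + 1))"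
    unfolding a_def by (rule sum.atLeast_Suc_lessThan[OF i])
  also have "(\<Sum>l = Suc i..<L. p l * x' * \<tau> ^ (l - i + 1)) = \<tau> * a (Suc i)"
    unfolding a_def sum_distrib_left
  proof (rule sum.cong[OF refl])
    fix l assume "l \<in> {Suc i..<L}"
    then have "l - i + 1 = Suc (l - Suc i + 1)" by auto
    then show "p l * x' * \<tau> ^ (l - i + 1) = \<tau> * (p l * x' * \<tau> ^ (l - Suc i + 1))" by simp
  qed
  finally show ?thesis by (simp add: algebra_simps)
qed

lemma r_rec: "i < L \<Longrightarrow> r i = p i + \<omega> * r (Suc i)"
proof -
  assume i: "i < L"
  then have L: "real (L - i) = 1 + real (L - Suc i)" by simp
  have "\<omega> * r (Suc i) = real (L - Suc i) * \<theta> / ((1 + \<epsilon>) * D * \<omega> ^ i)"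
    using \<omega>_pos by (simp add: r_def)
  moreover have "p i = \<theta> / ((1 + \<epsilon>) * D * \<omega> ^ i)" by (simp add: p_def Dg_def)
  ultimately show ?thesis unfolding r_def L by (simp add: add_divide_distrib distrib_right)
qed

lemma b_rec: "b i = \<omega> * b (Suc i)"
  using \<omega>_pos by (simp add: b_def)

lemma b_nn: "0 \<le> b i"
  using \<omega>_pos b0 by (simp add: b_def)

lemma r_nn: "0 \<le> r i"
  using \<omega>_pos \<theta> \<epsilon> D_pos by (simp add: r_def)

text \<open>The killer \<open>(A, False)\<close> is the selection of \<open>A\<close>, which kills the neighbours of \<open>A\<close>; the killer
  \<open>(A, True)\<close> is a coin flip that kills \<open>A\<close> alone. The coins are biased so that the total
  probability of the killers of any element is exactly \<open>\<theta>\<close>.\<close>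

definition q :: "nat \<Rightarrow> 'a set \<Rightarrow> 'a \<times> bool \<Rightarrow> real" where
  "q i V w = (if snd w then \<theta> - p i * card (N (fst w) \<inter> V) else p i)"

definition k :: "'a \<times> bool \<Rightarrow> 'a set" where
  "k w = (if snd w then {fst w} else N (fst w))"

definition ok :: "nat \<Rightarrow> 'a set \<Rightarrow> bool" where
  "ok i V \<longleftrightarrow> V \<subseteq> U \<and> (\<forall>A\<in>V. card (N A \<inter> V) \<le> Dg i)"

lemma ok_fin: "ok i V \<Longrightarrow> finite V"
  using finU finite_subset ok_def by blast

lemma q_bounds:
  assumes "params" "i < L" "ok i V" "w \<in> V \<times> UNIV"
  shows "0 \<le> q i V w \<and> q i V w \<le> 1"
proof -
  have "p i * card (N (fst w) \<inter> V) \<le> p i * Dg i"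
    using assms p_pos[of i] by (intro mult_left_mono) (auto simp: ok_def)
  also have "\<dots> = \<theta>" using Dg_pos[of i] by (simp add: p_def)
  finally have "p i * card (N (fst w) \<inter> V) \<le> \<theta>" .
  moreover have "0 \<le> p i * card (N (fst w) \<inter> V)" using p_pos[of i] by simp
  moreover have "p i \<le> 1" using assms by (simp add: params_def)
  ultimately show ?thesis using p_pos[of i] \<theta> by (cases "snd w"; simp only: q_def if_True if_False; linarith)
qed

text \<open>By symmetry of \<open>N\<close>, the selections that kill \<open>A\<close> are those of
  its neighbours in \<open>V\<close>; the coin of \<open>A\<close> supplies what is missing to
  \<open>\<theta>\<close>. \<open>W\<close> may omit killers that spare \<open>A\<close>, because
  \<open>step_edge\<close> sets the selections inside an edge aside.\<close>

lemma kill_sum: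
  assumes V: "V \<subseteq> U" and A: "A \<in> V" and W: "\<And>B. B \<in> V \<Longrightarrow> A \<in> N B \<Longrightarrow> (B, False) \<in> W"
    "(A, True) \<in> W" "W \<subseteq> V \<times> UNIV"
  shows "(\<Sum>w | w \<in> W \<and> A \<in> k w. q i V w) = \<theta>"
proof -
  have finV: "finite V" using V finU finite_subset by blast
  have "{w. w \<in> W \<and> A \<in> k w} = insert (A, True) ((\<lambda>B. (B, False)) ` (N A \<inter> V))"
  proof (intro set_eqI iffI)
    fix w assume w: "w \<in> {w. w \<in> W \<and> A \<in> k w}"
    obtain B c where wB: "w = (B, c)" by (cases w)
    have B: "B \<in> V" using w wB W(3) by auto
    show "w \<in> insert (A, True) ((\<lambda>B. (B, False)) ` (N A \<inter> V))"
    proof (cases c)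
      case True
      then show ?thesis using w wB by (simp add: k_def)
    next
      case False
      then have "A \<in> N B" using w wB by (simp add: k_def)
      then have "B \<in> N A" using N_sym[of A B] A B V by blast
      then show ?thesis using wB False B by auto
    qed
  next
    fix w assume "w \<in> insert (A, True) ((\<lambda>B. (B, False)) ` (N A \<inter> V))"
    then consider "w = (A, True)" | B where "w = (B, False)" "B \<in> N A" "B \<in> V" by auto
    then show "w \<in> {w. w \<in> W \<and> A \<in> k w}"
    proof cases
      case 1
      then show ?thesis using W(2) by (simp add: k_def)
    next
      case 2
      then have "A \<in> N B" using N_sym[of A B] A V by blast
      then show ?thesis using 2 W(1) by (simp add: k_def)
    qed
  qed
  moreover have "(A, True) \<notin> (\<lambda>B. (B, False)) ` (N A \<inter> V)" by auto
  moreover have "(\<Sum>w\<in>(\<lambda>B. (B, False)) ` (N A \<inter> V). q i V w) = p i * card (N A \<inter> V)"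
    by (subst sum.reindex) (auto simp: inj_on_def q_def)
  ultimately show ?thesis
    using finV by (simp add: q_def)
qed

text \<open>Selections contribute \<open>p i\<close> times the codegree sum. A coin kills a single
  element, so all coins together contribute at most \<open>\<theta> * card c\<close>.\<close>

lemma sq_sum:
  assumes par: "params" "i < L" "ok i V" and W: "W \<subseteq> V \<times> UNIV" and c: "c \<subseteq> U"
    and s: "(\<Sum>B\<in>U. (real (card (N B \<inter> c)))\<^sup>2) \<le> s"
  shows "(\<Sum>w\<in>W. q i V w * (real (card (k w \<inter> c)))\<^sup>2) \<le> p i * s + \<theta> * card c"
proof -
  have V: "V \<subseteq> U" "finite V" using par(3) ok_fin[OF par(3)] by (simp_all add: ok_def)
  have finc: "finite c" using c finU finite_subset by blast
  have "(\<Sum>w\<in>W. q i V w * (real (card (k w \<inter> c)))\<^sup>2) \<le> (\<Sum>w\<in>V \<times> UNIV. q i V w * (real (card (k w \<inter> c)))\<^sup>2)"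
  proof (rule sum_mono2)
    show "finite (V \<times> (UNIV :: bool set))" using V(2) by simp
    show "0 \<le> q i V w * (real (card (k w \<inter> c)))\<^sup>2" if "w \<in> V \<times> UNIV - W" for w
    proof -
      have "w \<in> V \<times> UNIV" using that by (rule DiffD1)
      from q_bounds[OF par this] show ?thesis by simp
    qed
  qed (rule W)
  also have "\<dots> = (\<Sum>B\<in>V. q i V (B, False) * (real (card (k (B, False) \<inter> c)))\<^sup>2) + (\<Sum>B\<in>V. q i V (B, True) * (real (card (k (B, True) \<inter> c)))\<^sup>2)"
    unfolding sum.cartesian_product' by (simp add: UNIV_bool sum.distrib add.commute)
  also have "(\<Sum>B\<in>V. q i V (B, False) * (real (card (k (B, False) \<inter> c)))\<^sup>2) \<le> p i * s"
  proof -
    have "(\<Sum>B\<in>V. (real (card (N B \<inter> c)))\<^sup>2) \<le> s"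
      using V finU by (intro order_trans[OF sum_mono2 s]) simp_all
    then show ?thesis using p_pos[of i] by (simp add: q_def k_def sum_distrib_left[symmetric])
  qed
  also have "(\<Sum>B\<in>V. q i V (B, True) * (real (card (k (B, True) \<inter> c)))\<^sup>2) \<le> \<theta> * card c"
  proof -
    have "(\<Sum>B\<in>V. q i V (B, True) * (real (card (k (B, True) \<inter> c)))\<^sup>2) \<le> (\<Sum>B\<in>V. if B \<in> c then \<theta> else 0)"
    proof (rule sum_mono)
      fix B assume "B \<in> V"
      have "0 \<le> p i * card (N B \<inter> V)" using p_pos[of i] by simp
      then show "q i V (B, True) * (real (card (k (B, True) \<inter> c)))\<^sup>2 \<le> (if B \<in> c then \<theta> else 0)"
        by (auto simp: q_def k_def)
    qed
    also have "\<dots> = \<theta> * card (V \<inter> c)" using V by (simp add: sum.If_cases)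
    also have "\<dots> \<le> \<theta> * card c" using \<theta> finc by (intro mult_left_mono of_nat_mono card_mono) auto
    finally show ?thesis .
  qed
  finally show ?thesis by simp
qed

text \<open>Every element has total killing probability exactly \<open>\<theta>\<close>, so
  \<open>surv_upper_tail\<close> gives it the factor 1 - (1 - \<theta>) \<theta> = \<omega>. This is
  the origin of the value of \<open>\<omega>\<close> and of the growth of \<open>b\<close>.\<close>

lemma step_degree:
  assumes par: "params" "i < L" "ok i V" and A: "A \<in> U"
  shows "rsub (q i V) (V \<times> UNIV) (\<lambda>Y. exp (b (Suc i) * card (surv k (N A \<inter> V) Y))) \<le> exp (b i * card (N A \<inter> V) + \<sigma>)"
proof -
  have V: "V \<subseteq> U" "finite V" using par(3) ok_fin[OF par(3)] by (simp_all add: ok_def)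
  have ks: "(\<Sum>w | w \<in> V \<times> UNIV \<and> B \<in> k w. q i V w) = \<theta>" if "B \<in> N A \<inter> V" for B
    by (rule kill_sum[OF V(1)]) (use that in auto)
  have "rsub (q i V) (V \<times> UNIV) (\<lambda>Y. exp (b (Suc i) * card (surv k (N A \<inter> V) Y))) \<le>
     exp (b (Suc i) * (\<Sum>B\<in>N A \<inter> V. 1 - (1 - \<theta>) * (\<Sum>w | w \<in> V \<times> UNIV \<and> B \<in> k w. q i V w)) +
      (b (Suc i))\<^sup>2 / 2 * (\<Sum>w\<in>V \<times> UNIV. q i V w * (card (k w \<inter> (N A \<inter> V)))\<^sup>2))"
  proof (rule surv_upper_tail)
    show "(\<Sum>w | w \<in> V \<times> UNIV \<and> B \<in> k w. q i V w) \<le> \<theta>" if "B \<in> N A \<inter> V" for B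
      by (simp only: ks[OF that])
    show "0 \<le> q i V w \<and> q i V w \<le> 1" if "w \<in> V \<times> UNIV" for w by (rule q_bounds[OF par that])
  qed (use \<theta> V b_nn in simp_all)
  also have "(\<Sum>B\<in>N A \<inter> V. 1 - (1 - \<theta>) * (\<Sum>w | w \<in> V \<times> UNIV \<and> B \<in> k w. q i V w)) = (\<Sum>B\<in>N A \<inter> V. \<omega>)"
    by (intro sum.cong[OF refl]) (simp add: ks \<omega>_def algebra_simps power2_eq_square)
  also have "b (Suc i) * (\<Sum>B\<in>N A \<inter> V. \<omega>) = b i * card (N A \<inter> V)"
    by (simp add: b_rec[of i])
  also have "(b (Suc i))\<^sup>2 / 2 * (\<Sum>w\<in>V \<times> UNIV. q i V w * (card (k w \<inter> (N A \<inter> V)))\<^sup>2) \<le> \<sigma>"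
  proof -
    have NA: "finite (N A)" "N A \<subseteq> U" using N_sub[OF A] finU finite_subset by auto
    have "(\<Sum>w\<in>V \<times> UNIV. q i V w * (card (k w \<inter> (N A \<inter> V)))\<^sup>2) \<le> (\<Sum>w\<in>V \<times> UNIV. q i V w * (real (card (k w \<inter> N A)))\<^sup>2)"
    proof (rule sum_mono)
      fix w :: "'a \<times> bool" assume w: "w \<in> V \<times> UNIV"
      have "card (k w \<inter> (N A \<inter> V)) \<le> card (k w \<inter> N A)" using NA by (intro card_mono) auto
      then have "(real (card (k w \<inter> (N A \<inter> V))))\<^sup>2 \<le> (real (card (k w \<inter> N A)))\<^sup>2"
        by (intro power_mono) auto
      then show "q i V w * (card (k w \<inter> (N A \<inter> V)))\<^sup>2 \<le> q i V w * (real (card (k w \<inter> N A)))\<^sup>2"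
        using q_bounds[OF par w] by (simp add: mult_left_mono)
    qed
    also have "\<dots> \<le> p i * S' + \<theta> * card (N A)"
      by (rule sq_sum[OF par order_refl NA(2) S'[OF A]])
    also have "\<dots> \<le> p i * S' + \<theta> * D" using N_card[OF A] \<theta> by simp
    finally have "(b (Suc i))\<^sup>2 / 2 * (\<Sum>w\<in>V \<times> UNIV. q i V w * (card (k w \<inter> (N A \<inter> V)))\<^sup>2) \<le>
      (b (Suc i))\<^sup>2 / 2 * (p i * S' + \<theta> * D)" by (rule mult_left_mono) simp
    then show ?thesis using par unfolding params_def by fastforce
  qed
  finally show ?thesis by simp
qed

lemma step_size:
  assumes par: "params" "i < L" "ok i V"
  shows "rsub (q i V) (V \<times> UNIV) (\<lambda>Y. real (card (surv k V Y))) \<le> \<omega> * card V"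
proof -
  have V: "V \<subseteq> U" "finite V" using par(3) ok_fin[OF par(3)] by (simp_all add: ok_def)
  have "rsub (q i V) (V \<times> UNIV) (\<lambda>Y. real (card (surv k V Y))) =
      rsub (q i V) (V \<times> UNIV) (\<lambda>Y. \<Sum>A\<in>V. if \<forall>w\<in>Y. A \<notin> k w then 1 else 0)"
    using V by (intro rsub_cong) (simp add: surv_def sum.If_cases Int_def)
  also have "\<dots> = (\<Sum>A\<in>V. rsub (q i V) (V \<times> UNIV) (\<lambda>Y. if \<forall>w\<in>Y. A \<notin> k w then 1 else 0))"
    by (rule rsub_sum)
  also have "\<dots> \<le> (\<Sum>A\<in>V. \<omega>)"
  proof (rule sum_mono)
    fix A assume A: "A \<in> V"
    have "rsub (q i V) (V \<times> UNIV) (\<lambda>Y. if \<forall>w\<in>Y. A \<notin> k w then 1 else 0) \<le> exp (- (\<Sum>w | w \<in> V \<times> UNIV \<and> A \<in> k w. q i V w))"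
    proof (rule surv_prob)
      show "0 \<le> q i V w \<and> q i V w \<le> 1" if "w \<in> V \<times> UNIV" for w by (rule q_bounds[OF par that])
    qed (use V in simp)
    also have "(\<Sum>w | w \<in> V \<times> UNIV \<and> A \<in> k w. q i V w) = \<theta>"
      by (rule kill_sum[OF V(1) A]) (use A in auto)
    also have "exp (- \<theta>) \<le> \<omega>"
      using one_minus_exp_neg_ge[of \<theta>] \<theta> zero_le_power2[of \<theta>] unfolding \<omega>_def by linarith
    finally show "rsub (q i V) (V \<times> UNIV) (\<lambda>Y. if \<forall>w\<in>Y. A \<notin> k w then 1 else 0) \<le> \<omega>" .
  qed
  finally show ?thesis by (simp add: mult.commute)
qed

end

section \<open>One round on a single edge, the potential, and the derandomised run\<close>

context nibble
begin

text \<open>A surviving element of an edge is selected with probability \<open>P\<close> and then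
  weighs \<open>exp (- x)\<close>; otherwise it stays and weighs \<open>exp (- c)\<close>. Passing
  to first order in \<open>c\<close> costs at most the factor (1 - P)(1 - c) \<ge> 1 - \<rho> in the
  exponent.\<close>

lemma choice_exponent:
  assumes "0 \<le> P" "P \<le> 1" "0 \<le> c" "P + c \<le> \<rho>"
  shows "P * exp (- x) + (1 - P) * exp (- c) \<le> exp (- ((1 - \<rho>) * (c + P * x')))"
proof -
  have c1: "c \<le> 1" using assms \<rho> by linarith
  have "(1 - \<rho>) * c \<le> (1 - P) * (1 - exp (- c))"
  proof -
    have "c\<^sup>2 / 2 \<le> c * c" by (simp add: power2_eq_square)
    then have "c * (1 - c) \<le> 1 - exp (- c)"
      using one_minus_exp_neg_ge[OF assms(3)] by (simp add: right_diff_distrib)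
    then have "(1 - P) * (c * (1 - c)) \<le> (1 - P) * (1 - exp (- c))"
      using assms(2) by (intro mult_left_mono) auto
    moreover have "(1 - \<rho>) * c \<le> (1 - P) * (c * (1 - c))"
    proof -
      have "1 - \<rho> \<le> (1 - P) * (1 - c)"
        using assms mult_nonneg_nonneg[OF assms(1,3)] by (simp only: left_diff_distrib right_diff_distrib)
      from mult_right_mono[OF this assms(3)] show ?thesis by (simp add: mult_ac)
    qed
    ultimately show ?thesis by linarith
  qed
  moreover have "(1 - \<rho>) * (P * x') \<le> P * x'"
    using \<rho> assms(1) x'_nn by (intro mult_left_le_one_le) auto
  ultimately have "1 + - (P * x' + (1 - P) * (1 - exp (- c))) \<le> exp (- ((1 - \<rho>) * (c + P * x')))"
    by (intro order_trans[OF exp_ge_add_one_self]) (simp add: distrib_left)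
  then show ?thesis by (simp add: x'_def algebra_simps)
qed

text \<open>An edge is independent, so the selections of its own elements (\<open>O1\<close>) never
  kill inside it. Given the killers in \<open>O2\<close>, the surviving part of the edge is
  therefore fixed and its selections are independent, which \<open>choice_exponent\<close>
  evaluates. Then \<open>surv_lower_tail\<close> averages over \<open>O2\<close>, where each element
  of the edge still has total killing probability \<open>\<theta>\<close>. The losses
  \<open>1 - \<rho>\<close> and \<open>1 - \<theta>\<close> of the two stages multiply to
  \<open>\<tau>\<close>.\<close>

lemma step_edge:
  assumes par: "params" "i < L" "ok i V" and T: "T \<in> TT"
  shows "rsub (q i V) (V \<times> UNIV) (\<lambda>Y. exp (- x * card {A \<in> surv k V Y \<inter> e T. (A, False) \<in> Y} -
      a (Suc i) * card {A \<in> surv k V Y \<inter> e T. (A, False) \<notin> Y})) \<le> exp (- a i * card (V \<inter> e T) + \<sigma>)"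
proof -
  have V: "V \<subseteq> U" "finite V" using par(3) ok_fin[OF par(3)] by (simp_all add: ok_def)
  have eU: "e T \<subseteq> U" and fe: "finite (e T)" using e_sub[OF T] finU finite_subset by auto
  define g where "g = V \<inter> e T"
  have fg: "finite g" using V by (simp add: g_def)
  define O1 where "O1 = g \<times> {False}"
  define O2 where "O2 = V \<times> UNIV - O1"
  have un: "V \<times> UNIV = O2 \<union> O1" "O2 \<inter> O1 = {}" by (auto simp: O1_def O2_def g_def)
  have fin: "finite O1" "finite O2" using V fg by (auto simp: O1_def O2_def)
  define c where "c = (1 - \<rho>) * (a (Suc i) + p i * x')"
  have c_nn: "0 \<le> c" unfolding c_def using \<rho> a_nn[of "Suc i"] p_pos[of i] x'_nn by (intro mult_nonneg_nonneg add_nonneg_nonneg) auto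
  have cE: "c * Dg i \<le> E0" "c \<le> E0" "exp E0 / 2 * c\<^sup>2 * (p i * S + \<theta> * K) \<le> \<sigma>" and pa: "p i \<le> 1" "p i + a (Suc i) \<le> \<rho>"
    using par(1,2) unfolding params_def c_def Let_def by auto
  define f where "f Y = exp (- x * card {A \<in> surv k V Y \<inter> e T. (A, False) \<in> Y} -
      a (Suc i) * card {A \<in> surv k V Y \<inter> e T. (A, False) \<notin> Y})" for Y
  have inner: "rsub (q i V) O1 (\<lambda>Z. f (Y \<union> Z)) \<le> exp (- c * card (surv k g Y))" if Y: "Y \<subseteq> O2" for Y
  proof -
    define G where "G = surv k g Y"
    have G: "G \<subseteq> g" "finite G" using surv_subset[of k g Y] fg finite_subset unfolding G_def by auto
    let ?u = "\<lambda>w::'a \<times> bool. if fst w \<in> G then exp (- x) else 1"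
    let ?v = "\<lambda>w::'a \<times> bool. if fst w \<in> G then exp (- a (Suc i)) else 1"
    have fY: "f (Y \<union> Z) = (\<Prod>w\<in>O1. if w \<in> Z then ?u w else ?v w)" if Z: "Z \<subseteq> O1" for Z
    proof -
      have nk: "A \<notin> k w" if "w \<in> Z" "A \<in> e T" for w A
      proof -
        have "w \<in> O1" using that(1) Z by blast
        then obtain B where "w = (B, False)" "B \<in> e T" by (auto simp: O1_def g_def)
        then show ?thesis using e_indep[OF T, of B A] that(2) by (simp add: k_def)
      qed
      have s: "surv k V (Y \<union> Z) \<inter> e T = G"
        unfolding G_def surv_def g_def using nk by blast
      have m: "(A, False) \<in> Y \<union> Z \<longleftrightarrow> (A, False) \<in> Z" if "A \<in> G" for A
        using that G(1) Y by (auto simp: O1_def O2_def)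
      have "(\<Prod>w\<in>O1. if w \<in> Z then ?u w else ?v w) = (\<Prod>A\<in>g. if (A, False) \<in> Z then ?u (A, False) else ?v (A, False))"
        unfolding O1_def prod.cartesian_product' by simp
      also have "\<dots> = (\<Prod>A\<in>G. if (A, False) \<in> Z then exp (- x) else exp (- a (Suc i)))"
        using G fg by (intro prod.mono_neutral_cong_right) auto
      also have "\<dots> = (\<Prod>A\<in>{A\<in>G. (A, False) \<in> Z}. exp (- x)) * (\<Prod>A\<in>{A\<in>G. (A, False) \<notin> Z}. exp (- a (Suc i)))"
        using G(2) by (simp add: prod.If_cases Int_def)
      also have "\<dots> = exp (- x * card {A\<in>G. (A, False) \<in> Z} - a (Suc i) * card {A\<in>G. (A, False) \<notin> Z})"
        by (simp add: exp_diff exp_minus field_simps flip: exp_of_nat_mult)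
      also have "\<dots> = f (Y \<union> Z)"
      proof -
        have "{A\<in>G. (A, False) \<in> Y \<union> Z} = {A\<in>G. (A, False) \<in> Z}" "{A\<in>G. (A, False) \<notin> Y \<union> Z} = {A\<in>G. (A, False) \<notin> Z}"
          using m by blast+
        then show ?thesis unfolding f_def s by simp
      qed
      finally show ?thesis ..
    qed
    have "rsub (q i V) O1 (\<lambda>Z. f (Y \<union> Z)) = rsub (\<lambda>_. p i) O1 (\<lambda>Z. f (Y \<union> Z))"
      by (rule rsub_cong_prob) (auto simp: O1_def q_def)
    also have "\<dots> = rsub (\<lambda>_. p i) O1 (\<lambda>Z. \<Prod>w\<in>O1. if w \<in> Z then ?u w else ?v w)"
      by (rule rsub_cong[OF fY])
    also have "\<dots> = (\<Prod>w\<in>O1. p i * ?u w + (1 - p i) * ?v w)"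
      by (rule rsub_prod[OF fin(1)])
    also have "\<dots> = (\<Prod>A\<in>g. p i * ?u (A, False) + (1 - p i) * ?v (A, False))"
      unfolding O1_def prod.cartesian_product' by simp
    also have "\<dots> = (\<Prod>A\<in>G. p i * exp (- x) + (1 - p i) * exp (- a (Suc i)))"
      using G fg by (intro prod.mono_neutral_cong_right) auto
    also have "\<dots> \<le> (\<Prod>A\<in>G. exp (- c))"
    proof (rule prod_mono, intro conjI)
      show "0 \<le> p i * exp (- x) + (1 - p i) * exp (- a (Suc i))"
        using p_pos[of i] pa(1) by (intro add_nonneg_nonneg mult_nonneg_nonneg) auto
      show "p i * exp (- x) + (1 - p i) * exp (- a (Suc i)) \<le> exp (- c)"
        unfolding c_def using choice_exponent[OF _ pa(1) a_nn pa(2)] p_pos[of i] by simp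
    qed
    also have "\<dots> = exp (- c * card G)" by (simp flip: exp_of_nat_mult add: mult.commute)
    finally show ?thesis by (simp only: G_def)
  qed
  have qb: "0 \<le> q i V w \<and> q i V w \<le> 1" if "w \<in> O2" for w
    using q_bounds[OF par, of w] that un(1) by blast
  have ks: "(\<Sum>w | w \<in> O2 \<and> A \<in> k w. q i V w) = \<theta>" if A: "A \<in> g" for A
  proof (rule kill_sum[OF V(1)])
    show "A \<in> V" using A by (simp add: g_def)
    then show "(A, True) \<in> O2" by (simp add: O1_def O2_def)
    show "O2 \<subseteq> V \<times> UNIV" by (simp add: O2_def Diff_subset)
    show "(B, False) \<in> O2" if "B \<in> V" "A \<in> N B" for B
      using that A e_indep[OF T, of B A] by (auto simp: O1_def O2_def g_def)
  qed
  have cw: "c * card (k w \<inter> g) \<le> E0" if w: "w \<in> O2" for w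
  proof -
    have wV: "fst w \<in> V" using w by (auto simp: O2_def)
    show ?thesis
    proof (cases "snd w")
      case True
      have "card (k w \<inter> g) \<le> card {fst w}" using True by (intro card_mono) (auto simp: k_def)
      then have "real (card (k w \<inter> g)) \<le> 1" by simp
      then show ?thesis using mult_left_mono[OF _ c_nn, of "real (card (k w \<inter> g))" 1] cE(2) by simp
    next
      case False
      have "card (k w \<inter> g) \<le> card (N (fst w) \<inter> V)"
        using False V by (intro card_mono) (auto simp: k_def g_def)
      also have "real \<dots> \<le> Dg i" using par(3) wV by (simp add: ok_def)
      finally have "real (card (k w \<inter> g)) \<le> Dg i" by simp
      then show ?thesis using mult_left_mono[OF _ c_nn] cE(1) by fastforce
    qed
  qed
  have "rsub (q i V) (V \<times> UNIV) f = rsub (q i V) O2 (\<lambda>Y. rsub (q i V) O1 (\<lambda>Z. f (Y \<union> Z)))"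
    unfolding un(1) by (rule rsub_union[OF fin(2,1) un(2)])
  also have "\<dots> \<le> rsub (q i V) O2 (\<lambda>Y. exp (- c * card (surv k g Y)))"
    by (rule rsub_mono[OF qb inner])
  also have "\<dots> \<le> exp (- c * (\<Sum>A\<in>g. 1 - (\<Sum>w | w \<in> O2 \<and> A \<in> k w. q i V w)) +
      (\<Sum>w\<in>O2. q i V w * (exp (c * card (k w \<inter> g)) - 1 - c * card (k w \<inter> g))))"
    by (rule surv_lower_tail[OF fin(2) fg qb c_nn])
  also have "(\<Sum>A\<in>g. 1 - (\<Sum>w | w \<in> O2 \<and> A \<in> k w. q i V w)) = (\<Sum>A\<in>g. 1 - \<theta>)"
    by (rule sum.cong[OF refl]) (simp add: ks)
  also have "- c * (\<Sum>A\<in>g. 1 - \<theta>) = - a i * card g"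
    unfolding a_rec[OF par(2)] c_def \<tau>_def by simp
  also have "(\<Sum>w\<in>O2. q i V w * (exp (c * card (k w \<inter> g)) - 1 - c * card (k w \<inter> g))) \<le> \<sigma>"
  proof -
    have "(\<Sum>w\<in>O2. q i V w * (exp (c * card (k w \<inter> g)) - 1 - c * card (k w \<inter> g))) \<le>
       (\<Sum>w\<in>O2. (exp E0 / 2 * c\<^sup>2) * (q i V w * (real (card (k w \<inter> e T)))\<^sup>2))"
    proof (rule sum_mono)
      fix w assume w: "w \<in> O2"
      let ?y = "c * card (k w \<inter> g)"
      have y: "0 \<le> ?y" using c_nn by simp
      have "?y\<^sup>2 \<le> c\<^sup>2 * (real (card (k w \<inter> e T)))\<^sup>2"
        unfolding power_mult_distrib using fe
        by (intro mult_left_mono power_mono of_nat_mono card_mono) (auto simp: g_def)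
      then have "?y\<^sup>2 / 2 * exp ?y \<le> (c\<^sup>2 * (real (card (k w \<inter> e T)))\<^sup>2) / 2 * exp E0"
        using cw[OF w] by (intro mult_mono divide_right_mono) auto
      then have "exp ?y - 1 - ?y \<le> exp E0 / 2 * c\<^sup>2 * (real (card (k w \<inter> e T)))\<^sup>2"
        using exp_minus_one_minus_le[OF y] by (simp add: mult_ac)
      from mult_left_mono[OF this, of "q i V w"] qb[OF w]
      show "q i V w * (exp ?y - 1 - ?y) \<le> (exp E0 / 2 * c\<^sup>2) * (q i V w * (real (card (k w \<inter> e T)))\<^sup>2)"
        by (simp only: mult_ac)
    qed
    also have "\<dots> = (exp E0 / 2 * c\<^sup>2) * (\<Sum>w\<in>O2. q i V w * (real (card (k w \<inter> e T)))\<^sup>2)"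
      by (rule sum_distrib_left[symmetric])
    also have "\<dots> \<le> (exp E0 / 2 * c\<^sup>2) * (p i * S + \<theta> * K)"
      using sq_sum[OF par _ eU S[OF T], of O2] e_card[OF T] by (intro mult_left_mono) (auto simp: O2_def)
    also have "\<dots> \<le> \<sigma>" by (rule cE(3))
    finally show ?thesis .
  qed
  finally show ?thesis by (simp add: f_def g_def)
qed

definition indep :: "'a set \<Rightarrow> bool" where
  "indep F \<longleftrightarrow> (\<forall>A\<in>F. \<forall>B\<in>F. B \<notin> N A)"

text \<open>A state consists of the remaining candidates \<open>V\<close>, the independent set \<open>F\<close> chosen so far, and the set
  \<open>J\<close> of elements thrown away because their degree exceeded the bound; an edge \<open>e T\<close> that meets \<open>J\<close> is
  given up.\<close>

definition admissible :: "nat \<Rightarrow> 'a set \<Rightarrow> 'a set \<Rightarrow> 'a set \<Rightarrow> bool" where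
  "admissible i V F J \<longleftrightarrow> ok i V \<and> F \<subseteq> U \<and> J \<subseteq> U \<and> indep F \<and> F \<inter> V = {} \<and> (\<forall>A\<in>F. N A \<inter> V = {})"

text \<open>The three parts control the size of \<open>F\<close>, the number of \<open>T\<close> with few chosen elements, and the
  size of \<open>J\<close>. The slack \<open>\<sigma>\<close> per round pays for the second-order terms, so that the expected
  potential does not increase.\<close>

definition pot :: "real \<Rightarrow> real \<Rightarrow> real \<Rightarrow> nat \<Rightarrow> 'a set \<Rightarrow> 'a set \<Rightarrow> 'a set \<Rightarrow> real" where
  "pot \<alpha> \<gamma> \<delta> i V F J = \<alpha> * (card F + r i * card V) +
    \<gamma> * (\<Sum>T | T \<in> TT \<and> e T \<inter> J = {}. exp (- x * card (F \<inter> e T) - a i * card (V \<inter> e T) + real (L - i) * \<sigma>)) +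
    \<delta> * (card J + real (L - i) * exp (- b0 * (1 + \<epsilon>) * D) * (\<Sum>A\<in>U. exp (b i * card (N A \<inter> V) + real (L - i) * \<sigma>)))"

lemma step:
  assumes par: "params" "i < L" and admissible: "admissible i V F J" and nn: "0 \<le> \<alpha>" "0 \<le> \<gamma>" "0 \<le> \<delta>"
  shows "\<exists>V' F' J'. admissible (Suc i) V' F' J' \<and> pot \<alpha> \<gamma> \<delta> (Suc i) V' F' J' \<le> pot \<alpha> \<gamma> \<delta> i V F J"
proof -
  have okV: "ok i V" and FJ: "F \<subseteq> U" "J \<subseteq> U" "indep F" "F \<inter> V = {}" "\<And>A. A \<in> F \<Longrightarrow> N A \<inter> V = {}"
    using admissible by (simp_all add: admissible_def)
  have V: "V \<subseteq> U" "finite V" using okV ok_fin[OF okV] by (simp_all add: ok_def)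
  have fin: "finite F" "finite J" using finite_subset[OF FJ(1) finU] finite_subset[OF FJ(2) finU] by simp_all
  let ?E = "rsub (q i V) (V \<times> UNIV)"
  have qb: "0 \<le> q i V w \<and> q i V w \<le> 1" if "w \<in> V \<times> UNIV" for w by (rule q_bounds[OF par okV that])
  have L: "real (L - i) = 1 + real (L - Suc i)" using par(2) by simp
  define Z where "Z = exp (- b0 * (1 + \<epsilon>) * D)"
  define R where "R Y = {A \<in> surv k V Y. (A, False) \<in> Y}" for Y
  define V1 where "V1 Y = {A \<in> surv k V Y. (A, False) \<notin> Y}" for Y
  \<comment> \<open>Elements whose remaining degree is still too large are discarded at once, so the
    degree condition \<open>ok\<close> holds after every outcome and not merely with high
    probability.\<close>
  define New where "New Y = {A \<in> V1 Y. \<not> card (N A \<inter> V1 Y) \<le> Dg (Suc i)}" for Y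
  define V2 where "V2 Y = V1 Y - New Y" for Y
  have subs: "R Y \<subseteq> V" "V1 Y \<subseteq> V" "V2 Y \<subseteq> V1 Y" "New Y \<subseteq> V1 Y" "V1 Y \<subseteq> surv k V Y" "V2 Y \<subseteq> V" for Y
    using surv_subset[of k V Y] by (auto simp: R_def V1_def V2_def New_def)
  have fins: "finite (R Y)" "finite (V1 Y)" "finite (V2 Y)" "finite (New Y)" "finite (surv k V Y)" for Y
    using finite_subset[OF subs(1) V(2)] finite_subset[OF subs(2) V(2)] finite_subset[OF subs(6) V(2)]
      finite_subset[OF order_trans[OF subs(4) subs(2)] V(2)] finite_subset[OF surv_subset V(2)] by simp_all
  have nokill: "B \<notin> N A" if "(A, False) \<in> Y" "B \<in> surv k V Y" for A B Y
    using that by (force simp: surv_def k_def)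
  have adm': "admissible (Suc i) (V2 Y) (F \<union> R Y) (J \<union> New Y)" for Y
  proof -
    have "ok (Suc i) (V2 Y)"
      unfolding ok_def
    proof (intro conjI ballI)
      show "V2 Y \<subseteq> U" using subs(6)[of Y] V by blast
      fix A assume A: "A \<in> V2 Y"
      have "card (N A \<inter> V2 Y) \<le> card (N A \<inter> V1 Y)"
        using subs(3)[of Y] fins(2)[of Y] by (intro card_mono) auto
      also have "real \<dots> \<le> Dg (Suc i)" using A by (auto simp: V2_def New_def)
      finally show "real (card (N A \<inter> V2 Y)) \<le> Dg (Suc i)" by simp
    qed
    moreover have "indep (F \<union> R Y)"
      unfolding indep_def
    proof (intro ballI)
      fix A B assume A: "A \<in> F \<union> R Y" and B: "B \<in> F \<union> R Y"
      have AU: "A \<in> U" "B \<in> U" using A B FJ(1) subs(1)[of Y] V(1) by auto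
      show "B \<notin> N A"
      proof (cases "A \<in> F")
        case AF: True
        show ?thesis
        proof (cases "B \<in> F")
          case True
          then show ?thesis using FJ(3) AF by (simp add: indep_def)
        next
          case False
          then have "B \<in> V" using B subs(1)[of Y] by auto
          then show ?thesis using FJ(5)[OF AF] by auto
        qed
      next
        case False
        then have AR: "A \<in> R Y" using A by simp
        show ?thesis
        proof (cases "B \<in> F")
          case True
          then have "A \<notin> N B" using FJ(5)[OF True] AR subs(1)[of Y] by auto
          then show ?thesis using N_sym AU by blast
        next
          case False
          then have "B \<in> R Y" using B by simp
          then show ?thesis using nokill[of A Y B] AR by (auto simp: R_def)
        qed
      qed
    qed
    moreover have "(F \<union> R Y) \<inter> V2 Y = {}"
      using FJ(4) subs(6)[of Y] by (auto simp: R_def V1_def V2_def)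
    moreover have "N A \<inter> V2 Y = {}" if "A \<in> F \<union> R Y" for A
    proof (cases "A \<in> F")
      case True
      then show ?thesis using FJ(5)[OF True] subs(6)[of Y] by auto
    next
      case False
      then have "(A, False) \<in> Y" using that by (auto simp: R_def)
      then show ?thesis using nokill[of A Y] subs(3,5)[of Y] by blast
    qed
    ultimately show ?thesis
      unfolding admissible_def using FJ subs[of Y] V by blast
  qed
  define G where "G Y = (\<Sum>A\<in>U. exp (b (Suc i) * card (surv k (N A \<inter> V) Y)))" for Y
  define X where "X T Y = exp (- x * card {A \<in> surv k V Y \<inter> e T. (A, False) \<in> Y} -
      a (Suc i) * card {A \<in> surv k V Y \<inter> e T. (A, False) \<notin> Y})" for T Y
  define m where "m = real (L - Suc i)"
  \<comment> \<open>\<open>H\<close> dominates the new potential for every \<open>Y\<close>, and it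
    is a linear combination of quantities whose expectations are given by \<open>rsub_member\<close>
    or bounded by \<open>step_size\<close>, \<open>step_edge\<close> and
    \<open>step_degree\<close>.\<close>
  define H where "H Y = \<alpha> * (card F + (\<Sum>A\<in>V. if (A, False) \<in> Y then 1 else (0::real)) + r (Suc i) * card (surv k V Y)) +
     \<gamma> * (\<Sum>T | T \<in> TT \<and> e T \<inter> J = {}. exp (- x * card (F \<inter> e T) + m * \<sigma>) * X T Y) +
     \<delta> * (card J + (1 + m) * Z * exp (m * \<sigma>) * G Y)" for Y
  have bound: "pot \<alpha> \<gamma> \<delta> (Suc i) (V2 Y) (F \<union> R Y) (J \<union> New Y) \<le> H Y" for Y
  proof -
    have 1: "card (F \<union> R Y) + r (Suc i) * card (V2 Y) \<le>
      card F + (\<Sum>A\<in>V. if (A, False) \<in> Y then 1 else (0::real)) + r (Suc i) * card (surv k V Y)"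
    proof -
      have "card (R Y) \<le> card {A\<in>V. (A, False) \<in> Y}"
        using V(2) surv_subset[of k V Y] by (intro card_mono) (auto simp: R_def)
      moreover have "(\<Sum>A\<in>V. if (A, False) \<in> Y then 1 else (0::real)) = real (card {A\<in>V. (A, False) \<in> Y})"
        using V(2) by (simp add: sum.If_cases Int_def)
      moreover have "card (F \<union> R Y) \<le> card F + card (R Y)" by (rule card_Un_le)
      moreover have "card (V2 Y) \<le> card (surv k V Y)"
        using subs(3,5)[of Y] fins[of Y] by (intro card_mono) auto
      then have "r (Suc i) * card (V2 Y) \<le> r (Suc i) * card (surv k V Y)"
        using r_nn by (intro mult_left_mono) auto
      ultimately show ?thesis by linarith
    qed
    have 2: "(\<Sum>T | T \<in> TT \<and> e T \<inter> (J \<union> New Y) = {}. exp (- x * card ((F \<union> R Y) \<inter> e T) - a (Suc i) * card (V2 Y \<inter> e T) + real (L - Suc i) * \<sigma>))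
      \<le> (\<Sum>T | T \<in> TT \<and> e T \<inter> J = {}. exp (- x * card (F \<inter> e T) + m * \<sigma>) * X T Y)"
    proof -
      have "(\<Sum>T | T \<in> TT \<and> e T \<inter> (J \<union> New Y) = {}. exp (- x * card ((F \<union> R Y) \<inter> e T) - a (Suc i) * card (V2 Y \<inter> e T) + real (L - Suc i) * \<sigma>))
        = (\<Sum>T | T \<in> TT \<and> e T \<inter> (J \<union> New Y) = {}. exp (- x * card (F \<inter> e T) + m * \<sigma>) * X T Y)"
      proof (rule sum.cong[OF refl])
        fix T assume "T \<in> {T. T \<in> TT \<and> e T \<inter> (J \<union> New Y) = {}}"
        then have T: "T \<in> TT" "e T \<inter> New Y = {}" by auto
        have eq1: "V2 Y \<inter> e T = {A \<in> surv k V Y \<inter> e T. (A, False) \<notin> Y}"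
          using T(2) by (auto simp: V2_def V1_def)
        have eq2: "(F \<union> R Y) \<inter> e T = (F \<inter> e T) \<union> {A \<in> surv k V Y \<inter> e T. (A, False) \<in> Y}"
          by (auto simp: R_def)
        have "card ((F \<union> R Y) \<inter> e T) = card (F \<inter> e T) + card {A \<in> surv k V Y \<inter> e T. (A, False) \<in> Y}"
          unfolding eq2 using fin fins[of Y] FJ(4) surv_subset[of k V Y] by (intro card_Un_disjoint) auto
        then show "exp (- x * card ((F \<union> R Y) \<inter> e T) - a (Suc i) * card (V2 Y \<inter> e T) + real (L - Suc i) * \<sigma>) =
          exp (- x * card (F \<inter> e T) + m * \<sigma>) * X T Y"
          unfolding X_def eq1 exp_add[symmetric] by (simp add: m_def algebra_simps)
      qed
      also have "\<dots> \<le> (\<Sum>T | T \<in> TT \<and> e T \<inter> J = {}. exp (- x * card (F \<inter> e T) + m * \<sigma>) * X T Y)"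
        using finT by (intro sum_mono2) (auto simp: X_def)
      finally show ?thesis .
    qed
    have sv: "surv k (N A \<inter> V) Y = N A \<inter> surv k V Y" for A by (auto simp: surv_def)
    have finNA: "finite (N A)" if "A \<in> U" for A using N_sub[OF that] finU finite_subset by blast
    have le: "exp (b (Suc i) * card (N A \<inter> W)) \<le> exp (b (Suc i) * card (surv k (N A \<inter> V) Y))" if "A \<in> U" "W \<subseteq> surv k V Y" for A W
      unfolding sv using that finNA[OF that(1)] b_nn
      by (intro iffD2[OF exp_le_cancel_iff] mult_left_mono of_nat_mono card_mono) auto
    \<comment> \<open>Markov's inequality in counting form: a discarded element has degree above
      \<open>Dg (Suc i)\<close>, and \<open>b (Suc i) * Dg (Suc i)\<close> is the same in all
      rounds, so its term is at least 1.\<close>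
    have 3: "card (J \<union> New Y) \<le> card J + Z * G Y"
    proof -
      have "real (card (New Y)) = (\<Sum>A\<in>New Y. 1)" by simp
      also have "\<dots> \<le> (\<Sum>A\<in>New Y. Z * exp (b (Suc i) * card (surv k (N A \<inter> V) Y)))"
      proof (rule sum_mono)
        fix A assume A: "A \<in> New Y"
        then have AU: "A \<in> U" using subs[of Y] V(1) by blast
        have "b (Suc i) * Dg (Suc i) \<le> b (Suc i) * card (N A \<inter> V1 Y)"
          using A b_nn by (intro mult_left_mono) (auto simp: New_def)
        moreover have "b (Suc i) * Dg (Suc i) = b0 * (1 + \<epsilon>) * D"
          using \<omega>_pos by (simp add: b_def Dg_def)
        ultimately have "1 \<le> Z * exp (b (Suc i) * card (N A \<inter> V1 Y))"
          unfolding Z_def exp_add[symmetric] by simp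
        also have "\<dots> \<le> Z * exp (b (Suc i) * card (surv k (N A \<inter> V) Y))"
          using le[OF AU subs(5)] by (simp add: Z_def)
        finally show "1 \<le> Z * exp (b (Suc i) * card (surv k (N A \<inter> V) Y))" .
      qed
      also have "\<dots> \<le> (\<Sum>A\<in>U. Z * exp (b (Suc i) * card (surv k (N A \<inter> V) Y)))"
        using subs[of Y] V(1) finU by (intro sum_mono2) (auto simp: Z_def)
      also have "\<dots> = Z * G Y" by (simp add: G_def sum_distrib_left)
      finally show ?thesis using card_Un_le[of J "New Y"] by linarith
    qed
    have 4: "(\<Sum>A\<in>U. exp (b (Suc i) * card (N A \<inter> V2 Y) + real (L - Suc i) * \<sigma>)) \<le> exp (m * \<sigma>) * G Y"
      unfolding G_def sum_distrib_left
    proof (rule sum_mono)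
      fix A assume "A \<in> U"
      then show "exp (b (Suc i) * card (N A \<inter> V2 Y) + real (L - Suc i) * \<sigma>) \<le> exp (m * \<sigma>) * exp (b (Suc i) * card (surv k (N A \<inter> V) Y))"
        using le[of A "V2 Y"] subs(3,5)[of Y] by (simp add: exp_add m_def mult.commute)
    qed
    have G_nn: "0 \<le> G Y" by (simp add: G_def sum_nonneg)
    have m_nn: "0 \<le> m" "1 \<le> exp (m * \<sigma>)" using \<sigma> by (simp_all add: m_def)
    \<comment> \<open>Of the \<open>L - i = 1 + m\<close> shares carried by the potential, one pays
      for the elements discarded now and \<open>m\<close> remain for the later rounds.\<close>
    have 5: "card (J \<union> New Y) + real (L - Suc i) * exp (- b0 * (1 + \<epsilon>) * D) * (\<Sum>A\<in>U. exp (b (Suc i) * card (N A \<inter> V2 Y) + real (L - Suc i) * \<sigma>))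
      \<le> card J + (1 + m) * Z * exp (m * \<sigma>) * G Y"
    proof -
      have "m * Z * (\<Sum>A\<in>U. exp (b (Suc i) * card (N A \<inter> V2 Y) + real (L - Suc i) * \<sigma>)) \<le> m * Z * (exp (m * \<sigma>) * G Y)"
        using 4 m_nn by (intro mult_left_mono) (auto simp: Z_def)
      moreover have "Z * G Y * 1 \<le> Z * G Y * exp (m * \<sigma>)"
        using m_nn G_nn by (intro mult_left_mono) (auto simp: Z_def)
      moreover have "(1 + m) * Z * exp (m * \<sigma>) * G Y = Z * G Y * exp (m * \<sigma>) + m * Z * (exp (m * \<sigma>) * G Y)"
        by (simp add: algebra_simps)
      ultimately show ?thesis using 3 unfolding m_def[symmetric] Z_def[symmetric] by linarith
    qed
    show ?thesis
      unfolding pot_def H_def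
      by (intro add_mono mult_left_mono 1 2 5 nn)
  qed
  have "?E H \<le> pot \<alpha> \<gamma> \<delta> i V F J"
  proof -
    have finO: "finite (V \<times> (UNIV::bool set))" using V(2) by simp
    have c: "?E (\<lambda>_. c) = c" for c by (rule rsub_const[OF finO])
    have EH: "?E H = \<alpha> * (card F + (\<Sum>A\<in>V. ?E (\<lambda>Y. if (A, False) \<in> Y then 1 else (0::real))) + r (Suc i) * ?E (\<lambda>Y. real (card (surv k V Y)))) +
     \<gamma> * (\<Sum>T | T \<in> TT \<and> e T \<inter> J = {}. exp (- x * card (F \<inter> e T) + m * \<sigma>) * ?E (X T)) +
     \<delta> * (card J + (1 + m) * Z * exp (m * \<sigma>) * (\<Sum>A\<in>U. ?E (\<lambda>Y. exp (b (Suc i) * card (surv k (N A \<inter> V) Y)))))"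
      unfolding H_def G_def by (simp only: rsub_add rsub_cmult rsub_sum c)
    have e1: "(\<Sum>A\<in>V. ?E (\<lambda>Y. if (A, False) \<in> Y then 1 else (0::real))) = p i * card V"
      using finO by (simp add: rsub_member q_def)
    have e2: "\<alpha> * (card F + p i * card V + r (Suc i) * ?E (\<lambda>Y. real (card (surv k V Y)))) \<le> \<alpha> * (card F + r i * card V)"
    proof (intro mult_left_mono nn)
      have "r (Suc i) * ?E (\<lambda>Y. real (card (surv k V Y))) \<le> r (Suc i) * (\<omega> * card V)"
        by (intro mult_left_mono r_nn step_size[OF par okV])
      then show "card F + p i * card V + r (Suc i) * ?E (\<lambda>Y. real (card (surv k V Y))) \<le> card F + r i * card V"
        unfolding r_rec[OF par(2)] by (simp add: algebra_simps)
    qed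
    have e3: "(\<Sum>T | T \<in> TT \<and> e T \<inter> J = {}. exp (- x * card (F \<inter> e T) + m * \<sigma>) * ?E (X T)) \<le>
       (\<Sum>T | T \<in> TT \<and> e T \<inter> J = {}. exp (- x * card (F \<inter> e T) - a i * card (V \<inter> e T) + real (L - i) * \<sigma>))"
    proof (rule sum_mono)
      fix T assume "T \<in> {T. T \<in> TT \<and> e T \<inter> J = {}}"
      then have "?E (X T) \<le> exp (- a i * card (V \<inter> e T) + \<sigma>)"
        unfolding X_def by (intro step_edge[OF par okV]) auto
      then have "exp (- x * card (F \<inter> e T) + m * \<sigma>) * ?E (X T) \<le> exp (- x * card (F \<inter> e T) + m * \<sigma>) * exp (- a i * card (V \<inter> e T) + \<sigma>)"
        by (intro mult_left_mono) auto
      then show "exp (- x * card (F \<inter> e T) + m * \<sigma>) * ?E (X T) \<le> exp (- x * card (F \<inter> e T) - a i * card (V \<inter> e T) + real (L - i) * \<sigma>)"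
        unfolding exp_add[symmetric] by (simp add: L m_def algebra_simps)
    qed
    have "(\<Sum>A\<in>U. ?E (\<lambda>Y. exp (b (Suc i) * card (surv k (N A \<inter> V) Y)))) \<le> (\<Sum>A\<in>U. exp (b i * card (N A \<inter> V) + \<sigma>))"
      by (rule sum_mono) (rule step_degree[OF par okV])
    then have "(1 + m) * Z * exp (m * \<sigma>) * (\<Sum>A\<in>U. ?E (\<lambda>Y. exp (b (Suc i) * card (surv k (N A \<inter> V) Y)))) \<le>
        (1 + m) * Z * exp (m * \<sigma>) * (\<Sum>A\<in>U. exp (b i * card (N A \<inter> V) + \<sigma>))"
      by (rule mult_left_mono) (simp add: m_def Z_def)
    also have "(1 + m) * Z * exp (m * \<sigma>) * (\<Sum>A\<in>U. exp (b i * card (N A \<inter> V) + \<sigma>)) =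
        real (L - i) * exp (- b0 * (1 + \<epsilon>) * D) * (\<Sum>A\<in>U. exp (b i * card (N A \<inter> V) + real (L - i) * \<sigma>))"
      unfolding L m_def[symmetric] Z_def[symmetric] sum_distrib_left
    proof (rule sum.cong[OF refl])
      fix A
      have "exp (b i * card (N A \<inter> V) + (1 + m) * \<sigma>) = exp (m * \<sigma>) * exp (b i * card (N A \<inter> V) + \<sigma>)"
        unfolding exp_add[symmetric] by (simp add: distrib_right)
      then show "(1 + m) * Z * exp (m * \<sigma>) * exp (b i * card (N A \<inter> V) + \<sigma>) = (1 + m) * Z * exp (b i * card (N A \<inter> V) + (1 + m) * \<sigma>)"
        by simp
    qed
    finally have e4: "(1 + m) * Z * exp (m * \<sigma>) * (\<Sum>A\<in>U. ?E (\<lambda>Y. exp (b (Suc i) * card (surv k (N A \<inter> V) Y)))) \<le>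
        real (L - i) * exp (- b0 * (1 + \<epsilon>) * D) * (\<Sum>A\<in>U. exp (b i * card (N A \<inter> V) + real (L - i) * \<sigma>))" .
    show ?thesis
      unfolding EH e1 pot_def by (intro add_mono e2 mult_left_mono[OF e3] mult_left_mono[OF add_left_mono[OF e4]] nn)
  qed
  from rsub_exists[OF _ qb this] obtain Y where "H Y \<le> pot \<alpha> \<gamma> \<delta> i V F J"
    using V(2) by auto
  then have "pot \<alpha> \<gamma> \<delta> (Suc i) (V2 Y) (F \<union> R Y) (J \<union> New Y) \<le> pot \<alpha> \<gamma> \<delta> i V F J"
    using bound[of Y] by linarith
  then show ?thesis using adm' by blast
qed

text \<open>After \<open>L\<close> rounds \<open>r\<close>, \<open>a\<close> and
  \<open>L - i\<close> vanish and the potential is the left-hand side; the right-hand side bounds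
  its initial value. Free weights put the three requirements into one inequality, so that a single
  outcome meets all of them. The last exponent comes from the gap between the threshold
  \<open>(1 + \<epsilon>) * D\<close> and the initial degree bound \<open>D\<close>.\<close>

theorem nibble_exists:
  fixes \<alpha> \<gamma> \<delta> :: real
  assumes "params" and nn: "0 \<le> \<alpha>" "0 \<le> \<gamma>" "0 \<le> \<delta>"
  shows "\<exists>F J. F \<subseteq> U \<and> J \<subseteq> U \<and> (\<forall>A\<in>F. \<forall>B\<in>F. B \<notin> N A) \<and>
    \<alpha> * card F + \<gamma> * (\<Sum>T | T \<in> TT \<and> e T \<inter> J = {}. exp (- x * card (F \<inter> e T))) + \<delta> * card J \<le>
    \<alpha> * (L * \<theta> * card U / ((1 + \<epsilon>) * D)) + \<gamma> * (card TT * exp (- a 0 * K + L * \<sigma>)) +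
    \<delta> * (L * card U * exp (L * \<sigma> - b0 * \<epsilon> * D))"
proof -
  have "\<exists>V F J. admissible i V F J \<and> pot \<alpha> \<gamma> \<delta> i V F J \<le> pot \<alpha> \<gamma> \<delta> 0 U {} {}" if "i \<le> L" for i
    using that
  proof (induction i)
    case 0
    have "ok 0 U"
      unfolding ok_def
    proof (intro conjI ballI order_refl)
      fix A assume A: "A \<in> U"
      have "real (card (N A \<inter> U)) = card (N A)" using N_sub[OF A] by (simp add: Int_absorb2)
      also have "\<dots> \<le> 1 * D" using N_card[OF A] by simp
      also have "\<dots> \<le> (1 + \<epsilon>) * D" using \<epsilon> D_pos by (intro mult_right_mono) auto
      finally show "real (card (N A \<inter> U)) \<le> Dg 0" by (simp add: Dg_def)
    qed
    then have "admissible 0 U {} {}" by (simp add: admissible_def indep_def)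
    then show ?case by blast
  next
    case (Suc i)
    then obtain V F J where *: "admissible i V F J" "pot \<alpha> \<gamma> \<delta> i V F J \<le> pot \<alpha> \<gamma> \<delta> 0 U {} {}" by auto
    from Suc.prems have "i < L" by simp
    from step[OF assms(1) this *(1) nn] obtain V' F' J' where
      "admissible (Suc i) V' F' J'" "pot \<alpha> \<gamma> \<delta> (Suc i) V' F' J' \<le> pot \<alpha> \<gamma> \<delta> i V F J" by auto
    then show ?case using *(2) by (meson order_trans)
  qed
  then obtain V F J where I: "admissible L V F J" and P: "pot \<alpha> \<gamma> \<delta> L V F J \<le> pot \<alpha> \<gamma> \<delta> 0 U {} {}" by blast
  have final: "pot \<alpha> \<gamma> \<delta> L V F J = \<alpha> * card F + \<gamma> * (\<Sum>T | T \<in> TT \<and> e T \<inter> J = {}. exp (- x * card (F \<inter> e T))) + \<delta> * card J"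
    by (simp add: pot_def r_def a_def)
  have init: "pot \<alpha> \<gamma> \<delta> 0 U {} {} \<le> \<alpha> * (L * \<theta> * card U / ((1 + \<epsilon>) * D)) + \<gamma> * (card TT * exp (- a 0 * K + L * \<sigma>)) +
    \<delta> * (L * card U * exp (L * \<sigma> - b0 * \<epsilon> * D))"
  proof -
    have "(\<Sum>T | T \<in> TT \<and> e T \<inter> {} = {}. exp (- x * card ({} \<inter> e T) - a 0 * card (U \<inter> e T) + real (L - 0) * \<sigma>)) = card TT * exp (- a 0 * K + L * \<sigma>)"
    proof -
      have "card (U \<inter> e T) = K" if "T \<in> TT" for T
        using e_sub[OF that] e_card[OF that] by (simp add: Int_absorb1)
      then show ?thesis by simp
    qed
    moreover have "real (L - 0) * exp (- b0 * (1 + \<epsilon>) * D) * (\<Sum>A\<in>U. exp (b 0 * card (N A \<inter> U) + real (L - 0) * \<sigma>)) \<le>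
       L * card U * exp (L * \<sigma> - b0 * \<epsilon> * D)"
    proof -
      have "(\<Sum>A\<in>U. exp (b 0 * card (N A \<inter> U) + real (L - 0) * \<sigma>)) \<le> (\<Sum>A\<in>U. exp (b0 * D + L * \<sigma>))"
      proof (rule sum_mono)
        fix A assume A: "A \<in> U"
        have "real (card (N A \<inter> U)) \<le> D" using N_sub[OF A] N_card[OF A] by (simp add: Int_absorb2)
        then show "exp (b 0 * card (N A \<inter> U) + real (L - 0) * \<sigma>) \<le> exp (b0 * D + L * \<sigma>)"
          using b0 by (simp add: b_def mult_left_mono)
      qed
      then have "real (L - 0) * exp (- b0 * (1 + \<epsilon>) * D) * (\<Sum>A\<in>U. exp (b 0 * card (N A \<inter> U) + real (L - 0) * \<sigma>)) \<le>
          real (L - 0) * exp (- b0 * (1 + \<epsilon>) * D) * (\<Sum>A\<in>U. exp (b0 * D + L * \<sigma>))"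
        by (intro mult_left_mono) auto
      also have "\<dots> = L * card U * (exp (- b0 * (1 + \<epsilon>) * D) * exp (b0 * D + L * \<sigma>))" by simp
      also have "exp (- b0 * (1 + \<epsilon>) * D) * exp (b0 * D + L * \<sigma>) = exp (L * \<sigma> - b0 * \<epsilon> * D)"
        unfolding exp_add[symmetric] by (simp add: algebra_simps)
      finally show ?thesis .
    qed
    ultimately show ?thesis
      unfolding pot_def using nn by (simp add: r_def mult_left_mono)
  qed
  show ?thesis
    using I P init unfolding final admissible_def indep_def by (intro exI[of _ F] exI[of _ J]) auto
qed

end

section \<open>Estimates for the parameters of the nibble\<close>

context nibble
begin

lemma inverse_\<omega>_pow: "i \<le> L \<Longrightarrow> 1 / \<omega> ^ i \<le> exp (2 * (L * \<theta>))"
proof -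
  assume i: "i \<le> L"
  have "exp (2 * (- \<theta>)) \<le> \<omega>"
  proof -
    have "1 + \<theta> \<le> exp \<theta>" by (rule exp_ge_add_one_self)
    then have "(1 + \<theta>)\<^sup>2 \<le> (exp \<theta>)\<^sup>2" using \<theta> by (intro power_mono) auto
    also have "(exp \<theta>)\<^sup>2 = exp (2 * \<theta>)" by (simp add: power2_eq_square exp_add[symmetric])
    finally have e: "(1 + \<theta>)\<^sup>2 \<le> exp (2 * \<theta>)" .
    have "1 \<le> \<omega> * (1 + \<theta>)\<^sup>2"
    proof -
      have "\<omega> * (1 + \<theta>)\<^sup>2 = 1 + \<theta> + \<theta> ^ 3 + \<theta> ^ 4"
        by (simp add: \<omega>_def power2_eq_square power3_eq_cube algebra_simps power4_eq_xxxx)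
      then show ?thesis using \<theta> by simp
    qed
    also have "\<dots> \<le> \<omega> * exp (2 * \<theta>)" using e \<omega>_pos by simp
    finally have "exp (- (2 * \<theta>)) * 1 \<le> exp (- (2 * \<theta>)) * (\<omega> * exp (2 * \<theta>))" by (intro mult_left_mono) auto
    also have "\<dots> = \<omega>" by (simp add: exp_minus)
    finally show ?thesis by simp
  qed
  then have "exp (2 * (- \<theta>)) ^ L \<le> \<omega> ^ L" by (intro power_mono) auto
  also have "\<omega> ^ L \<le> \<omega> ^ i" using i \<omega>_pos \<omega>_le by (intro power_decreasing) auto
  finally have "exp (- (2 * (L * \<theta>))) \<le> \<omega> ^ i" by (simp flip: exp_of_nat_mult add: mult_ac)
  then have "1 / \<omega> ^ i \<le> 1 / exp (- (2 * (L * \<theta>)))" by (intro divide_left_mono) (auto simp: \<omega>_pos)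
  then show ?thesis by (simp add: exp_minus field_simps)
qed

lemma \<tau>_le: "\<tau> \<le> \<omega>"
proof -
  have "\<tau> \<le> (1 - \<theta>) * 1" unfolding \<tau>_def using \<theta> \<rho> by (intro mult_left_mono) auto
  then show ?thesis by (simp add: \<omega>_def add_increasing2)
qed

lemma x'_le: "x' \<le> 1"
  by (simp add: x'_def)

text \<open>The selection probabilities grow like the powers of 1/\<omega> while the weights decay
  with \<tau> \<le> \<omega>. The two effects cancel, so each of the at most \<open>L\<close>
  summands is bounded by \<open>\<theta> / Dg i\<close>.\<close>

lemma a_plus_p_le:
  assumes "i < L"
  shows "a (Suc i) + p i \<le> L * \<theta> / Dg i"
proof -
  have "p l * x' * \<tau> ^ (l - Suc i + 1) \<le> \<theta> / Dg i" if l: "l \<in> {Suc i..<L}" for l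
  proof -
    have li: "l - Suc i + 1 = l - i" "l = i + (l - i)" using l by auto
    have "p l * x' * \<tau> ^ (l - i) \<le> p l * 1 * \<omega> ^ (l - i)"
      using p_pos[of l] x'_le x'_nn \<tau>_nn \<tau>_le by (intro mult_mono power_mono) auto
    also have "\<dots> = \<theta> / Dg i"
      using \<omega>_pos by (subst li(2)) (simp add: p_def Dg_def power_add)
    finally show ?thesis unfolding li(1) .
  qed
  then have "a (Suc i) \<le> (\<Sum>l = Suc i..<L. \<theta> / Dg i)"
    unfolding a_def by (rule sum_mono)
  also have "\<dots> = real (L - Suc i) * (\<theta> / Dg i)" by simp
  finally have "a (Suc i) + p i \<le> real (L - Suc i) * (\<theta> / Dg i) + \<theta> / Dg i" by (simp add: p_def)
  also have "\<dots> = (1 + real (L - Suc i)) * (\<theta> / Dg i)" by (simp add: distrib_right add_divide_distrib)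
  also have "\<dots> \<le> real L * (\<theta> / Dg i)"
    using assms \<theta> Dg_pos[of i] by (intro mult_right_mono) auto
  finally show ?thesis by simp
qed

lemma inverse_Dg: "i \<le> L \<Longrightarrow> 1 / Dg i \<le> exp (2 * (L * \<theta>)) / D"
proof -
  assume i: "i \<le> L"
  have "1 / Dg i = (1 / (1 + \<epsilon>)) * ((1 / D) * (1 / \<omega> ^ i))" by (simp add: Dg_def)
  also have "\<dots> \<le> 1 * ((1 / D) * exp (2 * (L * \<theta>)))"
    using \<epsilon> D_pos \<omega>_pos inverse_\<omega>_pow[OF i] by (intro mult_mono mult_left_mono) (auto simp: less_imp_le)
  finally show ?thesis by simp
qed

text \<open>All rounds are treated alike: the growth factors are replaced by their final bound exp(2
  \<beta>). The slack \<open>1 / L\<close> per round adds up to 1 over the run.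
  \<open>E0 = \<beta> + 1\<close> works since \<open>c * Dg i \<le> \<beta>\<close> by
  \<open>a_plus_p_le\<close> and \<open>c \<le> \<rho> \<le> 1\<close>.\<close>

lemma params_ok:
  assumes L: "1 \<le> L" and \<beta>: "\<beta> = L * \<theta>" and "\<rho> = \<beta> * exp (2 * \<beta>) / D" and "E0 = \<beta> + 1" and "\<sigma> = 1 / L"
    and h1: "exp (\<beta> + 1) / 2 * \<rho>\<^sup>2 * (\<beta> * (exp (2 * \<beta>) * S / D + K)) \<le> 1"
    and h2: "(b0 * exp (2 * \<beta>))\<^sup>2 / 2 * (\<beta> * (exp (2 * \<beta>) * S' / D + D)) \<le> 1"
    and nn: "0 \<le> S" "0 \<le> S'"
  shows params
  unfolding params_def
proof (intro allI impI)
  fix i assume i: "i < L"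
  have \<beta>_nn: "0 \<le> \<beta>" using \<theta> \<beta> by simp
  have inv: "1 / Dg i \<le> exp (2 * \<beta>) / D" using inverse_Dg[of i] i \<beta> by simp
  have ap: "a (Suc i) + p i \<le> \<beta> / Dg i" using a_plus_p_le[OF i] \<beta> by simp
  have "\<beta> * (1 / Dg i) \<le> \<beta> * (exp (2 * \<beta>) / D)" by (rule mult_left_mono[OF inv \<beta>_nn])
  then have apr: "a (Suc i) + p i \<le> \<rho>" using ap assms(3) by simp
  have p1: "p i \<le> 1" using apr a_nn[of "Suc i"] \<rho> by linarith
  have pe: "p i \<le> \<theta> * (exp (2 * \<beta>) / D)" unfolding p_def using mult_left_mono[OF inv, of \<theta>] \<theta> by simp
  define c where "c = (1 - \<rho>) * (a (Suc i) + p i * x')"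
  have c0: "0 \<le> c" unfolding c_def using \<rho> a_nn[of "Suc i"] p_pos[of i] x'_nn by (intro mult_nonneg_nonneg add_nonneg_nonneg) auto
  have px: "p i * x' \<le> p i" using p_pos[of i] x'_le x'_nn by (simp add: mult_left_le)
  have "c \<le> 1 * (a (Suc i) + p i * x')"
    unfolding c_def using \<rho> a_nn[of "Suc i"] p_pos[of i] x'_nn by (intro mult_right_mono add_nonneg_nonneg mult_nonneg_nonneg) auto
  then have cle: "c \<le> a (Suc i) + p i" using px by simp
  have "c * Dg i \<le> \<beta> / Dg i * Dg i" using cle ap Dg_pos[of i] by (intro mult_right_mono) auto
  then have cD: "c * Dg i \<le> E0" using Dg_pos[of i] assms(4) by simp
  have c\<rho>: "c \<le> \<rho>" using cle apr by simp
  have cE: "c \<le> E0" using c\<rho> \<rho> assms(4) \<beta>_nn by simp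
  have "exp E0 / 2 * c\<^sup>2 * (p i * S + \<theta> * K) \<le> exp (\<beta> + 1) / 2 * \<rho>\<^sup>2 * (\<theta> * (exp (2 * \<beta>) / D) * S + \<theta> * K)"
    using assms(4) c0 c\<rho> nn K_nn pe \<theta> p_pos[of i]
    by (intro mult_mono power_mono add_mono mult_right_mono) (auto intro!: add_nonneg_nonneg mult_nonneg_nonneg)
  also have "\<dots> = (exp (\<beta> + 1) / 2 * \<rho>\<^sup>2 * (\<beta> * (exp (2 * \<beta>) * S / D + K))) / L"
    using L by (simp add: \<beta> field_simps)
  also have "\<dots> \<le> \<sigma>" unfolding assms(5) using L h1 by (intro divide_right_mono) auto
  finally have s1: "exp E0 / 2 * c\<^sup>2 * (p i * S + \<theta> * K) \<le> \<sigma>" .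
  have bb: "b (Suc i) \<le> b0 * exp (2 * \<beta>)"
    unfolding b_def using mult_left_mono[OF inverse_\<omega>_pow[of "Suc i"] b0] i \<beta> by simp
  have "(b (Suc i))\<^sup>2 / 2 * (p i * S' + \<theta> * D) \<le> (b0 * exp (2 * \<beta>))\<^sup>2 / 2 * (\<theta> * (exp (2 * \<beta>) / D) * S' + \<theta> * D)"
    using bb b_nn nn pe \<theta> D_pos p_pos[of i]
    by (intro mult_mono divide_right_mono power_mono add_mono mult_right_mono) (auto intro!: add_nonneg_nonneg mult_nonneg_nonneg)
  also have "\<dots> = ((b0 * exp (2 * \<beta>))\<^sup>2 / 2 * (\<beta> * (exp (2 * \<beta>) * S' / D + D))) / L"
    using L by (simp add: \<beta> field_simps)
  also have "\<dots> \<le> \<sigma>" unfolding assms(5) using L h2 by (intro divide_right_mono) auto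
  finally have s2: "(b (Suc i))\<^sup>2 / 2 * (p i * S' + \<theta> * D) \<le> \<sigma>" .
  show "p i \<le> 1 \<and> p i + a (Suc i) \<le> \<rho> \<and>
   (let c = (1 - \<rho>) * (a (Suc i) + p i * x') in c * Dg i \<le> E0 \<and> c \<le> E0 \<and> exp E0 / 2 * c\<^sup>2 * (p i * S + \<theta> * K) \<le> \<sigma>) \<and>
   (b (Suc i))\<^sup>2 / 2 * (p i * S' + \<theta> * D) \<le> \<sigma>"
    unfolding Let_def c_def[symmetric] using p1 apr cD cE s1 s2 by (simp add: add.commute)
qed

text \<open>If \<open>\<tau>\<close> were equal to \<open>\<omega>\<close>, every summand of
  \<open>a 0\<close> would be \<theta> x' \<tau> / ((1 + \<epsilon>) D). The true ratio
  \<tau>/\<omega> is at least 1 - h with h = 2 \<theta>^2 + \<rho>, and Bernoulli's inequality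
  limits the loss over \<open>L\<close> rounds to the factor 1 - L h.\<close>

lemma a0_lower:
  assumes L: "1 \<le> L" and h: "L * (2 * \<theta>\<^sup>2 + \<rho>) \<le> 1"
  shows "x' * (L * \<theta>) / ((1 + \<epsilon>) * D) * (1 - \<theta> - 2 * \<theta> * (L * \<theta>) - 2 * L * \<rho>) \<le> a 0"
proof -
  define h where "h = 2 * \<theta>\<^sup>2 + \<rho>"
  have h0: "0 \<le> h" using \<rho> by (simp add: h_def)
  have h1: "h \<le> 1"
  proof -
    have "1 * h \<le> L * h" using L h0 by (intro mult_right_mono) auto
    then show ?thesis using assms(2) by (simp add: h_def)
  qed
  have "\<omega> * (1 - h) \<le> \<tau>"
  proof -
    have "1 - h \<le> (1 - 2 * \<theta>\<^sup>2) * (1 - \<rho>)" using \<rho> by (simp add: h_def algebra_simps)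
    then have "\<omega> * (1 - h) \<le> \<omega> * ((1 - 2 * \<theta>\<^sup>2) * (1 - \<rho>))" using \<omega>_pos by simp
    also have "\<dots> \<le> (1 - \<theta>) * (1 - \<rho>)"
    proof -
      have "\<theta> ^ 3 * 2 \<le> \<theta>\<^sup>2"
        using mult_right_mono[of "\<theta> * 2" 1 "\<theta>\<^sup>2"] \<theta> by (simp add: power3_eq_cube power2_eq_square mult_ac)
      then have "\<omega> * (1 - 2 * \<theta>\<^sup>2) \<le> 1 - \<theta>"
      proof -
        have "\<omega> * (1 - 2 * \<theta>\<^sup>2) = 1 - \<theta> - \<theta>\<^sup>2 + \<theta> ^ 3 * 2 - 2 * \<theta> ^ 4"
          by (simp add: \<omega>_def algebra_simps eval_nat_numeral)
        moreover have "0 \<le> \<theta> ^ 4" using \<theta> by simp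
        ultimately show ?thesis using \<open>\<theta> ^ 3 * 2 \<le> \<theta>\<^sup>2\<close> by linarith
      qed
      then show ?thesis using \<rho> by (simp add: mult.assoc[symmetric] mult_right_mono)
    qed
    finally show ?thesis by (simp add: \<tau>_def)
  qed
  then have tw: "1 - h \<le> \<tau> / \<omega>" using \<omega>_pos by (simp add: pos_le_divide_eq mult.commute)
  have t1: "1 - \<theta> - \<rho> \<le> \<tau>" using \<theta> \<rho> by (simp add: \<tau>_def algebra_simps)
  define C where "C = (1 - L * h) * \<tau>"
  have trm: "\<theta> * x' / ((1 + \<epsilon>) * D) * C \<le> p l * x' * \<tau> ^ (l - 0 + 1)" if l: "l \<in> {0..<L}" for l
  proof -
    have "1 - L * h \<le> 1 + real l * (- h)" using l h0 by (simp add: mult_right_mono)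
    also have "\<dots> \<le> (1 + (- h)) ^ l" using h1 by (intro Bernoulli_inequality) simp
    also have "\<dots> \<le> (\<tau> / \<omega>) ^ l" using tw h1 by (intro power_mono) auto
    finally have "C \<le> (\<tau> / \<omega>) ^ l * \<tau>" unfolding C_def using \<tau>_nn by (rule mult_right_mono)
    then have "\<theta> * x' / ((1 + \<epsilon>) * D) * C \<le> \<theta> * x' / ((1 + \<epsilon>) * D) * ((\<tau> / \<omega>) ^ l * \<tau>)"
      using \<theta> x'_nn \<epsilon> D_pos by (intro mult_left_mono) auto
    also have "\<dots> = p l * x' * \<tau> ^ (l - 0 + 1)"
      by (simp add: p_def Dg_def power_divide)
    finally show ?thesis .
  qed
  have "L * (\<theta> * x' / ((1 + \<epsilon>) * D) * C) \<le> a 0"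
  proof -
    have "(\<Sum>l = 0..<L. \<theta> * x' / ((1 + \<epsilon>) * D) * C) \<le> a 0" unfolding a_def by (rule sum_mono[OF trm])
    then show ?thesis by simp
  qed
  moreover have "x' * (L * \<theta>) / ((1 + \<epsilon>) * D) * (1 - \<theta> - 2 * \<theta> * (L * \<theta>) - 2 * L * \<rho>) \<le> L * (\<theta> * x' / ((1 + \<epsilon>) * D) * C)"
  proof -
    have Lh: "0 \<le> 1 - L * h" "L * h \<ge> 0" using h h0 assms(2) by (simp_all add: h_def)
    have "(1 - L * h) * (1 - \<theta> - \<rho>) \<le> C" unfolding C_def using t1 Lh by (intro mult_left_mono)
    moreover have "1 - \<theta> - \<rho> - L * h \<le> (1 - L * h) * (1 - \<theta> - \<rho>)"
      using mult_nonneg_nonneg[of "L * h" "\<theta> + \<rho>"] Lh \<theta> \<rho> by (simp add: algebra_simps)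
    moreover have "1 - \<theta> - 2 * \<theta> * (L * \<theta>) - 2 * L * \<rho> \<le> 1 - \<theta> - \<rho> - L * h"
      using mult_right_mono[of 1 "real L" \<rho>] L \<rho> by (simp add: h_def algebra_simps power2_eq_square)
    ultimately have "1 - \<theta> - 2 * \<theta> * (L * \<theta>) - 2 * L * \<rho> \<le> C" by linarith
    then have "x' * (L * \<theta>) / ((1 + \<epsilon>) * D) * (1 - \<theta> - 2 * \<theta> * (L * \<theta>) - 2 * L * \<rho>) \<le> x' * (L * \<theta>) / ((1 + \<epsilon>) * D) * C"
      using x'_nn \<theta> \<epsilon> D_pos by (intro mult_left_mono) auto
    then show ?thesis by (simp add: mult_ac)
  qed
  ultimately show ?thesis by linarith
qed

end

section \<open>The Kneser graph\<close>

lemma card_subsets_inter: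
  assumes "finite X" "W \<subseteq> X"
  shows "card {B. B \<subseteq> X \<and> card B = t \<and> card (B \<inter> W) = j} \<le> (card W choose j) * (card (X - W) choose (t - j))"
proof -
  have fW: "finite W" "finite (X - W)" using assms finite_subset by auto
  let ?S = "{B. B \<subseteq> X \<and> card B = t \<and> card (B \<inter> W) = j}"
  let ?T = "{C. C \<subseteq> W \<and> card C = j} \<times> {C. C \<subseteq> X - W \<and> card C = t - j}"
  have fT: "finite ?T" using fW by simp
  have inj: "inj_on (\<lambda>B. (B \<inter> W, B - W)) ?S" by (auto simp: inj_on_def)
  have im: "(\<lambda>B. (B \<inter> W, B - W)) ` ?S \<subseteq> ?T"
  proof
    fix y assume "y \<in> (\<lambda>B. (B \<inter> W, B - W)) ` ?S"
    then obtain B where B: "B \<subseteq> X" "card B = t" "card (B \<inter> W) = j" "y = (B \<inter> W, B - W)" by auto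
    have "finite B" using B(1) assms(1) finite_subset by blast
    then have "card (B - W) = t - j" using B by (simp add: card_Diff_subset_Int)
    then show "y \<in> ?T" using B by auto
  qed
  have "card ?S \<le> card ?T" by (rule card_inj_on_le[OF inj im fT])
  also have "\<dots> = (card W choose j) * (card (X - W) choose (t - j))"
    using fW by (simp add: card_cartesian_product n_subsets)
  finally show ?thesis .
qed

lemma choose_mult_choose:
  "(w choose j) * ((w - j) choose t) = (w choose t) * ((w - t) choose j)"
proof (cases "j + t \<le> w")
  case True
  have "(w choose j) * ((w - j) choose t) = (w choose (j + t)) * ((j + t) choose j)"
    using choose_mult[of j "j + t" w] True by simp
  moreover have "(w choose t) * ((w - t) choose j) = (w choose (j + t)) * ((j + t) choose t)"
    using choose_mult[of t "j + t" w] True by simp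
  moreover have "((j + t) choose j) = ((j + t) choose t)"
    using binomial_symmetric[of j "j + t"] by simp
  ultimately show ?thesis by simp
next
  case False
  then have "w < j \<or> w - j < t" "w < t \<or> w - t < j" by auto
  then have "(w choose j) * ((w - j) choose t) = 0" "(w choose t) * ((w - t) choose j) = 0"
    by (auto simp: binomial_eq_0)
  then show ?thesis by (simp only:)
qed

lemma sum_choose_squared_le: "(\<Sum>j\<le>v. (v choose j)\<^sup>2) \<le> 4 ^ v"
proof -
  have "(\<Sum>j\<le>v. (v choose j)\<^sup>2) \<le> (\<Sum>j\<le>v. (v choose j) * 2 ^ v)"
    unfolding power2_eq_square by (intro sum_mono mult_left_mono binomial_le_pow2) auto
  also have "\<dots> = 2 ^ v * 2 ^ v" by (simp add: choose_row_sum flip: sum_distrib_right)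
  finally show ?thesis by (simp flip: power_mult_distrib)
qed

text \<open>The number of common neighbours of \<open>B\<close> in the Kneser graph inside \<open>W\<close> depends on
  \<open>card (B \<inter> W)\<close> only, and the number of \<open>B\<close> with a given intersection size is at most the square
  of a binomial coefficient; the trinomial revision identity makes the product manageable.\<close>

lemma sum_disjoint_subsets_squared:
  assumes X: "finite X" and W: "W \<subseteq> X" and t: "t \<le> card W"
    and side: "\<And>j. j \<le> t \<Longrightarrow> (card (X - W) choose (t - j)) \<le> (card W choose j)"
  shows "(\<Sum>B | B \<subseteq> X \<and> card B = t. (card {A. A \<subseteq> W \<and> card A = t \<and> A \<inter> B = {}})\<^sup>2)
    \<le> 4 ^ (card W - t) * (card W choose t)\<^sup>2"
proof -
  define w where "w = card W"
  have fW: "finite W" using X W finite_subset by blast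
  have c: "card {A. A \<subseteq> W \<and> card A = t \<and> A \<inter> B = {}} = (w - card (B \<inter> W)) choose t" for B
  proof -
    have "{A. A \<subseteq> W \<and> card A = t \<and> A \<inter> B = {}} = {A. A \<subseteq> W - B \<and> card A = t}" by auto
    moreover have "card (W - B) = w - card (B \<inter> W)"
      using fW by (simp add: card_Diff_subset_Int w_def Int_commute)
    ultimately show ?thesis using fW by (simp add: n_subsets)
  qed
  let ?V = "{B. B \<subseteq> X \<and> card B = t}"
  have fV: "finite ?V" using X by simp
  have jt: "card (B \<inter> W) \<in> {..t}" if "B \<in> ?V" for B
    using that X finite_subset[of B X] card_mono[of B "B \<inter> W"] by auto
  have "(\<Sum>B\<in>?V. (card {A. A \<subseteq> W \<and> card A = t \<and> A \<inter> B = {}})\<^sup>2) = (\<Sum>B\<in>?V. ((w - card (B \<inter> W)) choose t)\<^sup>2)"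
    by (simp only: c)
  also have "\<dots> = (\<Sum>j\<le>t. \<Sum>B | B \<in> ?V \<and> card (B \<inter> W) = j. ((w - card (B \<inter> W)) choose t)\<^sup>2)"
    by (rule sum.group[symmetric, OF fV]) (use jt in auto)
  also have "\<dots> = (\<Sum>j\<le>t. card {B. B \<subseteq> X \<and> card B = t \<and> card (B \<inter> W) = j} * ((w - j) choose t)\<^sup>2)"
    by (intro sum.cong[OF refl]) (simp add: conj_assoc)
  also have "\<dots> \<le> (\<Sum>j\<le>t. (w choose t)\<^sup>2 * ((w - t) choose j)\<^sup>2)"
  proof (rule sum_mono)
    fix j assume j: "j \<in> {..t}"
    have "card {B. B \<subseteq> X \<and> card B = t \<and> card (B \<inter> W) = j} \<le> (w choose j) * (card (X - W) choose (t - j))"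
      unfolding w_def by (rule card_subsets_inter[OF X W])
    also have "\<dots> \<le> (w choose j) * (w choose j)"
      using side[of j] j unfolding w_def by (intro mult_left_mono) auto
    finally have "card {B. B \<subseteq> X \<and> card B = t \<and> card (B \<inter> W) = j} * ((w - j) choose t)\<^sup>2 \<le> ((w choose j) * ((w - j) choose t))\<^sup>2"
      unfolding power_mult_distrib power2_eq_square[of "w choose j"] by (rule mult_right_mono) simp
    then show "card {B. B \<subseteq> X \<and> card B = t \<and> card (B \<inter> W) = j} * ((w - j) choose t)\<^sup>2 \<le> (w choose t)\<^sup>2 * ((w - t) choose j)\<^sup>2"
      unfolding choose_mult_choose[of w j t] by (simp only: power_mult_distrib)
  qed
  also have "\<dots> = (w choose t)\<^sup>2 * (\<Sum>j\<le>t. ((w - t) choose j)\<^sup>2)" by (simp add: sum_distrib_left)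
  also have "(\<Sum>j\<le>t. ((w - t) choose j)\<^sup>2) \<le> (\<Sum>j\<le>w - t. ((w - t) choose j)\<^sup>2)"
  proof -
    have "(\<Sum>j\<le>t. ((w - t) choose j)\<^sup>2) = (\<Sum>j\<in>{..t} \<inter> {..w - t}. ((w - t) choose j)\<^sup>2)"
      by (rule sum.mono_neutral_right) (auto simp: binomial_eq_0)
    also have "\<dots> \<le> (\<Sum>j\<le>w - t. ((w - t) choose j)\<^sup>2)" by (rule sum_mono2) auto
    finally show ?thesis .
  qed
  also have "\<dots> \<le> 4 ^ (w - t)" by (rule sum_choose_squared_le)
  finally show ?thesis by (simp add: w_def mult.commute)
qed

text \<open>With \<open>m\<close> a constant multiple of ln K, most of these inequalities compare a
  power of ln K with a power of K, and all of them hold for large \<open>K\<close>. Collecting them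
  here keeps the nibble itself free of limits.\<close>

definition nibble_large :: "real \<Rightarrow> real \<Rightarrow> bool" where
  "nibble_large \<epsilon> K \<longleftrightarrow> (let m = 4 * ln K / \<epsilon>\<^sup>2 in
    1 \<le> K \<and> 1 \<le> \<epsilon> * m \<and> exp 1 * m ^ 3 \<le> sqrt K \<and> 9 * (ln K)\<^sup>2 * m / \<epsilon>\<^sup>2 \<le> sqrt K \<and>
    (m\<^sup>2 + 1) * m \<le> \<epsilon> / 32 * K powr (3 / 4) \<and> exp 2 \<le> \<epsilon>\<^sup>2 / 2 * K ^ 3 \<and>
    exp 1 * (m\<^sup>2 + 1) \<le> \<epsilon>\<^sup>2 / 2 * K \<and> m \<le> K)"

lemma eventually_nibble_large:
  assumes "0 < \<epsilon>"
  shows "eventually (nibble_large \<epsilon>) at_top"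
proof -
  define C where "C = 4 / \<epsilon>\<^sup>2"
  have C: "0 < C" using assms by (simp add: C_def)
  have m: "4 * ln K / \<epsilon>\<^sup>2 = C * ln K" for K by (simp add: C_def)
  have c: "9 * (ln K)\<^sup>2 * (C * ln K) / \<epsilon>\<^sup>2 = 9 / \<epsilon>\<^sup>2 * C * (ln K) ^ 3" for K
    by (simp add: power2_eq_square power3_eq_cube)
  define c1 where "c1 = 9 / \<epsilon>\<^sup>2 * C"
  define c2 where "c2 = \<epsilon>\<^sup>2 / 2"
  have pos: "0 < \<epsilon> * C" "0 < c1" "0 < c2" "0 < \<epsilon> / 32" using C assms by (simp_all add: c1_def c2_def)
  have "\<forall>\<^sub>F K in at_top. 1 \<le> (K::real)" by real_asymp
  moreover have "\<forall>\<^sub>F K in at_top. 1 \<le> (\<epsilon> * C) * ln K" using pos by real_asymp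
  moreover have "\<forall>\<^sub>F K in at_top. exp 1 * (C * ln K) ^ 3 \<le> sqrt K" using C by real_asymp
  moreover have "\<forall>\<^sub>F K in at_top. c1 * (ln K) ^ 3 \<le> sqrt K" using pos by real_asymp
  moreover have "\<forall>\<^sub>F K in at_top. ((C * ln K)\<^sup>2 + 1) * (C * ln K) \<le> \<epsilon> / 32 * K powr (3 / 4)" using pos(4) C by real_asymp
  moreover have "\<forall>\<^sub>F K in at_top. exp 2 \<le> c2 * K ^ 3" using pos by real_asymp
  moreover have "\<forall>\<^sub>F K in at_top. exp 1 * ((C * ln K)\<^sup>2 + 1) \<le> c2 * K" using pos C by real_asymp
  moreover have "\<forall>\<^sub>F K in at_top. C * ln K \<le> K" using C by real_asymp
  ultimately show ?thesis
    unfolding nibble_large_def Let_def m c c1_def[symmetric] c2_def[symmetric]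
    by eventually_elim (simp add: mult.assoc)
qed

lemma nat_ceiling_le: "0 \<le> y \<Longrightarrow> real (nat \<lceil>y\<rceil>) \<le> y + 1" for y :: real
  using of_int_ceiling_le_add_one[of y] by (simp add: le_of_int_ceiling)

text \<open>Here \<open>m\<close> is the expected number of chosen elements in each \<open>e T\<close>, so that the chosen set has density
  \<open>\<beta> = m / \<kappa>\<close> in units of one over the degree. The number \<open>L\<close> of rounds only has to be so large that the
  loss \<open>\<theta>\<^sup>2\<close> per round is negligible.\<close>

theorem nibble_conclusion:
  fixes U :: "'a set" and N :: "'a \<Rightarrow> 'a set" and TT :: "'t set" and e :: "'t \<Rightarrow> 'a set"
    and K \<kappa> S0 \<epsilon> :: real
  assumes finU: "finite U" and neU: "U \<noteq> {}" and finT: "finite TT"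
    and N_sub: "\<And>A. A \<in> U \<Longrightarrow> N A \<subseteq> U"
    and N_sym: "\<And>A B. A \<in> U \<Longrightarrow> B \<in> U \<Longrightarrow> B \<in> N A \<longleftrightarrow> A \<in> N B"
    and N_card: "\<And>A. A \<in> U \<Longrightarrow> card (N A) \<le> K / \<kappa>"
    and e_sub: "\<And>T. T \<in> TT \<Longrightarrow> e T \<subseteq> U"
    and e_card: "\<And>T. T \<in> TT \<Longrightarrow> card (e T) = K"
    and e_indep: "\<And>T A B. T \<in> TT \<Longrightarrow> A \<in> e T \<Longrightarrow> B \<in> e T \<Longrightarrow> B \<notin> N A"
    and S: "\<And>T. T \<in> TT \<Longrightarrow> (\<Sum>B\<in>U. (real (card (N B \<inter> e T)))\<^sup>2) \<le> S0 * K\<^sup>2"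
    and S': "\<And>A. A \<in> U \<Longrightarrow> (\<Sum>B\<in>U. (real (card (N B \<inter> N A)))\<^sup>2) \<le> S0 * (K / \<kappa>)\<^sup>2"
    and TU: "card TT \<le> card U" and deg: "\<And>A. A \<in> U \<Longrightarrow> card {T\<in>TT. A \<in> e T} \<le> K"
    and \<epsilon>: "0 < \<epsilon>" "\<epsilon> \<le> 1 / 8" and large: "nibble_large \<epsilon> K"
    and \<kappa>: "128 / \<epsilon>\<^sup>2 \<le> \<kappa>" and S0: "1 \<le> S0" "S0 \<le> K powr (1 / 4)"
  shows "\<exists>F Bad c. F \<subseteq> U \<and> (\<forall>A\<in>F. \<forall>B\<in>F. B \<notin> N A) \<and> Bad \<subseteq> TT \<and> 1 \<le> c \<and> c \<le> K \<and>
    (\<forall>T\<in>TT - Bad. c \<le> card (F \<inter> e T)) \<and>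
    real (card F + c * card Bad) \<le> (1 + 3 * \<epsilon>) / (1 - 4 * \<epsilon>) * c * card U / K"
proof -
  define lk where "lk = ln K"
  define m where "m = 4 * lk / \<epsilon>\<^sup>2"
  have K1: "1 \<le> K" and em: "1 \<le> \<epsilon> * m" and lc: "exp 1 * m ^ 3 \<le> sqrt K" and ld: "9 * lk\<^sup>2 * m / \<epsilon>\<^sup>2 \<le> sqrt K"
    and le: "(m\<^sup>2 + 1) * m \<le> \<epsilon> / 32 * K powr (3 / 4)" and lf: "exp 2 \<le> \<epsilon>\<^sup>2 / 2 * K ^ 3"
    and lg: "exp 1 * (m\<^sup>2 + 1) \<le> \<epsilon>\<^sup>2 / 2 * K" and lh: "m \<le> K"
    using large unfolding nibble_large_def Let_def m_def lk_def by auto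
  have K0: "0 < K" using K1 by simp
  have m8: "8 \<le> m"
  proof -
    have m0: "0 \<le> m" using K1 by (simp add: m_def lk_def)
    have "\<epsilon> * m \<le> 1 / 8 * m" using \<epsilon> m0 by (intro mult_right_mono)
    then show ?thesis using em by simp
  qed
  have \<epsilon>\<kappa>: "8 / \<epsilon> \<le> \<kappa>" "64 \<le> \<kappa>"
  proof -
    have "8 / \<epsilon> \<le> 128 / \<epsilon>\<^sup>2"
      using \<epsilon> by (simp add: field_simps power2_eq_square)
    then show 1: "8 / \<epsilon> \<le> \<kappa>" using \<kappa> by linarith
    have "64 \<le> 8 / \<epsilon>" using \<epsilon> by (simp add: field_simps)
    then show "64 \<le> \<kappa>" using 1 by linarith
  qed
  define D where "D = K / \<kappa>"
  have D0: "0 < D" using K0 \<epsilon>\<kappa> by (simp add: D_def)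
  define \<beta> where "\<beta> = m / \<kappa>"
  have \<beta>0: "0 < \<beta>" "\<beta> \<le> m" using m8 \<epsilon>\<kappa> by (simp_all add: \<beta>_def field_simps mult_left_le)
  \<comment> \<open>8 \<beta> = 32 ln K / (\<epsilon>^2 \<kappa>), so the assumption on
    \<open>\<kappa>\<close> is what bounds it by (ln K)/4. The growth factors and \<open>S0\<close>
    then cost K^(1/4) each, and the remaining sqrt K absorbs the powers of ln K.\<close>
  have exp\<beta>: "exp (8 * \<beta>) \<le> K powr (1 / 4)"
  proof -
    have lk0: "0 \<le> lk" using K1 by (simp add: lk_def)
    have "32 / (\<epsilon>\<^sup>2 * \<kappa>) \<le> 1 / 4"
      using \<kappa> \<epsilon> \<epsilon>\<kappa>(2) by (simp add: field_simps)
    then have "32 / (\<epsilon>\<^sup>2 * \<kappa>) * lk \<le> 1 / 4 * lk" using lk0 by (rule mult_right_mono)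
    moreover have "8 * \<beta> = 32 / (\<epsilon>\<^sup>2 * \<kappa>) * lk" by (simp add: \<beta>_def m_def)
    ultimately have "8 * \<beta> \<le> 1 / 4 * lk" by simp
    then show ?thesis using K0 by (simp add: powr_def lk_def)
  qed
  have expn: "exp (real n * \<beta>) \<le> K powr (1 / 4)" if "n \<le> 8" for n :: nat
  proof -
    have "real n * \<beta> \<le> 8 * \<beta>" using that \<beta>0 by (intro mult_right_mono) auto
    then show ?thesis using exp\<beta> by (meson exp_le_cancel_iff order_trans)
  qed
  have quarter: "K powr (1 / 4) * K powr (1 / 4) = sqrt K" "K powr (3 / 4) * K powr (1 / 4) = K" "sqrt K * sqrt K = K"
    using K0 by (simp_all add: powr_add[symmetric] powr_half_sqrt)
  define L where "L = nat \<lceil>m\<^sup>2\<rceil>"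
  have L: "m\<^sup>2 \<le> L" "L \<le> m\<^sup>2 + 1" unfolding L_def using nat_ceiling_le[of "m\<^sup>2"] by (simp_all add: real_nat_ceiling_ge)
  have m2: "64 \<le> m\<^sup>2" using power_mono[OF m8, of 2] by simp
  have L1: "1 \<le> L" using L(1) m2 by linarith
  define \<theta> where "\<theta> = \<beta> / L"
  have L\<theta>: "L * \<theta> = \<beta>" using L1 by (simp add: \<theta>_def)
  have inv\<kappa>: "1 / \<kappa> \<le> \<epsilon> / 8" using \<epsilon> \<epsilon>\<kappa> by (simp add: field_simps)
  have \<theta>m: "\<theta> \<le> 1 / (\<kappa> * m)"
  proof -
    have "\<theta> \<le> \<beta> / m\<^sup>2" unfolding \<theta>_def using L \<beta>0 m2 by (intro divide_left_mono) auto
    also have "\<dots> = 1 / (\<kappa> * m)" using m8 by (simp add: \<beta>_def power2_eq_square)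
    finally show ?thesis .
  qed
  have \<theta>0: "0 < \<theta>" using \<beta>0 L1 by (simp add: \<theta>_def)
  have \<theta>\<epsilon>: "\<theta> \<le> \<epsilon> / 8"
  proof -
    have "1 / (\<kappa> * m) \<le> 1 / (\<kappa> * 1)" using \<epsilon>\<kappa> m8 by (intro divide_left_mono mult_left_mono) auto
    then show ?thesis using \<theta>m inv\<kappa> by simp
  qed
  have \<theta>\<beta>: "\<theta> * \<beta> \<le> \<epsilon> / 8"
  proof -
    have "\<theta> * \<beta> \<le> 1 / (\<kappa> * m) * \<beta>" using \<theta>m \<beta>0 by (intro mult_right_mono) auto
    also have "\<dots> = 1 / \<kappa> * (1 / \<kappa>)" using m8 by (simp add: \<beta>_def)
    also have "\<dots> \<le> 1 / \<kappa> * 1" using \<epsilon>\<kappa> by (intro mult_left_mono) auto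
    finally show ?thesis using inv\<kappa> by simp
  qed
  define \<rho> where "\<rho> = \<beta> * exp (2 * \<beta>) / D"
  have \<rho>_eq: "\<rho> = m * exp (2 * \<beta>) / K" using \<epsilon>\<kappa> by (simp add: \<rho>_def \<beta>_def D_def)
  have \<rho>0: "0 \<le> \<rho>" using \<beta>0 D0 by (simp add: \<rho>_def)
  have L\<rho>: "L * \<rho> \<le> \<epsilon> / 32"
  proof -
    have "L * \<rho> \<le> (m\<^sup>2 + 1) * \<rho>" using L \<rho>0 by (intro mult_right_mono) auto
    also have "\<dots> = ((m\<^sup>2 + 1) * m) * exp (2 * \<beta>) / K" by (simp add: \<rho>_eq)
    also have "\<dots> \<le> (\<epsilon> / 32 * K powr (3 / 4)) * K powr (1 / 4) / K"
      using expn[of 2] \<epsilon> K0 by (intro divide_right_mono mult_mono[OF le]) auto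
    also have "\<dots> = \<epsilon> / 32 * (K powr (3 / 4) * K powr (1 / 4)) / K" by simp
    also have "\<dots> = \<epsilon> / 32" unfolding quarter(2) using K0 by simp
    finally show ?thesis .
  qed
  have \<rho>1: "\<rho> \<le> \<epsilon> / 32" using mult_right_mono[of 1 "real L" \<rho>] L1 \<rho>0 L\<rho> by simp
  \<comment> \<open>Chosen so that b0 \<epsilon> D = 3 ln K: of the resulting factor K^(-3), two
    powers of K pay for \<open>\<delta>\<close>, as a discarded element spoils up to
    \<open>K\<close> edges and the target for \<open>Bad\<close> is of order card U / K.\<close>
  define b0 where "b0 = 3 * lk / (\<epsilon> * D)"
  have lk0: "0 \<le> lk" using K1 by (simp add: lk_def)
  have b0: "0 \<le> b0" using lk0 \<epsilon> D0 by (simp add: b0_def)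
  interpret nib: nibble U N TT e D K "S0 * K\<^sup>2" "S0 * D\<^sup>2" \<theta> \<epsilon> \<epsilon> b0 \<rho> "1 / L" "\<beta> + 1" L
  proof unfold_locales
    show "\<theta> \<le> 1 / 2" "\<rho> \<le> 1" using \<theta>\<epsilon> \<rho>1 \<epsilon> by linarith+
  qed (use assms \<theta>0 \<rho>0 b0 D0 K0 in \<open>simp_all add: D_def\<close>)
  have par: nib.params
  proof (rule nib.params_ok[OF L1 L\<theta>[symmetric] \<rho>_def refl refl])
    have "exp (\<beta> + 1) / 2 * \<rho>\<^sup>2 * (\<beta> * (exp (2 * \<beta>) * (S0 * K\<^sup>2) / D + K)) \<le> exp 1 * m ^ 3 * exp (7 * \<beta>) * S0 / K"
    proof -
      have "\<beta> * (exp (2 * \<beta>) * (S0 * K\<^sup>2) / D + K) = K * (m * exp (2 * \<beta>) * S0 + \<beta>)"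
        using \<epsilon>\<kappa> K0 by (simp add: \<beta>_def D_def power2_eq_square field_simps)
      also have "\<dots> \<le> K * (2 * (m * exp (2 * \<beta>) * S0))"
      proof -
        have "\<beta> * (1 * 1) \<le> m * (exp (2 * \<beta>) * S0)"
          using \<beta>0 S0 by (intro mult_mono) auto
        then have "m * exp (2 * \<beta>) * S0 + \<beta> \<le> 2 * (m * exp (2 * \<beta>) * S0)" unfolding mult.assoc by linarith
        then show ?thesis using K0 by (intro mult_left_mono) auto
      qed
      finally have "exp (\<beta> + 1) / 2 * \<rho>\<^sup>2 * (\<beta> * (exp (2 * \<beta>) * (S0 * K\<^sup>2) / D + K)) \<le> exp (\<beta> + 1) / 2 * \<rho>\<^sup>2 * (K * (2 * (m * exp (2 * \<beta>) * S0)))"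
        by (rule mult_left_mono) simp
      also have "\<dots> = m ^ 3 * S0 / K * (exp (\<beta> + 1) * (exp (2 * \<beta>))\<^sup>2 * exp (2 * \<beta>))"
        using K0 by (simp add: \<rho>_eq power2_eq_square power3_eq_cube)
      also have "exp (\<beta> + 1) * (exp (2 * \<beta>))\<^sup>2 * exp (2 * \<beta>) = exp 1 * exp (7 * \<beta>)"
        by (simp add: power2_eq_square exp_add[symmetric])
      finally show ?thesis by (simp add: mult_ac)
    qed
    also have "\<dots> \<le> sqrt K * K powr (1 / 4) * K powr (1 / 4) / K"
      using lc expn[of 7] S0 K0 m8 by (intro divide_right_mono mult_mono) auto
    also have "\<dots> = 1" unfolding mult.assoc quarter using K0 by simp
    finally show "exp (\<beta> + 1) / 2 * \<rho>\<^sup>2 * (\<beta> * (exp (2 * \<beta>) * (S0 * K\<^sup>2) / D + K)) \<le> 1" .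
    have "(b0 * exp (2 * \<beta>))\<^sup>2 / 2 * (\<beta> * (exp (2 * \<beta>) * (S0 * D\<^sup>2) / D + D)) \<le> 9 * lk\<^sup>2 * m / \<epsilon>\<^sup>2 * exp (6 * \<beta>) * S0 / K"
    proof -
      have "\<beta> * (exp (2 * \<beta>) * (S0 * D\<^sup>2) / D + D) = \<beta> * D * (exp (2 * \<beta>) * S0 + 1)"
        using D0 by (simp add: power2_eq_square field_simps)
      also have "\<dots> \<le> \<beta> * D * (2 * (exp (2 * \<beta>) * S0))"
      proof -
        have "1 * 1 \<le> exp (2 * \<beta>) * S0" using \<beta>0 S0 by (intro mult_mono) auto
        then have "exp (2 * \<beta>) * S0 + 1 \<le> 2 * (exp (2 * \<beta>) * S0)" by linarith
        then show ?thesis using \<beta>0 D0 by (intro mult_left_mono) auto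
      qed
      finally have "(b0 * exp (2 * \<beta>))\<^sup>2 / 2 * (\<beta> * (exp (2 * \<beta>) * (S0 * D\<^sup>2) / D + D)) \<le> (b0 * exp (2 * \<beta>))\<^sup>2 / 2 * (\<beta> * D * (2 * (exp (2 * \<beta>) * S0)))"
        by (rule mult_left_mono) simp
      also have "\<dots> = b0\<^sup>2 * \<beta> * D * S0 * ((exp (2 * \<beta>))\<^sup>2 * exp (2 * \<beta>))"
        by (simp add: power_mult_distrib)
      also have "(exp (2 * \<beta>))\<^sup>2 * exp (2 * \<beta>) = exp (6 * \<beta>)"
        by (simp add: power2_eq_square exp_add[symmetric])
      also have "b0\<^sup>2 * \<beta> * D = 9 * lk\<^sup>2 * m / \<epsilon>\<^sup>2 / K"
        using \<epsilon>\<kappa> K0 \<epsilon> by (simp add: b0_def \<beta>_def D_def power2_eq_square field_simps)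
      finally show ?thesis by (simp add: mult_ac)
    qed
    also have "\<dots> \<le> sqrt K * K powr (1 / 4) * K powr (1 / 4) / K"
      using ld expn[of 6] S0 K0 m8 by (intro divide_right_mono mult_mono) auto
    also have "\<dots> = 1" unfolding mult.assoc quarter using K0 by simp
    finally show "(b0 * exp (2 * \<beta>))\<^sup>2 / 2 * (\<beta> * (exp (2 * \<beta>) * (S0 * D\<^sup>2) / D + D)) \<le> 1" .
  qed (use S0 in simp_all)
  \<comment> \<open>To first order \<open>a 0 * K\<close> is \<epsilon> m: an edge expects
    \<open>m\<close> chosen elements, each of weight x' \<approx> \<epsilon>. The corrections fit
    into the factor 1 - 2 \<epsilon>.\<close>
  have a0: "\<epsilon> * m * (1 - 2 * \<epsilon>) \<le> nib.a 0 * K"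
  proof -
    have h: "L * (2 * \<theta>\<^sup>2 + \<rho>) \<le> 1"
    proof -
      have "L * (2 * \<theta>\<^sup>2 + \<rho>) = 2 * (\<theta> * (L * \<theta>)) + L * \<rho>" by (simp add: power2_eq_square algebra_simps)
      then show ?thesis unfolding L\<theta> using \<theta>\<beta> L\<rho> \<epsilon> by linarith
    qed
    have "1 - \<epsilon> / 2 \<le> 1 - \<theta> - 2 * \<theta> * (L * \<theta>) - 2 * L * \<rho>"
    proof -
      have "2 * \<theta> * \<beta> = 2 * (\<theta> * \<beta>)" "2 * L * \<rho> = 2 * (L * \<rho>)" by simp_all
      then show ?thesis unfolding L\<theta> using \<theta>\<epsilon> \<theta>\<beta> L\<rho> \<epsilon> by linarith
    qed
    then have "nib.x' * \<beta> / ((1 + \<epsilon>) * D) * (1 - \<epsilon> / 2) \<le> nib.x' * \<beta> / ((1 + \<epsilon>) * D) * (1 - \<theta> - 2 * \<theta> * (L * \<theta>) - 2 * L * \<rho>)"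
      using nib.x'_nn \<beta>0 \<epsilon> D0 by (intro mult_left_mono) auto
    also have "\<dots> \<le> nib.a 0" using nib.a0_lower[OF L1 h] L\<theta> by simp
    finally have fa: "nib.x' * \<beta> / ((1 + \<epsilon>) * D) * (1 - \<epsilon> / 2) \<le> nib.a 0" .
    have "nib.x' * \<beta> / ((1 + \<epsilon>) * D) * (1 - \<epsilon> / 2) * K \<le> nib.a 0 * K"
      by (rule mult_right_mono[OF fa less_imp_le[OF K0]])
    moreover have "nib.x' * \<beta> / ((1 + \<epsilon>) * D) * (1 - \<epsilon> / 2) * K = nib.x' * m * (1 / (1 + \<epsilon>)) * (1 - \<epsilon> / 2)"
    proof -
      have "\<beta> / D * K = m" using K0 \<epsilon>\<kappa> by (simp add: \<beta>_def D_def)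
      moreover have "nib.x' * \<beta> / ((1 + \<epsilon>) * D) * (1 - \<epsilon> / 2) * K = nib.x' * (\<beta> / D * K) * (1 / (1 + \<epsilon>)) * (1 - \<epsilon> / 2)"
        by (simp add: mult_ac)
      ultimately show ?thesis by simp
    qed
    moreover have "\<epsilon> * (1 - \<epsilon> / 2) * m * (1 - \<epsilon>) * (1 - \<epsilon> / 2) \<le> nib.x' * m * (1 / (1 + \<epsilon>)) * (1 - \<epsilon> / 2)"
    proof (intro mult_mono)
      show "\<epsilon> * (1 - \<epsilon> / 2) \<le> nib.x'"
        using one_minus_exp_neg_ge[of \<epsilon>] \<epsilon> by (simp add: nib.x'_def power2_eq_square algebra_simps)
      show "1 - \<epsilon> \<le> 1 / (1 + \<epsilon>)" using \<epsilon> by (simp add: field_simps)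
    qed (use \<epsilon> m8 nib.x'_nn in auto)
    moreover have "\<epsilon> * m * (1 - 2 * \<epsilon>) \<le> \<epsilon> * (1 - \<epsilon> / 2) * m * (1 - \<epsilon>) * (1 - \<epsilon> / 2)"
    proof -
      have "1 - 2 * \<epsilon> \<le> (1 - \<epsilon> / 2) * (1 - \<epsilon>) * (1 - \<epsilon> / 2)"
      proof -
        have "(1 - \<epsilon> / 2) * (1 - \<epsilon>) * (1 - \<epsilon> / 2) = 1 - 2 * \<epsilon> + \<epsilon> * \<epsilon> * (5 / 4 - \<epsilon> / 4)"
          by (simp add: field_simps)
        moreover have "0 \<le> \<epsilon> * \<epsilon> * (5 / 4 - \<epsilon> / 4)" using \<epsilon> by simp
        ultimately show ?thesis by linarith
      qed
      then have "\<epsilon> * m * (1 - 2 * \<epsilon>) \<le> \<epsilon> * m * ((1 - \<epsilon> / 2) * (1 - \<epsilon>) * (1 - \<epsilon> / 2))"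
        using \<epsilon> m8 by (intro mult_left_mono) auto
      then show ?thesis by (simp add: mult_ac)
    qed
    ultimately show ?thesis by linarith
  qed
  \<comment> \<open>The threshold lies 2 \<epsilon> m below (1 - 2 \<epsilon>) m, so failing it has
    exponential cost 2 \<epsilon>^2 m = 8 ln K. This explains the choice m = 4 ln K /
    \<epsilon>^2.\<close>
  define c where "c = nat \<lceil>(1 - 4 * \<epsilon>) * m\<rceil>"
  have cpos: "0 < (1 - 4 * \<epsilon>) * m" using \<epsilon> m8 by simp
  have c: "(1 - 4 * \<epsilon>) * m \<le> c" "c \<le> (1 - 4 * \<epsilon>) * m + 1" unfolding c_def using nat_ceiling_le[of "(1 - 4 * \<epsilon>) * m"] cpos by (simp_all add: real_nat_ceiling_ge)
  have c1: "1 \<le> c" using c(1) cpos by linarith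
  have cm: "c \<le> m" using c(2) em by (simp add: algebra_simps)
  have Ucard: "0 < card U" using finU neU by (simp add: card_gt_0_iff)
  let ?u = "real (card U)"
  \<comment> \<open>The weights are normalised so that the three initial terms are at most 1,
    \<epsilon>/2 and \<epsilon>/2. The final bound 1 + \<epsilon> then limits \<open>card F\<close>
    to (1 + \<epsilon>) m card U / K, and, through the 1/\<epsilon> in \<open>\<gamma>\<close> and
    \<open>\<delta>\<close>, limits \<open>card Bad\<close> to 2 \<epsilon> card U / K.\<close>
  define \<alpha> where "\<alpha> = D / (\<beta> * ?u)"
  define \<gamma> where "\<gamma> = K / (\<epsilon> * ?u) * exp (\<epsilon> * c)"
  define \<delta> where "\<delta> = K / (\<epsilon> * ?u) * K"
  have nn: "0 \<le> \<alpha>" "0 \<le> \<gamma>" "0 \<le> \<delta>" using D0 \<beta>0 K0 \<epsilon> by (simp_all add: \<alpha>_def \<gamma>_def \<delta>_def)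
  obtain F J where F: "F \<subseteq> U" "\<forall>A\<in>F. \<forall>B\<in>F. B \<notin> N A" and J: "J \<subseteq> U"
    and ineq: "\<alpha> * card F + \<gamma> * (\<Sum>T | T \<in> TT \<and> e T \<inter> J = {}. exp (- \<epsilon> * card (F \<inter> e T))) + \<delta> * card J \<le>
    \<alpha> * (L * \<theta> * card U / ((1 + \<epsilon>) * D)) + \<gamma> * (card TT * exp (- nib.a 0 * K + L * (1 / L))) +
    \<delta> * (L * card U * exp (L * (1 / L) - b0 * \<epsilon> * D))"
    using nib.nibble_exists[OF par nn] by auto
  have LL: "L * (1 / L) = (1::real)" using L1 by simp
  have expl: "exp (- (real n * lk)) = 1 / K ^ n" for n
    using K0 by (simp add: lk_def exp_minus exp_of_nat_mult field_simps)
  have t1: "\<alpha> * (L * \<theta> * card U / ((1 + \<epsilon>) * D)) \<le> 1"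
  proof -
    have "\<alpha> * (L * \<theta> * card U / ((1 + \<epsilon>) * D)) = 1 / (1 + \<epsilon>)"
      unfolding L\<theta> \<alpha>_def using \<beta>0 D0 Ucard by simp
    then show ?thesis using \<epsilon> by simp
  qed
  have t2: "\<gamma> * (card TT * exp (- nib.a 0 * K + L * (1 / L))) \<le> \<epsilon> / 2"
  proof -
    have "\<epsilon> * c - nib.a 0 * K + 1 \<le> 2 - 8 * lk"
    proof -
      have "\<epsilon> * c \<le> \<epsilon> * ((1 - 4 * \<epsilon>) * m + 1)" using c(2) \<epsilon> by (intro mult_left_mono) auto
      also have "\<dots> = \<epsilon> * m * (1 - 2 * \<epsilon>) - 2 * (\<epsilon>\<^sup>2 * m) + \<epsilon>" by (simp add: power2_eq_square algebra_simps)
      also have "\<epsilon>\<^sup>2 * m = 4 * lk" using \<epsilon> by (simp add: m_def)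
      finally show ?thesis using a0 \<epsilon> by linarith
    qed
    then have "exp (\<epsilon> * c - nib.a 0 * K + 1) \<le> exp (2 - 8 * lk)" by simp
    also have "\<dots> = exp 2 * exp (- (real 8 * lk))" by (simp add: exp_add[symmetric])
    also have "\<dots> = exp 2 / K ^ 8" unfolding expl by simp
    also have "\<dots> \<le> exp 2 / K ^ 4" using K1 by (intro divide_left_mono power_increasing) auto
    finally have "K * exp (\<epsilon> * c - nib.a 0 * K + 1) \<le> K * (exp 2 / K ^ 4)" using K0 by (intro mult_left_mono) auto
    also have "\<dots> = exp 2 / K ^ 3" using K0 by (simp add: eval_nat_numeral)
    also have "\<dots> \<le> \<epsilon>\<^sup>2 / 2" using lf K0 by (simp add: pos_divide_le_eq)
    finally have k: "K * exp (\<epsilon> * c - nib.a 0 * K + 1) \<le> \<epsilon>\<^sup>2 / 2" .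
    have "\<gamma> * (card TT * exp (- nib.a 0 * K + L * (1 / L))) \<le> \<gamma> * (card U * exp (- nib.a 0 * K + L * (1 / L)))"
      using nn TU by (intro mult_left_mono mult_right_mono) auto
    also have "\<dots> = K * exp (\<epsilon> * c - nib.a 0 * K + 1) / \<epsilon>"
      unfolding LL \<gamma>_def using Ucard by (simp add: exp_add exp_diff exp_minus field_simps)
    also have "\<dots> \<le> (\<epsilon>\<^sup>2 / 2) / \<epsilon>" using k \<epsilon> by (intro divide_right_mono) auto
    also have "\<dots> = \<epsilon> / 2" using \<epsilon> by (simp add: power2_eq_square)
    finally show ?thesis .
  qed
  have t3: "\<delta> * (L * card U * exp (L * (1 / L) - b0 * \<epsilon> * D)) \<le> \<epsilon> / 2"
  proof -
    have "b0 * \<epsilon> * D = real 3 * lk" using \<epsilon> D0 by (simp add: b0_def)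
    then have "exp (L * (1 / L) - b0 * \<epsilon> * D) = exp 1 * exp (- (real 3 * lk))" unfolding LL by (simp add: exp_add[symmetric])
    then have "exp (L * (1 / L) - b0 * \<epsilon> * D) = exp 1 / K ^ 3" unfolding expl by simp
    then have "\<delta> * (L * card U * exp (L * (1 / L) - b0 * \<epsilon> * D)) = (exp 1 * L) / K / \<epsilon>"
      unfolding \<delta>_def using Ucard K0 by (simp add: power3_eq_cube mult.commute)
    also have "\<dots> \<le> (\<epsilon>\<^sup>2 / 2) / \<epsilon>"
    proof -
      have "exp 1 * L \<le> exp 1 * (m\<^sup>2 + 1)" using L by simp
      then have "exp 1 * L \<le> \<epsilon>\<^sup>2 / 2 * K" using lg by linarith
      then show ?thesis using \<epsilon> K0 by (intro divide_right_mono) (simp_all add: pos_divide_le_eq)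
    qed
    also have "\<dots> = \<epsilon> / 2" using \<epsilon> by (simp add: power2_eq_square)
    finally show ?thesis .
  qed
  define live where "live = {T. T \<in> TT \<and> e T \<inter> J = {}}"
  \<comment> \<open>Edges spoiled by \<open>J\<close> number at most \<open>K\<close> per discarded
    element, by \<open>deg\<close>; live edges below the threshold are counted by Markov's
    inequality with weight \<open>exp (\<epsilon> * c)\<close>.\<close>
  define Bad where "Bad = {T\<in>TT. e T \<inter> J \<noteq> {}} \<union> {T\<in>live. card (F \<inter> e T) < c}"
  define \<Sigma> where "\<Sigma> = (\<Sum>T\<in>live. exp (- \<epsilon> * card (F \<inter> e T)))"
  have total: "\<alpha> * card F + \<gamma> * \<Sigma> + \<delta> * card J \<le> 1 + \<epsilon>"
    using ineq t1 t2 t3 unfolding \<Sigma>_def live_def by linarith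
  have \<Sigma>0: "0 \<le> \<Sigma>" unfolding \<Sigma>_def by (intro sum_nonneg) auto
  have Fcard: "card F \<le> (1 + \<epsilon>) * m * ?u / K"
  proof -
    have "\<alpha> * card F \<le> 1 + \<epsilon>" using total mult_nonneg_nonneg[OF nn(2) \<Sigma>0] mult_nonneg_nonneg[OF nn(3), of "card J"] by linarith
    moreover have "\<alpha> = K / (m * ?u)" unfolding \<alpha>_def D_def \<beta>_def using \<epsilon>\<kappa> by simp
    moreover have "0 < K / (m * ?u)" using K0 m8 Ucard by simp
    ultimately have "card F \<le> (1 + \<epsilon>) / (K / (m * ?u))" by (simp only: pos_le_divide_eq mult.commute)
    then show ?thesis by simp
  qed
  have Badcard: "card Bad \<le> 2 * \<epsilon> * ?u / K"
  proof -
    have finJ: "finite J" using J finU finite_subset by blast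
    have finl: "finite live" using finT by (simp add: live_def)
    have "{T\<in>TT. e T \<inter> J \<noteq> {}} \<subseteq> (\<Union>A\<in>J. {T\<in>TT. A \<in> e T})" by auto
    then have "card {T\<in>TT. e T \<inter> J \<noteq> {}} \<le> card (\<Union>A\<in>J. {T\<in>TT. A \<in> e T})"
      using finJ finT by (intro card_mono) auto
    also have "\<dots> \<le> (\<Sum>A\<in>J. card {T\<in>TT. A \<in> e T})" using finJ by (rule card_UN_le)
    finally have "card {T\<in>TT. e T \<inter> J \<noteq> {}} \<le> (\<Sum>A\<in>J. card {T\<in>TT. A \<in> e T})" .
    from of_nat_mono[OF this, where 'a = real]
    have "real (card {T\<in>TT. e T \<inter> J \<noteq> {}}) \<le> (\<Sum>A\<in>J. real (card {T\<in>TT. A \<in> e T}))"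
      by simp
    also have "\<dots> \<le> (\<Sum>A\<in>J. K)" using J deg by (intro sum_mono) auto
    finally have b1: "real (card {T\<in>TT. e T \<inter> J \<noteq> {}}) \<le> K * card J" by (simp add: mult.commute)
    have "real (card {T\<in>live. card (F \<inter> e T) < c}) = (\<Sum>T\<in>{T\<in>live. card (F \<inter> e T) < c}. 1)" by simp
    also have "\<dots> \<le> (\<Sum>T\<in>{T\<in>live. card (F \<inter> e T) < c}. exp (\<epsilon> * c) * exp (- \<epsilon> * card (F \<inter> e T)))"
    proof (rule sum_mono)
      fix T assume "T \<in> {T\<in>live. card (F \<inter> e T) < c}"
      then have "0 \<le> \<epsilon> * (real c - card (F \<inter> e T))" using \<epsilon> by simp
      then show "1 \<le> exp (\<epsilon> * c) * exp (- \<epsilon> * card (F \<inter> e T))"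
        unfolding exp_add[symmetric] by (simp add: algebra_simps)
    qed
    also have "\<dots> \<le> (\<Sum>T\<in>live. exp (\<epsilon> * c) * exp (- \<epsilon> * card (F \<inter> e T)))"
      using finl by (intro sum_mono2) auto
    also have "\<dots> = exp (\<epsilon> * c) * \<Sigma>" by (simp add: \<Sigma>_def sum_distrib_left)
    finally have b2: "real (card {T\<in>live. card (F \<inter> e T) < c}) \<le> exp (\<epsilon> * c) * \<Sigma>" .
    have "real (card Bad) \<le> K * card J + exp (\<epsilon> * c) * \<Sigma>"
      unfolding Bad_def using card_Un_le[of "{T\<in>TT. e T \<inter> J \<noteq> {}}" "{T\<in>live. card (F \<inter> e T) < c}"] b1 b2 by linarith
    then have "K / (\<epsilon> * ?u) * card Bad \<le> K / (\<epsilon> * ?u) * (K * card J + exp (\<epsilon> * c) * \<Sigma>)"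
      using K0 \<epsilon> by (intro mult_left_mono) auto
    also have "\<dots> = \<gamma> * \<Sigma> + \<delta> * card J" by (simp add: \<gamma>_def \<delta>_def algebra_simps)
    also have "\<dots> \<le> 1 + \<epsilon>" using total mult_nonneg_nonneg[OF nn(1), of "card F"] by simp
    also have "\<dots> \<le> 2" using \<epsilon> by simp
    finally have fb: "K / (\<epsilon> * ?u) * card Bad \<le> 2" .
    have "0 < K / (\<epsilon> * ?u)" using K0 \<epsilon> Ucard by simp
    then have "card Bad \<le> 2 / (K / (\<epsilon> * ?u))" using fb by (simp only: pos_le_divide_eq mult.commute)
    then show ?thesis by simp
  qed
  have "real (card F + c * card Bad) \<le> (1 + \<epsilon>) * m * ?u / K + m * (2 * \<epsilon> * ?u / K)"
    using Fcard mult_mono[OF cm Badcard] m8 by simp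
  also have "\<dots> = (1 + 3 * \<epsilon>) * (m * (?u / K))"
    using K0 by (simp add: add_divide_distrib[symmetric]) (simp add: algebra_simps)
  also have "\<dots> \<le> (1 + 3 * \<epsilon>) * (c / (1 - 4 * \<epsilon>) * (?u / K))"
  proof -
    have "m \<le> c / (1 - 4 * \<epsilon>)" using c(1) \<epsilon> by (simp add: pos_le_divide_eq mult.commute)
    then show ?thesis using \<epsilon> K0 by (intro mult_left_mono mult_right_mono) auto
  qed
  also have "\<dots> = (1 + 3 * \<epsilon>) / (1 - 4 * \<epsilon>) * c * card U / K" by simp
  finally have fin: "real (card F + c * card Bad) \<le> (1 + 3 * \<epsilon>) / (1 - 4 * \<epsilon>) * c * card U / K" .
  have BT: "Bad \<subseteq> TT" by (auto simp: Bad_def live_def)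
  have good: "\<forall>T\<in>TT - Bad. c \<le> card (F \<inter> e T)" by (auto simp: Bad_def live_def not_less)
  have cK: "c \<le> K" using cm lh by linarith
  show ?thesis
    by (intro exI[of _ F] exI[of _ Bad] exI[of _ c] conjI F BT c1 cK good fin)
qed

text \<open>The sets \<open>T\<close> are the complements of the s-sets of colours, and the ratio of
  \<open>K\<close> to the Kneser degree is exactly (s + 1 + d)/d, by absorption. The squared
  codegrees come from \<open>sum_disjoint_subsets_squared\<close>, applied to W = T and to W = the
  complement of A. The threshold \<open>\<kappa>0\<close> depends on \<open>\<epsilon>\<close>
  alone.\<close>

theorem kneser_family:
  fixes \<epsilon> :: real
  assumes \<epsilon>: "0 < \<epsilon>" "\<epsilon> \<le> 1 / 8"
  shows "\<exists>\<kappa>0>0. \<forall>s d. 1 \<le> d \<longrightarrow> \<kappa>0 * real d \<le> real (s + 1 + d) \<longrightarrow>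
    (\<exists>F Bad c. F \<subseteq> {A. A \<subseteq> {..<2 * s + 1 + d} \<and> card A = s + 1} \<and> (\<forall>A\<in>F. \<forall>B\<in>F. A \<inter> B \<noteq> {}) \<and>
      Bad \<subseteq> {T. T \<subseteq> {..<2 * s + 1 + d} \<and> card T = s + 1 + d} \<and> 1 \<le> c \<and> c \<le> (s + 1 + d) choose (s + 1) \<and>
      (\<forall>T. T \<subseteq> {..<2 * s + 1 + d} \<longrightarrow> card T = s + 1 + d \<longrightarrow> T \<notin> Bad \<longrightarrow> c \<le> card {A\<in>F. A \<subseteq> T}) \<and>
      real (card F + c * card Bad) \<le> (1 + 3 * \<epsilon>) / (1 - 4 * \<epsilon>) * c *
        real ((2 * s + 1 + d) choose (s + 1)) / real ((s + 1 + d) choose (s + 1)))"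
proof -
  obtain K0 where K0: "\<And>K. K0 \<le> K \<Longrightarrow> nibble_large \<epsilon> K"
    using eventually_nibble_large[OF \<epsilon>(1)] unfolding eventually_at_top_linorder by blast
  \<comment> \<open>256 = 4^4 gives 4^d \<le> K^(1/4), because K \<ge> \<kappa>^d; \<open>K0\<close>
    suffices because K \<ge> \<kappa>; the third bound is the assumption of
    \<open>nibble_conclusion\<close> on \<open>\<kappa>\<close>.\<close>
  define \<kappa>0 where "\<kappa>0 = max (max 256 K0) (128 / \<epsilon>\<^sup>2)"
  have \<kappa>0: "256 \<le> \<kappa>0" "K0 \<le> \<kappa>0" "128 / \<epsilon>\<^sup>2 \<le> \<kappa>0" unfolding \<kappa>0_def by auto
  show ?thesis
  proof (intro exI[of _ \<kappa>0] conjI allI impI)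
    show "0 < \<kappa>0" using \<kappa>0 by simp
    fix s d :: nat
    assume d: "1 \<le> d" and big: "\<kappa>0 * real d \<le> real (s + 1 + d)"
    let ?X = "{..<2 * s + 1 + d}"
    define U where "U = {A. A \<subseteq> ?X \<and> card A = s + 1}"
    define N where "N A = {B\<in>U. B \<inter> A = {}}" for A
    define TT where "TT = {T. T \<subseteq> ?X \<and> card T = s + 1 + d}"
    define e where "e T = {A. A \<subseteq> T \<and> card A = s + 1}" for T :: "nat set"
    define K where "K = (s + 1 + d) choose (s + 1)"
    define \<kappa> where "\<kappa> = real (s + 1 + d) / real d"
    have \<kappa>: "\<kappa>0 \<le> \<kappa>" using big d by (simp add: \<kappa>_def pos_le_divide_eq)
    have Ksym: "K = (s + 1 + d) choose d"
      unfolding K_def using binomial_symmetric[of "s + 1" "s + 1 + d"] by simp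
    have K\<kappa>: "\<kappa> ^ d \<le> real K"
      unfolding Ksym \<kappa>_def by (rule binomial_ge_n_over_k_pow_k) simp
    have "\<kappa> ^ 1 \<le> \<kappa> ^ d" using \<kappa> \<kappa>0 d by (intro power_increasing) auto
    then have Kbig: "K0 \<le> real K" "1 \<le> real K" using \<kappa> \<kappa>0 K\<kappa> by simp_all
    have ds: "d < s + 1"
    proof -
      have "256 * real d \<le> \<kappa>0 * real d" using \<kappa>0 by (intro mult_right_mono) auto
      then have "256 * real d \<le> real (s + 1 + d)" using big by linarith
      then show ?thesis using d by linarith
    qed
    have Dcard: "real ((s + d) choose (s + 1)) = real K / \<kappa>"
    proof -
      have "d * K = (s + 1 + d) * ((s + d) choose (s + 1))"
        unfolding K_def using binomial_absorb_comp[of "s + 1 + d" "s + 1"] by simp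
      then have "real d * real K = real (s + 1 + d) * real ((s + d) choose (s + 1))"
        by (metis of_nat_mult)
      then show ?thesis using d by (simp add: \<kappa>_def field_simps)
    qed
    have N_alt: "N A = {B. B \<subseteq> ?X - A \<and> card B = s + 1}" for A
      by (auto simp: N_def U_def)
    have cardA: "card (?X - A) = s + d" "finite A" if "A \<in> U" for A
    proof -
      show "finite A" using that finite_subset[of A ?X] by (auto simp: U_def)
      then show "card (?X - A) = s + d" using that by (simp add: U_def card_Diff_subset)
    qed
    have finU: "finite U" by (simp add: U_def)
    have neU: "U \<noteq> {}"
    proof -
      have "{..<s + 1} \<in> U" by (auto simp: U_def)
      then show ?thesis by blast
    qed
    have side1: "(s choose (s + 1 - j)) \<le> (s + 1 + d) choose j" if "j \<le> s + 1" for j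
    proof -
      have "(s choose (s + 1 - j)) \<le> (s + 1) choose (s + 1 - j)" by (rule binomial_right_mono) simp
      also have "\<dots> = (s + 1) choose j" using binomial_symmetric[OF that] by simp
      also have "\<dots> \<le> (s + 1 + d) choose j" by (rule binomial_right_mono) simp
      finally show ?thesis .
    qed
    have side2: "((s + 1) choose (s + 1 - j)) \<le> (s + d) choose j" if "j \<le> s + 1" for j
    proof -
      have "(s + 1) choose (s + 1 - j) = (s + 1) choose j" using binomial_symmetric[OF that] by simp
      also have "\<dots> \<le> (s + d) choose j" using d by (intro binomial_right_mono) simp
      finally show ?thesis .
    qed
    have "\<exists>F Bad c. F \<subseteq> U \<and> (\<forall>A\<in>F. \<forall>B\<in>F. B \<notin> N A) \<and> Bad \<subseteq> TT \<and> 1 \<le> c \<and> real c \<le> real K \<and>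
      (\<forall>T\<in>TT - Bad. c \<le> card (F \<inter> e T)) \<and>
      real (card F + c * card Bad) \<le> (1 + 3 * \<epsilon>) / (1 - 4 * \<epsilon>) * c * card U / real K"
    proof (rule nibble_conclusion[where \<kappa> = \<kappa> and ?S0.0 = "4 ^ d"])
      show "finite U" "U \<noteq> {}" by (fact finU neU)+
      show "finite TT" by (simp add: TT_def)
      show "N A \<subseteq> U" for A by (auto simp: N_def)
      show "B \<in> N A \<longleftrightarrow> A \<in> N B" if "A \<in> U" "B \<in> U" for A B using that by (auto simp: N_def)
      show "real (card (N A)) \<le> real K / \<kappa>" if "A \<in> U" for A
        unfolding N_alt using cardA[OF that] by (simp add: n_subsets flip: Dcard)
      show "e T \<subseteq> U" if "T \<in> TT" for T using that by (auto simp: e_def U_def TT_def)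
      show "real (card (e T)) = real K" if "T \<in> TT" for T
        using that finite_subset[of T ?X] by (simp add: e_def TT_def n_subsets K_def)
      show "B \<notin> N A" if "T \<in> TT" "A \<in> e T" "B \<in> e T" for T A B
      proof
        assume "B \<in> N A"
        then have disj: "A \<inter> B = {}" by (auto simp: N_def)
        have fT: "finite T" using that(1) finite_subset[of T ?X] by (auto simp: TT_def)
        have "finite A" "finite B" using that(2,3) fT finite_subset by (auto simp: e_def)
        then have "card (A \<union> B) = (s + 1) + (s + 1)"
          using disj that(2,3) by (simp add: card_Un_disjoint e_def)
        moreover have "card (A \<union> B) \<le> card T" using that(2,3) fT by (intro card_mono) (auto simp: e_def)
        ultimately show False using that(1) ds by (simp add: TT_def)
      qed
      show "(\<Sum>B\<in>U. (real (card (N B \<inter> e T)))\<^sup>2) \<le> 4 ^ d * (real K)\<^sup>2" if "T \<in> TT" for T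
      proof -
        have T: "T \<subseteq> ?X" "card T = s + 1 + d" using that by (auto simp: TT_def)
        have cX: "card (?X - T) = s" using T finite_subset[OF T(1)] by (simp add: card_Diff_subset)
        have "(\<Sum>B\<in>U. (card {A. A \<subseteq> T \<and> card A = s + 1 \<and> A \<inter> B = {}})\<^sup>2) \<le> 4 ^ (card T - (s + 1)) * (card T choose (s + 1))\<^sup>2"
          unfolding U_def by (rule sum_disjoint_subsets_squared) (use T side1 cX in auto)
        also have "\<dots> = 4 ^ d * K\<^sup>2" using T by (simp add: K_def)
        finally have "(\<Sum>B\<in>U. (card {A. A \<subseteq> T \<and> card A = s + 1 \<and> A \<inter> B = {}})\<^sup>2) \<le> 4 ^ d * K\<^sup>2" .
        moreover have "N B \<inter> e T = {A. A \<subseteq> T \<and> card A = s + 1 \<and> A \<inter> B = {}}" for B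
          using T by (auto simp: N_def e_def U_def)
        ultimately have "(\<Sum>B\<in>U. (card (N B \<inter> e T))\<^sup>2) \<le> 4 ^ d * K\<^sup>2" by simp
        from of_nat_mono[OF this, where 'a = real] show ?thesis by simp
      qed
      show "(\<Sum>B\<in>U. (real (card (N B \<inter> N A)))\<^sup>2) \<le> 4 ^ d * (real K / \<kappa>)\<^sup>2" if A: "A \<in> U" for A
      proof -
        have AX: "A \<subseteq> ?X" "card A = s + 1" using A by (auto simp: U_def)
        have cX: "card (?X - (?X - A)) = s + 1" using AX by (simp add: double_diff)
        have "(\<Sum>B\<in>U. (card {C. C \<subseteq> ?X - A \<and> card C = s + 1 \<and> C \<inter> B = {}})\<^sup>2) \<le> 4 ^ (card (?X - A) - (s + 1)) * (card (?X - A) choose (s + 1))\<^sup>2"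
          unfolding U_def by (rule sum_disjoint_subsets_squared) (use cX side2 cardA(1)[OF A] d in auto)
        also have "\<dots> \<le> 4 ^ d * ((s + d) choose (s + 1))\<^sup>2"
          unfolding cardA(1)[OF A] by (intro mult_right_mono power_increasing) auto
        finally have "(\<Sum>B\<in>U. (card {C. C \<subseteq> ?X - A \<and> card C = s + 1 \<and> C \<inter> B = {}})\<^sup>2) \<le> 4 ^ d * ((s + d) choose (s + 1))\<^sup>2" .
        moreover have "N B \<inter> N A = {C. C \<subseteq> ?X - A \<and> card C = s + 1 \<and> C \<inter> B = {}}" for B
          by (auto simp: N_def U_def)
        ultimately have "(\<Sum>B\<in>U. (card (N B \<inter> N A))\<^sup>2) \<le> 4 ^ d * ((s + d) choose (s + 1))\<^sup>2" by simp
        from of_nat_mono[OF this, where 'a = real] show ?thesis by (simp flip: Dcard)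
      qed
      show "card TT \<le> card U"
      proof -
        have "card TT = (2 * s + 1 + d) choose (s + 1 + d)" by (simp add: TT_def n_subsets)
        also have "\<dots> = (2 * s + 1 + d) choose s"
          using binomial_symmetric[of s "2 * s + 1 + d"] by (simp add: mult_2)
        also have "\<dots> \<le> (2 * s + 1 + d) choose (s + 1)" using d by (intro binomial_mono) auto
        finally show ?thesis by (simp add: U_def n_subsets)
      qed
      show "real (card {T\<in>TT. A \<in> e T}) \<le> real K" if A: "A \<in> U" for A
      proof -
        have AX: "A \<subseteq> ?X" "card A = s + 1" using A by (auto simp: U_def)
        have "card {T\<in>TT. A \<in> e T} \<le> card {Z. Z \<subseteq> ?X - A \<and> card Z = d}"
        proof (rule card_inj_on_le)
          show "inj_on (\<lambda>T. T - A) {T\<in>TT. A \<in> e T}" by (auto simp: inj_on_def e_def)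
          show "(\<lambda>T. T - A) ` {T\<in>TT. A \<in> e T} \<subseteq> {Z. Z \<subseteq> ?X - A \<and> card Z = d}"
            using AX cardA(2)[OF A] by (auto simp: TT_def e_def card_Diff_subset)
        qed simp
        also have "\<dots> = (s + d) choose d" using cardA(1)[OF A] by (simp add: n_subsets)
        also have "\<dots> \<le> K" unfolding Ksym by (rule binomial_right_mono) simp
        finally show ?thesis by simp
      qed
      show "0 < \<epsilon>" "\<epsilon> \<le> 1 / 8" by (fact \<epsilon>)+
      show "nibble_large \<epsilon> (real K)" by (rule K0[OF Kbig(1)])
      show "128 / \<epsilon>\<^sup>2 \<le> \<kappa>" using \<kappa> \<kappa>0 by linarith
      show "(1::real) \<le> 4 ^ d" by simp
      show "(4::real) ^ d \<le> real K powr (1 / 4)"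
      proof -
        have "((4::real) ^ d) ^ 4 = (4 ^ 4) ^ d" by (simp only: power_mult[symmetric] mult.commute)
        also have "\<dots> = 256 ^ d" by simp
        also have "\<dots> \<le> \<kappa> ^ d" using \<kappa> \<kappa>0 by (intro power_mono) auto
        also have "\<dots> \<le> real K" by (rule K\<kappa>)
        finally have "(((4::real) ^ d) ^ 4) powr (1 / 4) \<le> real K powr (1 / 4)" by (intro powr_mono2) auto
        moreover have "(((4::real) ^ d) ^ 4) powr (1 / 4) = 4 ^ d"
        proof -
          have "((4::real) ^ d) ^ 4 = (4 ^ d) powr 4" by (simp add: powr_numeral)
          then show ?thesis by (simp only: powr_powr) simp
        qed
        ultimately show ?thesis by simp
      qed
    qed
    then obtain F Bad c where *: "F \<subseteq> U" "\<forall>A\<in>F. \<forall>B\<in>F. B \<notin> N A" "Bad \<subseteq> TT" "1 \<le> c" "real c \<le> real K"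
      "\<forall>T\<in>TT - Bad. c \<le> card (F \<inter> e T)"
      "real (card F + c * card Bad) \<le> (1 + 3 * \<epsilon>) / (1 - 4 * \<epsilon>) * c * card U / real K" by blast
    show "\<exists>F Bad c. F \<subseteq> {A. A \<subseteq> ?X \<and> card A = s + 1} \<and> (\<forall>A\<in>F. \<forall>B\<in>F. A \<inter> B \<noteq> {}) \<and>
      Bad \<subseteq> {T. T \<subseteq> ?X \<and> card T = s + 1 + d} \<and> 1 \<le> c \<and> c \<le> (s + 1 + d) choose (s + 1) \<and>
      (\<forall>T. T \<subseteq> ?X \<longrightarrow> card T = s + 1 + d \<longrightarrow> T \<notin> Bad \<longrightarrow> c \<le> card {A\<in>F. A \<subseteq> T}) \<and>
      real (card F + c * card Bad) \<le> (1 + 3 * \<epsilon>) / (1 - 4 * \<epsilon>) * c *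
        real ((2 * s + 1 + d) choose (s + 1)) / real ((s + 1 + d) choose (s + 1))"
    proof (rule exI[of _ F], rule exI[of _ Bad], rule exI[of _ c], intro conjI)
      show "F \<subseteq> {A. A \<subseteq> ?X \<and> card A = s + 1}" using *(1) by (simp only: U_def)
      show "\<forall>A\<in>F. \<forall>B\<in>F. A \<inter> B \<noteq> {}" using *(1,2) by (auto simp: N_def)
      show "Bad \<subseteq> {T. T \<subseteq> ?X \<and> card T = s + 1 + d}" using *(3) by (simp only: TT_def)
      show "1 \<le> c" by (fact *)
      show "c \<le> (s + 1 + d) choose (s + 1)" using *(5) by (simp add: K_def)
      show "\<forall>T. T \<subseteq> ?X \<longrightarrow> card T = s + 1 + d \<longrightarrow> T \<notin> Bad \<longrightarrow> c \<le> card {A\<in>F. A \<subseteq> T}"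
      proof (intro allI impI)
        fix T assume "T \<subseteq> ?X" "card T = s + 1 + d" "T \<notin> Bad"
        then have "c \<le> card (F \<inter> e T)" using *(6) by (simp add: TT_def)
        moreover have "F \<inter> e T = {A\<in>F. A \<subseteq> T}" using *(1) by (auto simp: e_def U_def)
        ultimately show "c \<le> card {A\<in>F. A \<subseteq> T}" by simp
      qed
      have "card U = (2 * s + 1 + d) choose (s + 1)" by (simp add: U_def n_subsets)
      then show "real (card F + c * card Bad) \<le> (1 + 3 * \<epsilon>) / (1 - 4 * \<epsilon>) * c *
        real ((2 * s + 1 + d) choose (s + 1)) / real ((s + 1 + d) choose (s + 1))"
        using *(7) by (simp only: K_def)
    qed
  qed
qed

section \<open>Bounds for g by intersecting families\<close>

lemma K_edges_pair: "u < n \<Longrightarrow> v < n \<Longrightarrow> u \<noteq> v \<Longrightarrow> {u, v} \<in> K_edges n"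
  by (simp add: K_edges_def)

lemma finite_touched: "finite (touched n c S)"
  by (rule finite_subset[of _ "{..<n}"]) (auto simp: touched_def)

lemma card_touched_le: "card (touched n c S) \<le> n"
  using card_mono[of "{..<n}" "touched n c S"] by (auto simp: touched_def)

definition g_pred :: "nat \<Rightarrow> nat \<Rightarrow> nat \<Rightarrow> nat \<Rightarrow> bool" where
  "g_pred n r s m \<longleftrightarrow> (\<forall>c. edge_colouring n r c \<longrightarrow> (\<exists>S\<subseteq>{..<r}. card S \<le> s \<and> m \<le> card (touched n c S)))"

lemma g_eq: "g n r s = (GREATEST m. g_pred n r s m)"
  by (simp add: g_def g_pred_def)

lemma g_pred_bound: "1 \<le> r \<Longrightarrow> g_pred n r s m \<Longrightarrow> m \<le> n"
proof -
  assume "1 \<le> r" "g_pred n r s m"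
  moreover from this have "edge_colouring n r (\<lambda>_. 0)" by (simp add: edge_colouring_def)
  ultimately show "m \<le> n" unfolding g_pred_def using card_touched_le order_trans by blast
qed

lemma g_pred_0: "g_pred n r s 0"
  unfolding g_pred_def by (intro allI impI exI[of _ "{}"]) simp

lemma g_pred_g: "1 \<le> r \<Longrightarrow> g_pred n r s (g n r s)"
  unfolding g_eq by (rule GreatestI_nat[where P = "g_pred n r s", OF g_pred_0]) (rule g_pred_bound)

lemma g_le_n: "1 \<le> r \<Longrightarrow> g n r s \<le> n"
  using g_pred_bound g_pred_g by blast

lemma g_ge_real:
  assumes "1 \<le> r" "\<And>c. edge_colouring n r c \<Longrightarrow> \<exists>S\<subseteq>{..<r}. card S \<le> s \<and> y \<le> real (card (touched n c S))"
  shows "y \<le> real (g n r s)"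
proof -
  have "g_pred n r s (nat \<lceil>y\<rceil>)"
    unfolding g_pred_def
  proof (intro allI impI)
    fix c assume "edge_colouring n r c"
    then obtain S where "S \<subseteq> {..<r}" "card S \<le> s" "y \<le> real (card (touched n c S))" using assms(2) by blast
    then show "\<exists>S\<subseteq>{..<r}. card S \<le> s \<and> nat \<lceil>y\<rceil> \<le> card (touched n c S)"
      by (intro exI[of _ S]) (simp add: ceiling_le_iff)
  qed
  then have "nat \<lceil>y\<rceil> \<le> g n r s"
    unfolding g_eq by (rule Greatest_le_nat[where P = "g_pred n r s"]) (rule g_pred_bound[OF assms(1)])
  then show ?thesis using real_nat_ceiling_ge[of y] by linarith
qed

lemma card_residues_ge:
  assumes "R \<subseteq> {..<k}"
  shows "card R * (n div k) \<le> card {v. v < n \<and> v mod k \<in> R}"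
proof (cases "k = 0")
  case True
  then show ?thesis using assms by simp
next
  case False
  have fR: "finite R" using assms finite_subset by blast
  have "card (R \<times> {..<n div k}) \<le> card {v. v < n \<and> v mod k \<in> R}"
  proof (rule card_inj_on_le)
    show "inj_on (\<lambda>(i, q). i + k * q) (R \<times> {..<n div k})"
    proof (rule inj_onI)
      fix x y
      assume x: "x \<in> R \<times> {..<n div k}" and y: "y \<in> R \<times> {..<n div k}" and eq: "(case x of (i, q) \<Rightarrow> i + k * q) = (case y of (i, q) \<Rightarrow> i + k * q)"
      obtain i q j q' where xy: "x = (i, q)" "y = (j, q')" by (cases x, cases y)
      then have lt: "i < k" "j < k" and *: "i + k * q = j + k * q'" using assms x y eq by auto
      from * have "(i + k * q) mod k = (j + k * q') mod k" by simp
      then have "i = j" using lt by simp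
      then show "x = y" using * False xy by simp
    qed
    show "(\<lambda>(i, q). i + k * q) ` (R \<times> {..<n div k}) \<subseteq> {v. v < n \<and> v mod k \<in> R}"
    proof
      fix y assume "y \<in> (\<lambda>(i, q). i + k * q) ` (R \<times> {..<n div k})"
      then obtain i q where *: "i \<in> R" "q \<in> {..<n div k}" and y: "y = i + k * q" by auto
      then have i: "i < k" using assms by auto
      have "i + k * q < k * Suc q" using i by simp
      also have "\<dots> \<le> k * (n div k)" using *(2) by (intro mult_le_mono2) simp
      also have "\<dots> \<le> n" by simp
      finally show "y \<in> {v. v < n \<and> v mod k \<in> R}" using * i y by simp
    qed
  qed simp
  then show ?thesis using fR by (simp add: card_cartesian_product)
qed

text \<open>Blow-up: vertex \<open>v\<close> receives the index with number v mod card I, and an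
  edge gets a colour common to the sets of its ends. The case i = j of \<open>int\<close> serves
  edges inside a class. If \<open>B i\<close> avoids \<open>S\<close>, the whole class of
  \<open>i\<close> is untouched, and each class has at least \<open>n div card I\<close>
  vertices.\<close>

lemma g_upper:
  fixes B :: "'i \<Rightarrow> 'b set"
  assumes I: "finite I" "I \<noteq> {}" and C: "finite C" "card C \<le> r"
    and int: "\<And>i j. i \<in> I \<Longrightarrow> j \<in> I \<Longrightarrow> B i \<inter> B j \<inter> C \<noteq> {}"
    and miss: "\<And>S. S \<subseteq> C \<Longrightarrow> card S \<le> s \<Longrightarrow> M \<le> card {i\<in>I. B i \<inter> S = {}}"
  shows "g n r s \<le> n - M * (n div card I)"
proof -
  define k where "k = card I"
  obtain f where f: "bij_betw f {0..<k} I" unfolding k_def using ex_bij_betw_nat_finite[OF I(1)] by blast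
  have k0: "0 < k" unfolding k_def using I by (simp add: card_gt_0_iff)
  obtain h where h: "bij_betw h C {0..<card C}" using ex_bij_betw_finite_nat[OF C(1)] by blast
  define t where "t v = f (v mod k)" for v
  have tI: "t v \<in> I" for v using f k0 unfolding t_def bij_betw_def by auto
  have hinj: "inj_on h C" using h by (rule bij_betw_imp_inj_on)
  have hlt: "h x < r" if "x \<in> C" for x
  proof -
    have "h x \<in> {0..<card C}" using bij_betw_apply[OF h that] .
    then show ?thesis using C(2) by simp
  qed
  have "1 \<le> r"
  proof -
    obtain i where "i \<in> I" using I by blast
    then have "C \<noteq> {}" using int[of i i] by blast
    then have "0 < card C" using C(1) by (simp add: card_gt_0_iff)
    then show ?thesis using C(2) by simp
  qed
  define x where "x e = (SOME y. y \<in> C \<and> (\<forall>v\<in>e. y \<in> B (t v)))" for e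
  have x: "x e \<in> C" "\<And>v. v \<in> e \<Longrightarrow> x e \<in> B (t v)" if e: "e \<in> K_edges n" for e
  proof -
    have "card e = 2" using e by (simp add: K_edges_def)
    then obtain u v where uv: "e = {u, v}" by (meson card_2_iff)
    obtain y where "y \<in> B (t u)" "y \<in> B (t v)" "y \<in> C" using int[OF tI tI, of u v] by blast
    then have "\<exists>y. y \<in> C \<and> (\<forall>v\<in>e. y \<in> B (t v))" using uv by blast
    then have "x e \<in> C \<and> (\<forall>v\<in>e. x e \<in> B (t v))" unfolding x_def by (rule someI_ex)
    then show "x e \<in> C" "\<And>v. v \<in> e \<Longrightarrow> x e \<in> B (t v)" by auto
  qed
  define c where "c e = h (x e)" for e
  have col: "edge_colouring n r c"
    unfolding edge_colouring_def c_def using x(1) hlt by blast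
  obtain S where S: "S \<subseteq> {..<r}" "card S \<le> s" "g n r s \<le> card (touched n c S)"
    using g_pred_g[OF \<open>1 \<le> r\<close>, of n s] col unfolding g_pred_def by blast
  define S' where "S' = {y\<in>C. h y \<in> S}"
  have "card S' \<le> card S"
  proof (rule card_inj_on_le[of h])
    show "inj_on h S'" by (rule inj_on_subset[OF hinj]) (auto simp: S'_def)
    show "finite S" using S(1) finite_subset by blast
  qed (auto simp: S'_def)
  then have Mle: "M \<le> card {i\<in>I. B i \<inter> S' = {}}" using S(2) by (intro miss) (auto simp: S'_def)
  define R where "R = {j. j < k \<and> B (f j) \<inter> S' = {}}"
  have "card {i\<in>I. B i \<inter> S' = {}} \<le> card R"
  proof -
    have "{i\<in>I. B i \<inter> S' = {}} \<subseteq> f ` R"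
    proof
      fix i assume i: "i \<in> {i\<in>I. B i \<inter> S' = {}}"
      then obtain j where "j \<in> {0..<k}" "f j = i" using f unfolding bij_betw_def by blast
      then show "i \<in> f ` R" using i by (auto simp: R_def)
    qed
    then have "card {i\<in>I. B i \<inter> S' = {}} \<le> card (f ` R)" by (intro card_mono) (auto simp: R_def)
    also have "\<dots> \<le> card R" by (intro card_image_le) (auto simp: R_def)
    finally show ?thesis .
  qed
  then have "M * (n div k) \<le> card R * (n div k)" using Mle by (intro mult_le_mono1) simp
  also have "\<dots> \<le> card {v. v < n \<and> v mod k \<in> R}" by (rule card_residues_ge) (auto simp: R_def)
  also have "\<dots> \<le> card ({..<n} - touched n c S)"
  proof (rule card_mono)
    show "{v. v < n \<and> v mod k \<in> R} \<subseteq> {..<n} - touched n c S"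
    proof
      fix v assume v: "v \<in> {v. v < n \<and> v mod k \<in> R}"
      have "v \<notin> touched n c S"
      proof
        assume "v \<in> touched n c S"
        then obtain e where e: "e \<in> K_edges n" "v \<in> e" "c e \<in> S" by (auto simp: touched_def)
        then have "x e \<in> B (t v) \<inter> S'" using x[OF e(1)] by (auto simp: c_def S'_def)
        then show False using v by (auto simp: R_def t_def)
      qed
      then show "v \<in> {..<n} - touched n c S" using v by simp
    qed
  qed simp
  also have "\<dots> = n - card (touched n c S)"
  proof -
    have "touched n c S \<subseteq> {..<n}" by (auto simp: touched_def)
    then show ?thesis by (simp add: card_Diff_subset finite_touched)
  qed
  finally have "M * (n div k) \<le> n - card (touched n c S)" .
  then have "card (touched n c S) \<le> n - M * (n div k)" using card_touched_le[of n c S] by linarith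
  then show ?thesis using S(3) unfolding k_def by linarith
qed

section \<open>Colour sets at the vertices and the lower bounds for \<open>g\<close>\<close>

definition colours_at :: "nat \<Rightarrow> (nat set \<Rightarrow> nat) \<Rightarrow> nat \<Rightarrow> nat set" where
  "colours_at n c v = c ` {e \<in> K_edges n. v \<in> e}"

lemma touched_eq: "touched n c S = {v. v < n \<and> colours_at n c v \<inter> S \<noteq> {}}"
  unfolding touched_def colours_at_def by blast

lemma colours_at_subset: "edge_colouring n r c \<Longrightarrow> colours_at n c v \<subseteq> {..<r}"
  unfolding colours_at_def edge_colouring_def by auto

lemma colours_at_inter:
  assumes "2 \<le> n" "u < n" "v < n"
  shows "colours_at n c u \<inter> colours_at n c v \<noteq> {}"
proof -
  obtain w where w: "w < n" "w \<noteq> u" "u \<noteq> v \<Longrightarrow> w = v"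
  proof (cases "u = v")
    case True
    have "(if u = 0 then 1 else 0) < n" "(if u = 0 then 1 else 0) \<noteq> u" using assms by auto
    then show ?thesis using that True by blast
  next
    case False
    then show ?thesis using that[of v] assms by simp
  qed
  then have "{u, w} \<in> K_edges n" "v \<in> {u, w}" using K_edges_pair[of u n w] assms by auto
  then show ?thesis unfolding colours_at_def by blast
qed

text \<open>The edge from any other vertex to \<open>v\<close> carries a colour of \<open>v\<close>,
  so buying all colours of one vertex touches every vertex.\<close>

lemma touched_colours_at:
  assumes "2 \<le> n" "v < n" "colours_at n c v \<subseteq> S"
  shows "touched n c S = {..<n}"
  unfolding touched_eq using colours_at_inter[OF assms(1) _ assms(2), of _ c] assms(3) by blast

text \<open>Double counting of the pairs of a vertex and a set of \<open>SS\<close> touching it: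
  some set is at least as good as a random one.\<close>

lemma touched_average:
  fixes \<phi> :: real
  assumes SS: "finite SS" "SS \<noteq> {}"
    and f: "\<And>v. v < n \<Longrightarrow> \<phi> * card SS \<le> card {S\<in>SS. colours_at n c v \<inter> S \<noteq> {}}"
  shows "\<exists>S\<in>SS. \<phi> * n \<le> card (touched n c S)"
proof (rule ccontr)
  assume "\<not> ?thesis"
  then have lt: "\<And>S. S \<in> SS \<Longrightarrow> real (card (touched n c S)) < \<phi> * n" by force
  have "(\<Sum>S\<in>SS. real (card (touched n c S))) < (\<Sum>S\<in>SS. \<phi> * n)"
    by (rule sum_strict_mono[OF SS lt])
  also have "\<dots> = (\<Sum>v<n. \<phi> * card SS)" by simp
  also have "\<dots> \<le> (\<Sum>v<n. real (card {S\<in>SS. colours_at n c v \<inter> S \<noteq> {}}))"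
    by (rule sum_mono) (use f in auto)
  also have "\<dots> = (\<Sum>v<n. \<Sum>S\<in>SS. if colours_at n c v \<inter> S \<noteq> {} then 1 else 0)"
    using SS by (intro sum.cong[OF refl]) (simp add: sum.If_cases Int_def)
  also have "\<dots> = (\<Sum>S\<in>SS. \<Sum>v<n. if colours_at n c v \<inter> S \<noteq> {} then 1 else 0)"
    by (rule sum.swap)
  also have "\<dots> = (\<Sum>S\<in>SS. real (card (touched n c S)))"
    unfolding touched_eq by (intro sum.cong[OF refl]) (simp add: sum.If_cases Int_def)
  finally show False by simp
qed

lemma card_subsets_meeting:
  assumes "finite X" "A \<subseteq> X"
  shows "card {S \<in> {S. S \<subseteq> X \<and> card S = s}. A \<inter> S \<noteq> {}} + ((card X - card A) choose s) = card X choose s"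
proof -
  have fA: "finite A" using assms finite_subset by blast
  have 1: "{S. S \<subseteq> X \<and> card S = s} = {S \<in> {S. S \<subseteq> X \<and> card S = s}. A \<inter> S \<noteq> {}} \<union> {S. S \<subseteq> X - A \<and> card S = s}"
    by blast
  have "card X choose s = card {S. S \<subseteq> X \<and> card S = s}" using assms by (simp add: n_subsets)
  also have "\<dots> = card {S \<in> {S. S \<subseteq> X \<and> card S = s}. A \<inter> S \<noteq> {}} + card {S. S \<subseteq> X - A \<and> card S = s}"
    using assms by (subst 1, intro card_Un_disjoint) auto
  also have "card {S. S \<subseteq> X - A \<and> card S = s} = (card X - card A) choose s"
    using assms fA by (simp add: n_subsets card_Diff_subset)
  finally show ?thesis by simp
qed

text \<open>\<open>X\<close> will be the set of all colours, or the colour set of one vertex, which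
  meets every other colour set.\<close>

lemma touched_random_subset:
  fixes \<phi> :: real
  assumes n: "2 \<le> n" and col: "edge_colouring n r c" and X: "X \<subseteq> {..<r}" and s: "s \<le> card X"
    and y: "\<And>v. v < n \<Longrightarrow> real ((card X - card (colours_at n c v \<inter> X)) choose s) \<le> (1 - \<phi>) * real (card X choose s)"
  shows "\<exists>S\<subseteq>{..<r}. card S \<le> s \<and> \<phi> * n \<le> card (touched n c S)"
proof -
  have fX: "finite X" using X finite_subset by blast
  let ?SS = "{S. S \<subseteq> X \<and> card S = s}"
  have cS: "card ?SS = card X choose s" using fX by (simp add: n_subsets)
  have "0 < card ?SS" using s cS by (simp add: zero_less_binomial)
  then have SS: "finite ?SS" "?SS \<noteq> {}" by (auto simp: card_gt_0_iff)
  have "\<exists>S\<in>?SS. \<phi> * n \<le> card (touched n c S)"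
  proof (rule touched_average[OF SS])
    fix v assume v: "v < n"
    have "{S\<in>?SS. colours_at n c v \<inter> S \<noteq> {}} = {S\<in>?SS. (colours_at n c v \<inter> X) \<inter> S \<noteq> {}}" by auto
    moreover have "real (card {S\<in>?SS. (colours_at n c v \<inter> X) \<inter> S \<noteq> {}}) + real ((card X - card (colours_at n c v \<inter> X)) choose s) = card X choose s"
      using card_subsets_meeting[OF fX, of "colours_at n c v \<inter> X" s] by (simp flip: of_nat_add)
    ultimately show "\<phi> * card ?SS \<le> card {S\<in>?SS. colours_at n c v \<inter> S \<noteq> {}}"
      unfolding cS using y[OF v] by (simp add: algebra_simps)
  qed
  then show ?thesis using X by auto
qed

lemma card_colours_at_inter:
  assumes "edge_colouring n r c"
  shows "colours_at n c v \<inter> {..<r} = colours_at n c v" "card (colours_at n c v) \<le> r"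
proof -
  show 1: "colours_at n c v \<inter> {..<r} = colours_at n c v" using colours_at_subset[OF assms] by blast
  show "card (colours_at n c v) \<le> r" using card_mono[OF _ colours_at_subset[OF assms], of v] by simp
qed

text \<open>A vertex with at most \<open>s\<close> colours makes \<open>g\<close> trivial. Otherwise
  every colour set has at least \<open>s + 1\<close> elements, and a random \<open>s\<close>-set
  misses it with at most the probability in the bound.\<close>

lemma g_lower_binomial:
  assumes n: "2 \<le> n" and s: "1 \<le> s" "s \<le> r"
  shows "(1 - real ((r - s - 1) choose s) / real (r choose s)) * n \<le> real (g n r s)"
proof (rule g_ge_real)
  show "1 \<le> r" using s by simp
  fix c assume col: "edge_colouring n r c"
  have pos: "0 < r choose s" using s by (simp add: zero_less_binomial)
  have \<phi>1: "1 - real ((r - s - 1) choose s) / real (r choose s) \<le> 1" by simp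
  show "\<exists>S\<subseteq>{..<r}. card S \<le> s \<and> (1 - real ((r - s - 1) choose s) / real (r choose s)) * n \<le> real (card (touched n c S))"
  proof (cases "\<exists>v<n. card (colours_at n c v) \<le> s")
    case True
    then obtain v where v: "v < n" "card (colours_at n c v) \<le> s" by blast
    have "touched n c (colours_at n c v) = {..<n}" by (rule touched_colours_at[OF n v(1) order_refl])
    then show ?thesis using v(2) colours_at_subset[OF col] mult_right_mono[OF \<phi>1, of "real n"] by (intro exI[of _ "colours_at n c v"]) auto
  next
    case False
    show ?thesis
    proof (rule touched_random_subset[OF n col order_refl])
      show "s \<le> card {..<r}" using s by simp
      fix v assume "v < n"
      then have "s < card (colours_at n c v)" using False by force
      then have "((r - card (colours_at n c v)) choose s) \<le> (r - s - 1) choose s"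
        by (intro binomial_right_mono) simp
      then show "real ((card {..<r} - card (colours_at n c v \<inter> {..<r})) choose s) \<le>
          (1 - (1 - real ((r - s - 1) choose s) / real (r choose s))) * real (card {..<r} choose s)"
        using pos by (simp add: card_colours_at_inter[OF col])
    qed
  qed
qed

text \<open>Drawing \<open>s\<close> of \<open>r\<close> colours without replacement avoids
  \<open>a\<close> given ones with probability at most (1 - a/r)^s; the induction adds one drawn
  colour at a time.\<close>

lemma binomial_exp_bound:
  assumes "a \<le> r" "s \<le> r" "1 \<le> r"
  shows "real ((r - a) choose s) \<le> exp (- (real a * real s / real r)) * real (r choose s)"
  using assms(2)
proof (induction s)
  case 0
  then show ?case by simp
next
  case (Suc s)
  have IH: "real ((r - a) choose s) \<le> exp (- (real a * real s / real r)) * real (r choose s)" using Suc by simp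
  have rec: "real (Suc s) * real (m choose Suc s) = (real m - real s) * real (m choose s)" for m
  proof (cases "s \<le> m")
    case True
    have "Suc s * (m choose Suc s) = (m - s) * (m choose s)" 
      using binomial_absorption[of s m] binomial_absorb_comp[of m s] by simp
    then have "real (Suc s) * real (m choose Suc s) = real (m - s) * real (m choose s)" by (metis of_nat_mult)
    then show ?thesis using True by (simp add: of_nat_diff)
  next
    case False
    then show ?thesis by (simp add: binomial_eq_0)
  qed
  show ?case
  proof (cases "s \<le> r - a")
    case False
    then show ?thesis by (simp add: binomial_eq_0)
  next
    case True
    have sr: "real s < real r" using Suc.prems by simp
    have "real (r - a) - real s \<le> (1 - real a / real r) * (real r - real s)"
    proof -
      have "real a * real s / real r \<ge> 0" by simp
      then show ?thesis using assms sr by (simp add: of_nat_diff field_simps)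
    qed
    also have "\<dots> \<le> exp (- (real a / real r)) * (real r - real s)"
      using exp_ge_add_one_self[of "- (real a / real r)"] sr by (intro mult_right_mono) auto
    finally have f: "real (r - a) - real s \<le> exp (- (real a / real r)) * (real r - real s)" .
    have "real (Suc s) * real ((r - a) choose Suc s) = (real (r - a) - real s) * real ((r - a) choose s)" by (rule rec)
    also have "\<dots> \<le> (exp (- (real a / real r)) * (real r - real s)) * (exp (- (real a * real s / real r)) * real (r choose s))"
      using f IH sr True by (intro mult_mono) auto
    also have "\<dots> = (exp (- (real a / real r)) * exp (- (real a * real s / real r))) * ((real r - real s) * real (r choose s))"
      by simp
    also have "exp (- (real a / real r)) * exp (- (real a * real s / real r)) = exp (- (real a * real (Suc s) / real r))"
      unfolding exp_add[symmetric] by (simp add: distrib_left add_divide_distrib)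
    also have "(real r - real s) * real (r choose s) = real (Suc s) * real (r choose Suc s)" by (rule rec[symmetric])
    finally show ?thesis by (simp add: mult.left_commute mult_le_cancel_left_pos del: of_nat_Suc)
  qed
qed

text \<open>The threshold sqrt r balances two strategies. Inside a colour set A of at most sqrt r
  colours, a random \<open>s\<close>-subset hits any other colour set with probability at least
  s/card A. If all colour sets are larger, a random \<open>s\<close>-set of colours misses each with
  probability at most exp(- s/sqrt r).\<close>

lemma g_lower_exp:
  assumes n: "2 \<le> n" and s: "1 \<le> s" "s \<le> r"
  shows "(1 - exp (- (real s / sqrt (real r)))) * n \<le> real (g n r s)"
proof (rule g_ge_real)
  show r1: "1 \<le> r" using s by simp
  fix c assume col: "edge_colouring n r c"
  define \<phi> where "\<phi> = 1 - exp (- (real s / sqrt (real r)))"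
  have sq: "0 < sqrt (real r)" "sqrt (real r) * sqrt (real r) = real r" using r1 by simp_all
  have \<phi>1: "\<phi> \<le> 1" by (simp add: \<phi>_def)
  have \<phi>s: "\<phi> \<le> real s / sqrt (real r)"
    unfolding \<phi>_def using exp_ge_add_one_self[of "- (real s / sqrt (real r))"] by linarith
  have "\<exists>S\<subseteq>{..<r}. card S \<le> s \<and> \<phi> * n \<le> real (card (touched n c S))"
  proof (cases "\<exists>v<n. real (card (colours_at n c v)) \<le> sqrt (real r)")
    case True
    then obtain v where v: "v < n" "real (card (colours_at n c v)) \<le> sqrt (real r)" by blast
    let ?A = "colours_at n c v"
    have AX: "?A \<subseteq> {..<r}" by (rule colours_at_subset[OF col])
    have fA: "finite ?A" using AX finite_subset by blast
    show ?thesis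
    proof (cases "card ?A \<le> s")
      case small: True
      have "touched n c ?A = {..<n}" by (rule touched_colours_at[OF n v(1) order_refl])
      then show ?thesis using small AX mult_right_mono[OF \<phi>1, of "real n"] by (intro exI[of _ ?A]) auto
    next
      case False
      define k where "k = card ?A"
      have ks: "s < k" using False by (simp add: k_def)
      show ?thesis
      proof (rule touched_random_subset[OF n col AX])
        show "s \<le> card ?A" using False by simp
        fix u assume u: "u < n"
        have "colours_at n c u \<inter> ?A \<noteq> {}" by (rule colours_at_inter[OF n u v(1)])
        then have "1 \<le> card (colours_at n c u \<inter> ?A)" using fA by (simp add: Suc_le_eq card_gt_0_iff)
        then have "((k - card (colours_at n c u \<inter> ?A)) choose s) \<le> (k - 1) choose s"
          by (intro binomial_right_mono) simp
        moreover have "real k * real ((k - 1) choose s) = (real k - real s) * real (k choose s)"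
        proof -
          have "(k - s) * (k choose s) = k * ((k - 1) choose s)" by (rule binomial_absorb_comp)
          then have "real (k - s) * real (k choose s) = real k * real ((k - 1) choose s)" by (metis of_nat_mult)
          then show ?thesis using ks by (simp add: of_nat_diff)
        qed
        then have "real ((k - 1) choose s) = (1 - real s / real k) * real (k choose s)"
          using ks by (simp add: field_simps)
        moreover have "(1 - real s / real k) * real (k choose s) \<le> (1 - \<phi>) * real (k choose s)"
        proof (rule mult_right_mono)
          have "real s / sqrt (real r) \<le> real s / real k"
            using v(2) ks sq by (intro divide_left_mono) (auto simp: k_def)
          then show "1 - real s / real k \<le> 1 - \<phi>" using \<phi>s by linarith
        qed simp
        ultimately show "real ((card ?A - card (colours_at n c u \<inter> ?A)) choose s) \<le> (1 - \<phi>) * real (card ?A choose s)"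
          unfolding k_def[symmetric] by (metis of_nat_le_iff order_trans)
      qed
    qed
  next
    case False
    show ?thesis
    proof (rule touched_random_subset[OF n col order_refl])
      show "s \<le> card {..<r}" using s by simp
      fix v assume "v < n"
      then have big: "sqrt (real r) \<le> real (card (colours_at n c v))" using False by force
      let ?a = "card (colours_at n c v)"
      have "real ((r - ?a) choose s) \<le> exp (- (real ?a * real s / real r)) * real (r choose s)"
        by (rule binomial_exp_bound[OF card_colours_at_inter(2)[OF col] s(2) r1])
      also have "\<dots> \<le> exp (- (real s / sqrt (real r))) * real (r choose s)"
      proof -
        have "real s / sqrt (real r) = sqrt (real r) * real s / real r"
          using sq by (simp add: field_simps)
        also have "\<dots> \<le> real ?a * real s / real r"
          using big by (intro divide_right_mono mult_right_mono) auto
        finally show ?thesis by (intro mult_right_mono) auto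
      qed
      finally show "real ((card {..<r} - card (colours_at n c v \<inter> {..<r})) choose s) \<le> (1 - \<phi>) * real (card {..<r} choose s)"
        by (simp add: card_colours_at_inter[OF col] \<phi>_def)
    qed
  qed
  then show "\<exists>S\<subseteq>{..<r}. card S \<le> s \<and> (1 - exp (- (real s / sqrt (real r)))) * n \<le> real (card (touched n c S))"
    by (simp add: \<phi>_def)
qed

section \<open>Constructions\<close>

lemma two_large_subsets_meet:
  assumes "finite X" "A \<subseteq> X" "B \<subseteq> X" "card X < card A + card B"
  shows "A \<inter> B \<noteq> {}"
proof
  assume "A \<inter> B = {}"
  then have "card (A \<union> B) = card A + card B"
    using assms finite_subset by (intro card_Un_disjoint) auto
  moreover have "card (A \<union> B) \<le> card X" using assms by (intro card_mono) auto
  ultimately show False using assms(4) by simp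
qed

text \<open>Two (s + 1)-sets among 2 s + 1 points meet, and the complement of an
  \<open>s\<close>-set contains one.\<close>

lemma g_upper_all_subsets:
  "g n (2 * s + 1) s \<le> n - n div ((2 * s + 1) choose s)"
proof -
  let ?I = "{A. A \<subseteq> {..<2 * s + 1} \<and> card A = s + 1}"
  have cI: "card ?I = (2 * s + 1) choose s"
    using binomial_symmetric[of s "2 * s + 1"] by (simp add: n_subsets)
  have "g n (2 * s + 1) s \<le> n - 1 * (n div card ?I)"
  proof (rule g_upper[where B = "\<lambda>A. A" and C = "{..<2 * s + 1}"])
    show "?I \<noteq> {}"
    proof -
      have "{..<s + 1} \<in> ?I" by auto
      then show ?thesis by blast
    qed
    show "A \<inter> B \<inter> {..<2 * s + 1} \<noteq> {}" if "A \<in> ?I" "B \<in> ?I" for A B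
      using two_large_subsets_meet[of "{..<2 * s + 1}" A B] that by auto
    show "1 \<le> card {A \<in> ?I. A \<inter> S = {}}" if S: "S \<subseteq> {..<2 * s + 1}" "card S \<le> s" for S
    proof -
      have "card ({..<2 * s + 1} - S) = 2 * s + 1 - card S"
        using S finite_subset[of S] by (simp add: card_Diff_subset)
      then have "s + 1 \<le> card ({..<2 * s + 1} - S)" using S by simp
      then obtain A where "A \<subseteq> {..<2 * s + 1} - S" "card A = s + 1" by (meson obtain_subset_with_card_n)
      then have "A \<in> {A \<in> ?I. A \<inter> S = {}}" by auto
      moreover have "finite {A \<in> ?I. A \<inter> S = {}}" by simp
      ultimately have "0 < card {A \<in> ?I. A \<inter> S = {}}" using card_gt_0_iff by blast
      then show ?thesis by simp
    qed
  qed auto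
  then show ?thesis unfolding cI by simp
qed

text \<open>A colour lies in the crosses of at most two indices, those of its row and of its
  column.\<close>

lemma cross_sum:
  fixes S :: "(nat \<times> nat \<times> nat) set"
  assumes "finite S"
  shows "(\<Sum>v<m. card {z \<in> S. fst z = v \<or> fst (snd z) = v}) \<le> 2 * card S"
proof -
  have "(\<Sum>v<m. card {z \<in> S. fst z = v \<or> fst (snd z) = v}) = (\<Sum>v<m. \<Sum>z\<in>S. if fst z = v \<or> fst (snd z) = v then 1 else 0)"
    using assms by (intro sum.cong[OF refl]) (simp add: sum.If_cases Int_def)
  also have "\<dots> = (\<Sum>z\<in>S. \<Sum>v<m. if fst z = v \<or> fst (snd z) = v then 1 else 0)" by (rule sum.swap)
  also have "\<dots> \<le> (\<Sum>z\<in>S. 2)"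
  proof (rule sum_mono)
    fix z assume "z \<in> S"
    have "(\<Sum>v<m. if fst z = v \<or> fst (snd z) = v then 1 else 0) = card {v \<in> {..<m}. fst z = v \<or> fst (snd z) = v}"
      by (simp add: sum.If_cases Int_def)
    also have "\<dots> \<le> card {fst z, fst (snd z)}" by (intro card_mono) auto
    also have "\<dots> \<le> 2" by (simp add: card_insert_if)
    finally show "(\<Sum>v<m. if fst z = v \<or> fst (snd z) = v then 1 else 0) \<le> (2::nat)" .
  qed
  finally show ?thesis by simp
qed

text \<open>The colours form an \<open>m \<times> m\<close> array of cells of size \<open>w\<close>; a vertex sees, in every cell of one
  row and the corresponding column, the same set of more than half of the positions.\<close>

lemma g_upper_cross:
  assumes m: "1 \<le> m" and r: "m * m * w \<le> r" and w: "1 \<le> w" and h: "h = w div 2 + 1"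
    and s: "m = 1 \<and> s \<le> w - h \<or> 2 * s \<le> m * (w - h)"
  shows "g n r s \<le> n - n div (m * (w choose h))"
proof -
  let ?X = "{X. X \<subseteq> {..<w} \<and> card X = h}"
  let ?I = "{..<m} \<times> ?X"
  define B :: "nat \<times> nat set \<Rightarrow> (nat \<times> nat \<times> nat) set" where
    "B p = {z. (fst z = fst p \<or> fst (snd z) = fst p) \<and> snd (snd z) \<in> snd p}" for p
  let ?C = "{..<m} \<times> {..<m} \<times> {..<w}"
  have cI: "card ?I = m * (w choose h)" by (simp add: card_cartesian_product n_subsets)
  have hw: "h \<le> w" using h w by auto
  have "g n r s \<le> n - 1 * (n div card ?I)"
  proof (rule g_upper[where B = B and C = ?C])
    have "{..<h} \<in> ?X" using hw by auto
    then have "(0, {..<h}) \<in> ?I" using m by auto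
    then show "?I \<noteq> {}" by blast
    show "finite ?I" by simp
    show "card ?C \<le> r" using r by (simp add: card_cartesian_product mult.assoc)
    show "B p \<inter> B p' \<inter> ?C \<noteq> {}" if "p \<in> ?I" "p' \<in> ?I" for p p'
    proof -
      have "snd p \<inter> snd p' \<noteq> {}"
        using two_large_subsets_meet[of "{..<w}" "snd p" "snd p'"] that h by auto
      then obtain x where "x \<in> snd p" "x \<in> snd p'" by blast
      \<comment> \<open>The row of \<open>p\<close> crosses the column of \<open>p'\<close> in one
        cell, which both crosses contain; the two majority sets share a position in it.\<close>
      then have "(fst p, fst p', x) \<in> B p \<inter> B p' \<inter> ?C" using that by (auto simp: B_def)
      then show ?thesis by blast
    qed
    show "1 \<le> card {p \<in> ?I. B p \<inter> S = {}}" if S: "S \<subseteq> ?C" "card S \<le> s" for S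
    proof -
      have fS: "finite S" using S(1) finite_subset by blast
      define c where "c v = {z \<in> S. fst z = v \<or> fst (snd z) = v}" for v
      \<comment> \<open>By averaging some cross contains at most \<open>w - h\<close> colours of
        \<open>S\<close>, so \<open>h\<close> positions are free throughout that cross.\<close>
      have "\<exists>v<m. card (c v) \<le> w - h"
      proof (rule ccontr)
        assume "\<not> ?thesis"
        then have gt: "w - h + 1 \<le> card (c v)" if "v < m" for v using that by force
        have mcard: "card (c v) \<le> s" for v using card_mono[OF fS, of "c v"] S(2) by (auto simp: c_def)
        from s show False
        proof
          assume "m = 1 \<and> s \<le> w - h"
          then show False using gt[of 0] mcard[of 0] by simp
        next
          assume s2: "2 * s \<le> m * (w - h)"
          have "m * (w - h + 1) = (\<Sum>v<m. w - h + 1)" by simp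
          also have "\<dots> \<le> (\<Sum>v<m. card (c v))" by (rule sum_mono) (use gt in auto)
          also have "\<dots> \<le> 2 * card S" unfolding c_def by (rule cross_sum[OF fS])
          also have "\<dots> \<le> m * (w - h)" using S(2) s2 by simp
          finally show False using m by simp
        qed
      qed
      then obtain v where v: "v < m" "card (c v) \<le> w - h" by blast
      let ?P = "(\<lambda>z. snd (snd z)) ` c v"
      have fc: "finite (c v)" using fS by (simp add: c_def)
      have "card ?P \<le> w - h" using card_image_le[OF fc, of "\<lambda>z. snd (snd z)"] v(2) by linarith
      moreover have "?P \<subseteq> {..<w}" using S(1) by (auto simp: c_def)
      ultimately have "h \<le> card ({..<w} - ?P)" using hw fc by (simp add: card_Diff_subset)
      then obtain X where X: "X \<subseteq> {..<w} - ?P" "card X = h" by (meson obtain_subset_with_card_n)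
      have "(v, X) \<in> {p \<in> ?I. B p \<inter> S = {}}"
        using X v(1) by (auto simp: B_def c_def)
      moreover have "finite {p \<in> ?I. B p \<inter> S = {}}" by simp
      ultimately have "0 < card {p \<in> ?I. B p \<inter> S = {}}" using card_gt_0_iff by blast
      then show ?thesis by simp
    qed
  qed simp
  then show ?thesis unfolding cI by simp
qed

text \<open>A transversal design: the blocks \<open>(a, b)\<close> are the lines \<open>y = a i + b\<close> modulo \<open>m\<close>; the pairs
  inside a group \<open>i\<close> are covered by unions of two segments of length \<open>k\<close>.\<close>

lemma g_upper_design:
  assumes k: "1 \<le> k" and m: "1 \<le> m" and cop: "\<And>t. 1 \<le> t \<Longrightarrow> t < 2 * k \<Longrightarrow> coprime t m"
    and P: "P = m div k + 1" and r: "m * m + 2 * k * (P * P) \<le> r"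
  shows "g n r s \<le> n - (2 * k * m - s * (2 * k)) * (n div (2 * k * m))"
proof -
  let ?I = "{..<2 * k} \<times> {..<m}"
  define B :: "nat \<times> nat \<Rightarrow> (nat \<times> nat + nat \<times> nat \<times> nat) set" where
    "B p = {c. case c of Inl z \<Rightarrow> (fst z * fst p + snd z) mod m = snd p
      | Inr z \<Rightarrow> fst z = fst p \<and> (fst (snd z) = snd p div k \<or> snd (snd z) = snd p div k)}" for p
  let ?C = "({..<m} \<times> {..<m}) <+> ({..<2 * k} \<times> {..<P} \<times> {..<P})"
  have cI: "card ?I = 2 * k * m" by (simp add: card_cartesian_product)
  have line: "\<exists>z. Inl z \<in> B (i, y) \<inter> B (j, y') \<inter> ?C" if "i < j" "j < 2 * k" "y < m" "y' < m" for i j y y'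
  proof -
    define t where "t = j - i"
    have t: "j = i + t" "coprime t m" using that cop[of t] by (auto simp: t_def)
    obtain u where u: "[t * u = 1] (mod m)" using cong_solve_coprime_nat[OF t(2)] by auto
    \<comment> \<open>The line through both points: solve a t = y' - y and b = y - a i modulo
      \<open>m\<close>. The terms \<open>m - y\<close> and \<open>m - 1\<close> represent -y and -1
      in the natural numbers.\<close>
    define a where "a = (u * (y' + (m - y))) mod m"
    define b where "b = (y + (m - 1) * (a * i)) mod m"
    have "[a * i + b = a * i + (y + (m - 1) * (a * i))] (mod m)"
      unfolding b_def by (intro cong_add cong_refl) simp
    also have "a * i + (y + (m - 1) * (a * i)) = y + m * (a * i)"
      using m by (cases m) auto
    also have "[y + m * (a * i) = y] (mod m)" by (simp add: cong_def)
    finally have 1: "[a * i + b = y] (mod m)" .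
    have "[a * t = u * (y' + (m - y)) * t] (mod m)"
      unfolding a_def by (intro cong_mult cong_refl) simp
    also have "u * (y' + (m - y)) * t = (t * u) * (y' + (m - y))" by simp
    also have "[(t * u) * (y' + (m - y)) = 1 * (y' + (m - y))] (mod m)"
      using u by (intro cong_mult cong_refl)
    finally have "[a * t = y' + (m - y)] (mod m)" by simp
    note cong_add[OF 1 this]
    then have "[a * i + b + a * t = y + (y' + (m - y))] (mod m)" .
    also have "y + (y' + (m - y)) = y' + m" using that by simp
    also have "[y' + m = y'] (mod m)" by (simp add: cong_def)
    also have "a * i + b + a * t = a * j + b" by (simp add: t(1) distrib_left)
    finally have 2: "[a * j + b = y'] (mod m)" .
    have "a < m" "b < m" using m by (auto simp: a_def b_def)
    then have "Inl (a, b) \<in> B (i, y) \<inter> B (j, y') \<inter> ?C"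
      using 1 2 that by (auto simp: B_def cong_def)
    then show ?thesis by blast
  qed
  have "g n r s \<le> n - (2 * k * m - s * (2 * k)) * (n div card ?I)"
  proof (rule g_upper[where B = B and C = ?C])
    show "finite ?I" by simp
    have "(0, 0) \<in> ?I" using k m by simp
    then show "?I \<noteq> {}" by blast
    show "finite ?C" by simp
    show "card ?C \<le> r" using r by (simp add: card_Plus card_cartesian_product)
    show "B p \<inter> B p' \<inter> ?C \<noteq> {}" if "p \<in> ?I" "p' \<in> ?I" for p p'
    proof -
      obtain i y j y' where pp: "p = (i, y)" "p' = (j, y')" by (cases p, cases p')
      then have lt: "i < 2 * k" "y < m" "j < 2 * k" "y' < m" using that by auto
      consider "i < j" | "j < i" | "i = j" by linarith
      then show ?thesis
      proof cases
        case 1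
        then show ?thesis using line[of i j y y'] lt pp by blast
      next
        case 2
        then show ?thesis using line[of j i y' y] lt pp by blast
      next
        case 3
        have "y div k < P" "y' div k < P" using lt P div_le_mono[of y m k] div_le_mono[of y' m k] by auto
        then have "Inr (i, y div k, y' div k) \<in> B p \<inter> B p' \<inter> ?C" using 3 lt pp by (auto simp: B_def)
        then show ?thesis by blast
      qed
    qed
    show "2 * k * m - s * (2 * k) \<le> card {p \<in> ?I. B p \<inter> S = {}}" if S: "S \<subseteq> ?C" "card S \<le> s" for S
    proof -
      have fS: "finite S" by (rule finite_subset[OF S(1)]) simp
      \<comment> \<open>A line has one point in each of the 2 k groups, and two segments of length
        \<open>k\<close> have at most 2 k points together. Both kinds of colour are thus equally
        effective, and \<open>s\<close> colours touch at most a fraction s/m of the points.\<close>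
      have each: "card {p \<in> ?I. c \<in> B p} \<le> 2 * k" for c
      proof (cases c)
        case (Inl z)
        have "{p \<in> ?I. c \<in> B p} \<subseteq> (\<lambda>i. (i, (fst z * i + snd z) mod m)) ` {..<2 * k}"
          using Inl by (auto simp: B_def)
        then have "card {p \<in> ?I. c \<in> B p} \<le> card ((\<lambda>i. (i, (fst z * i + snd z) mod m)) ` {..<2 * k})"
          by (intro card_mono) auto
        also have "\<dots> \<le> 2 * k" using card_image_le[of "{..<2 * k}" "\<lambda>i. (i, (fst z * i + snd z) mod m)"] by simp
        finally show ?thesis .
      next
        case (Inr z)
        have seg: "y \<in> {q * k..<q * k + k}" if "y div k = q" for y q
        proof -
          have "y = q * k + y mod k" using that div_mult_mod_eq[of y k] by simp
          moreover have "y mod k < k" using k by simp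
              moreover have "q * k \<le> q * k + y mod k" by simp
          ultimately show ?thesis unfolding atLeastLessThan_iff by linarith
        qed
        let ?Y = "{fst (snd z) * k..<fst (snd z) * k + k} \<union> {snd (snd z) * k..<snd (snd z) * k + k}"
        have "{p \<in> ?I. c \<in> B p} \<subseteq> Pair (fst z) ` ?Y"
          using Inr seg by (fastforce simp: B_def)
        then have "card {p \<in> ?I. c \<in> B p} \<le> card (Pair (fst z) ` ?Y)" by (intro card_mono) auto
        also have "\<dots> \<le> card ?Y" by (intro card_image_le) simp
        also have "\<dots> \<le> k + k" using card_Un_le[of "{fst (snd z) * k..<fst (snd z) * k + k}" "{snd (snd z) * k..<snd (snd z) * k + k}"] by simp
        finally show ?thesis by simp
      qed
      have "{p \<in> ?I. B p \<inter> S \<noteq> {}} \<subseteq> (\<Union>c\<in>S. {p \<in> ?I. c \<in> B p})" by blast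
      then have "card {p \<in> ?I. B p \<inter> S \<noteq> {}} \<le> card (\<Union>c\<in>S. {p \<in> ?I. c \<in> B p})"
        using fS by (intro card_mono) auto
      also have "\<dots> \<le> (\<Sum>c\<in>S. card {p \<in> ?I. c \<in> B p})" by (rule card_UN_le[OF fS])
      also have "\<dots> \<le> (\<Sum>c\<in>S. 2 * k)" by (rule sum_mono) (rule each)
      also have "\<dots> \<le> s * (2 * k)" using S(2) by simp
      finally have le: "card {p \<in> ?I. B p \<inter> S \<noteq> {}} \<le> s * (2 * k)" .
      have "?I = {p \<in> ?I. B p \<inter> S = {}} \<union> {p \<in> ?I. B p \<inter> S \<noteq> {}}" by blast
      then have "card ?I \<le> card {p \<in> ?I. B p \<inter> S = {}} + card {p \<in> ?I. B p \<inter> S \<noteq> {}}"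
        using card_Un_le[of "{p \<in> ?I. B p \<inter> S = {}}" "{p \<in> ?I. B p \<inter> S \<noteq> {}}"] by simp
      then show ?thesis using le unfolding cI by linarith
    qed
  qed
  then show ?thesis unfolding cI by simp
qed

text \<open>\<open>Inr (T, i)\<close> are the \<open>c\<close> copies of the exceptional set \<open>T\<close> that is its own repair.\<close>

lemma g_upper_kneser:
  assumes F: "F \<subseteq> {A. A \<subseteq> {..<2 * s + 1 + d} \<and> card A = s + 1}" "\<forall>A\<in>F. \<forall>B\<in>F. A \<inter> B \<noteq> {}"
    and Bad: "Bad \<subseteq> {T. T \<subseteq> {..<2 * s + 1 + d} \<and> card T = s + 1 + d}" and c: "1 \<le> c"
    and good: "\<forall>T. T \<subseteq> {..<2 * s + 1 + d} \<longrightarrow> card T = s + 1 + d \<longrightarrow> T \<notin> Bad \<longrightarrow> c \<le> card {A\<in>F. A \<subseteq> T}"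
  shows "g n (2 * s + 1 + d) s \<le> n - c * (n div (card F + c * card Bad))" "1 \<le> card F + c * card Bad"
proof -
  let ?X = "{..<2 * s + 1 + d}"
  let ?I = "F <+> (Bad \<times> {..<c})"
  define B :: "nat set + nat set \<times> nat \<Rightarrow> nat set" where "B p = (case p of Inl A \<Rightarrow> A | Inr z \<Rightarrow> fst z)" for p
  have fF: "finite F" "finite Bad" using finite_subset[OF F(1)] finite_subset[OF Bad] by simp_all
  have cI: "card ?I = card F + c * card Bad"
    using fF by (simp add: card_Plus card_cartesian_product mult.commute)
  have miss: "c \<le> card {p \<in> ?I. B p \<inter> S = {}}" if S: "S \<subseteq> ?X" "card S \<le> s" for S
  proof -
    have "card (?X - S) = 2 * s + 1 + d - card S"
      using S finite_subset[of S] by (simp add: card_Diff_subset)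
    then have "s + 1 + d \<le> card (?X - S)" using S by simp
    then obtain T where T: "T \<subseteq> ?X - S" "card T = s + 1 + d" by (meson obtain_subset_with_card_n)
    have fin: "finite {p \<in> ?I. B p \<inter> S = {}}" using fF by simp
    show ?thesis
    proof (cases "T \<in> Bad")
      case True
      have "(\<lambda>i. Inr (T, i)) ` {..<c} \<subseteq> {p \<in> ?I. B p \<inter> S = {}}"
        using True T(1) by (auto simp: B_def)
      from card_mono[OF fin this] show ?thesis by (simp add: card_image inj_on_def)
    next
      case False
      then have "c \<le> card {A\<in>F. A \<subseteq> T}" using good T by auto
      also have "\<dots> = card ((Inl :: nat set \<Rightarrow> nat set + nat set \<times> nat) ` {A\<in>F. A \<subseteq> T})" by (simp add: card_image)
      also have "\<dots> \<le> card {p \<in> ?I. B p \<inter> S = {}}"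
        using T(1) by (intro card_mono[OF fin]) (auto simp: B_def)
      finally show ?thesis .
    qed
  qed
  have ne: "?I \<noteq> {}"
  proof
    assume e: "?I = {}"
    have "c \<le> card {p \<in> ?I. B p \<inter> {} = {}}" by (rule miss) simp_all
    then show False using c unfolding e by simp
  qed
  have sz: "B p \<subseteq> ?X" "s + 1 \<le> card (B p)" "p \<notin> Inl ` F \<Longrightarrow> card (B p) = s + 1 + d" if "p \<in> ?I" for p
  proof -
    have "B p \<subseteq> ?X \<and> s + 1 \<le> card (B p) \<and> (p \<notin> Inl ` F \<longrightarrow> card (B p) = s + 1 + d)"
    proof (cases p)
      case (Inl A)
      then have "A \<in> F" using that by auto
      then show ?thesis using Inl F(1) by (auto simp: B_def)
    next
      case (Inr z)
      then have "fst z \<in> Bad" using that by auto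
      then show ?thesis using Inr Bad by (auto simp: B_def)
    qed
    then show "B p \<subseteq> ?X" "s + 1 \<le> card (B p)" "p \<notin> Inl ` F \<Longrightarrow> card (B p) = s + 1 + d" by auto
  qed
  have "g n (2 * s + 1 + d) s \<le> n - c * (n div card ?I)"
  proof (rule g_upper[where B = B and C = ?X])
    show "finite ?I" using fF by simp
    show "?I \<noteq> {}" by (rule ne)
    show "B p \<inter> B q \<inter> ?X \<noteq> {}" if pq: "p \<in> ?I" "q \<in> ?I" for p q
    proof (cases "p \<in> Inl ` F \<and> q \<in> Inl ` F")
      case True
      then obtain A A' where A: "A \<in> F" "A' \<in> F" "p = Inl A" "q = Inl A'" by auto
      then have "A \<inter> A' \<noteq> {}" "A \<subseteq> ?X" using F by blast+
      then show ?thesis using A by (auto simp: B_def)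
    next
      case False
      then have "2 * s + 1 + d < card (B p) + card (B q)" using sz[OF pq(1)] sz[OF pq(2)] by auto
      then have "B p \<inter> B q \<noteq> {}" using two_large_subsets_meet[of ?X "B p" "B q"] sz(1)[OF pq(1)] sz(1)[OF pq(2)] by simp
      then show ?thesis using sz(1)[OF pq(1)] by blast
    qed
  qed (use miss in auto)
  then show "g n (2 * s + 1 + d) s \<le> n - c * (n div (card F + c * card Bad))" unfolding cI .
  show "1 \<le> card F + c * card Bad" using ne fF unfolding cI[symmetric] by (simp add: Suc_le_eq card_gt_0_iff)
qed

section \<open>Asymptotics\<close>

lemma real_div_ge: "1 \<le> k \<Longrightarrow> real n / real k - 1 \<le> real (n div k)"
proof -
  assume k: "1 \<le> k"
  have "n mod k < k" using k by simp
  then have "n \<le> k * (n div k) + k" using mult_div_mod_eq[of k n] by linarith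
  from of_nat_mono[OF this, where 'a = real]
  have "real n \<le> real k * real (n div k) + real k" by simp
  then have "real n \<le> (real (n div k) + 1) * real k" by (simp add: algebra_simps)
  then have "real n / real k \<le> real (n div k) + 1" using k by (simp add: pos_divide_le_eq)
  then show ?thesis by simp
qed

section \<open>Exponential upper bounds for \<open>s\<close> of order at least sqrt(r log r)\<close>

lemma g_le_exp:
  assumes "g n r s \<le> n - n div k" "1 \<le> k" "2 * k \<le> n" "2 * real k \<le> exp E"
  shows "real (g n r s) \<le> (1 - exp (- E)) * real n"
proof -
  have k: "0 < real k" using assms(2) by simp
  \<comment> \<open>Since n \<ge> 2 k, rounding costs at most a factor 2, which \<open>E\<close> has
    to cover.\<close>
  have "real n / (2 * real k) \<le> real n / real k - 1"
    using assms(2,3) by (simp add: field_simps)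
  also have "\<dots> \<le> real (n div k)" by (rule real_div_ge[OF assms(2)])
  finally have 1: "real n / (2 * real k) \<le> real (n div k)" .
  have "real n / exp E \<le> real n / (2 * real k)" using assms(4) k by (intro divide_left_mono) auto
  moreover have "exp (- E) * real n = real n / exp E" by (simp add: exp_minus field_simps)
  ultimately have "exp (- E) * real n \<le> real (n div k)" using 1 by linarith
  moreover have "real (g n r s) \<le> real n - real (n div k)"
    using assms(1) div_le_dividend[of n k] by linarith
  ultimately show ?thesis by (simp add: algebra_simps)
qed

lemma pow_bound: "2 * (r * 2 ^ r) \<le> (16::nat) ^ r" if "1 \<le> r"
proof -
  have "2 * (r * 2 ^ r) \<le> 2 ^ r * (2 ^ r * 2 ^ r)"
    using that less_exp[of r] self_le_power[of 2 r] by (intro mult_mono) auto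
  also have "\<dots> = 8 ^ r" by (simp flip: power_mult_distrib)
  also have "\<dots> \<le> 16 ^ r" by (rule power_mono) auto
  finally show ?thesis .
qed

text \<open>The cross family has at most r 2^w members, so cells of size w = O(y) with y = s^2/r
  suffice. The constant is 4096 = 64^2 for the factor 2^w, plus 1 for the factor r \<le> exp y and 1
  for the factor 2 \<le> exp y.\<close>

lemma g_upper_exp:
  assumes s: "1 \<le> s" "2 * s < r" and y: "log 2 (real r) \<le> (real s)\<^sup>2 / real r" and n: "16 ^ r \<le> n"
  shows "real (g n r s) \<le> (1 - exp (- (4098 * ((real s)\<^sup>2 / real r)))) * real n"
proof -
  define y where "y = (real s)\<^sup>2 / real r"
  have r3: "3 \<le> r" using s by simp
  have "1 \<le> log 2 (real r)" using r3 by simp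
  then have y1: "1 \<le> y" using y by (simp add: y_def)
  have lnr: "real r \<le> exp y"
  proof -
    have "ln (real r) = log 2 (real r) * ln 2" by (simp add: log_def)
    also have "\<dots> \<le> log 2 (real r) * 1" using ln_2_less_1 r3 by (intro mult_left_mono) auto
    also have "\<dots> \<le> y" using y by (simp add: y_def)
    finally have "exp (ln (real r)) \<le> exp y" by simp
    then show ?thesis using r3 by simp
  qed
  have main: "real (g n r s) \<le> (1 - exp (- (4098 * y))) * real n"
    if m: "1 \<le> m" "m \<le> r" "m * m * w \<le> r" "1 \<le> w" "w \<le> r" "real w \<le> 4096 * y"
      and sm: "m = 1 \<and> s \<le> w - (w div 2 + 1) \<or> 2 * s \<le> m * (w - (w div 2 + 1))" for m w :: nat
  proof (rule g_le_exp[where k = "m * (w choose (w div 2 + 1))"])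
    show "g n r s \<le> n - n div (m * (w choose (w div 2 + 1)))"
      by (rule g_upper_cross[OF m(1,3,4) refl sm])
    have h: "w div 2 + 1 \<le> w" using m(4) by auto
    then have "1 \<le> w choose (w div 2 + 1)" by (simp add: Suc_le_eq zero_less_binomial)
    then show "1 \<le> m * (w choose (w div 2 + 1))" using m(1) by simp
    have le: "m * (w choose (w div 2 + 1)) \<le> r * 2 ^ w" using m(2) by (intro mult_mono binomial_le_pow2) auto
    have "r * 2 ^ w \<le> r * 2 ^ r" using m(5) by (intro mult_left_mono power_increasing) auto
    then show "2 * (m * (w choose (w div 2 + 1))) \<le> n" using le pow_bound[of r] r3 n by linarith
    have "2 * real (m * (w choose (w div 2 + 1))) \<le> 2 * real (r * 2 ^ w)" using of_nat_mono[OF le, where 'a = real] by simp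
    also have "\<dots> = 2 * (real r * 2 ^ w)" by simp
    also have "\<dots> \<le> exp y * (exp y * exp (4096 * y))"
    proof (intro mult_mono lnr)
      show "2 \<le> exp y" using exp_ge_add_one_self[of y] y1 by linarith
      have "(2::real) ^ w \<le> exp 1 ^ w" using exp_ge_add_one_self[of 1] by (intro power_mono) auto
      also have "\<dots> = exp (real w)" by (simp flip: exp_of_nat_mult)
      also have "\<dots> \<le> exp (4096 * y)" using m(6) by simp
      finally show "(2::real) ^ w \<le> exp (4096 * y)" .
    qed auto
    also have "\<dots> = exp (4098 * y)" by (simp add: exp_add[symmetric])
    finally show "2 * real (m * (w choose (w div 2 + 1))) \<le> exp (4098 * y)" .
  qed
  have "real (g n r s) \<le> (1 - exp (- (4098 * y))) * real n"
  proof (cases "64 * s \<le> r")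
    case False
    have "real r \<le> 4096 * y"
    proof -
      have "real r \<le> 64 * real s" using False by linarith
      then have "(real r)\<^sup>2 \<le> (64 * real s)\<^sup>2" by (intro power_mono) auto
      then show ?thesis using r3 by (simp add: y_def power2_eq_square field_simps)
    qed
    moreover have "s \<le> r - (r div 2 + 1)" using s(2) by linarith
    ultimately show ?thesis using main[of 1 r] r3 by auto
  next
    case True
    \<comment> \<open>With m about r/(32 s) and w about r/m^2 the array uses at most
      \<open>r\<close> colours and m w \<ge> 31 s, enough for 2 s \<le> m (w/2 - 1). Rounding down
      at most halves r/(32 s), whence the 64.\<close>
    define m where "m = r div (32 * s)"
    define w where "w = r div (m * m)"
    have m2: "2 \<le> m" unfolding m_def using True s by (simp add: less_eq_div_iff_mult_less_eq)
    have m0: "0 < real m" using m2 by simp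
    have s0: "0 < real s" "0 < real r" using s r3 by auto
    have ms: "real m * (32 * real s) \<le> real r"
    proof -
      have "m * (32 * s) \<le> r" unfolding m_def by (rule div_times_less_eq_dividend)
      from of_nat_mono[OF this, where 'a = real] show ?thesis by simp
    qed
    have ms': "real r \<le> real m * (64 * real s)"
    proof -
      have "real r / real (32 * s) - 1 \<le> real m" unfolding m_def by (rule real_div_ge) (use s in simp)
      moreover have "1 \<le> real m" using m2 by simp
      ultimately have "real r / real (32 * s) \<le> 2 * real m" by linarith
      then show ?thesis using s0 by (simp add: field_simps)
    qed
    have s2: "real r \<le> real s * real s" using y1 s0 by (simp add: y_def power2_eq_square pos_le_divide_eq)
    have m32: "32 * real m \<le> real s"
    proof -
      have "(32 * real m) * real s \<le> real s * real s" using ms s2 by (simp add: mult_ac)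
      then show ?thesis using s0 by simp
    qed
    have wl: "real m * real m * real w \<le> real r"
    proof -
      have "m * m * w \<le> r" unfolding w_def by (rule times_div_less_eq_dividend)
      from of_nat_mono[OF this, where 'a = real] show ?thesis by simp
    qed
    have "real r / real (m * m) - 1 \<le> real w" unfolding w_def by (rule real_div_ge) (use m2 in simp)
    then have "real r / (real m * real m) \<le> real w + 1" by simp
    then have "real r \<le> (real w + 1) * (real m * real m)" using m0 by (simp add: pos_divide_le_eq)
    then have "real m * (32 * real s) \<le> real m * ((real w + 1) * real m)" using ms by (simp add: mult_ac)
    then have wm: "32 * real s \<le> (real w + 1) * real m" using m0 by (simp only: mult_le_cancel_left_pos)
    then have mw: "31 * real s \<le> real m * real w" using m32 m0 by (simp add: algebra_simps)
    have w1: "1 \<le> w"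
    proof (rule ccontr)
      assume "\<not> 1 \<le> w"
      then have "w = 0" by simp
      then show False using mw s0 by simp
    qed
    have w4: "real w \<le> 4096 * y"
    proof -
      have "real m * real m * real w * (real r * real r) \<le> real r * ((real m * (64 * real s)) * (real m * (64 * real s)))"
        using wl ms' s0 m0 by (intro mult_mono) auto
      then have "(real m * real m * real r) * (real w * real r) \<le> (real m * real m * real r) * (4096 * (real s * real s))"
        by (simp add: mult_ac)
      then have "real w * real r \<le> 4096 * (real s * real s)"
        using m0 s0 by (simp only: mult_le_cancel_left_pos mult_pos_pos)
      then show ?thesis using s0 by (simp add: y_def power2_eq_square field_simps)
    qed
    have wr: "w \<le> r" unfolding w_def by (rule div_le_dividend)
    have mr: "m \<le> r" unfolding m_def by (rule div_le_dividend)
    have "2 * s \<le> m * (w - (w div 2 + 1))"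
    proof -
      have "real w / 2 - 1 \<le> real (w - (w div 2 + 1))" using w1 by linarith
      then have "real m * (real w / 2 - 1) \<le> real m * real (w - (w div 2 + 1))" using m0 by (intro mult_left_mono) auto
      moreover have "2 * real s \<le> real m * (real w / 2 - 1)" using mw m32 s0 by (simp add: algebra_simps)
      ultimately have "real (2 * s) \<le> real (m * (w - (w div 2 + 1)))" by simp
      then show ?thesis by (simp only: of_nat_le_iff)
    qed
    moreover have "m * m * w \<le> r" unfolding w_def by (rule times_div_less_eq_dividend)
    ultimately show ?thesis using main[of m w] m2 mr wr w1 w4 by simp
  qed
  then show ?thesis by (simp add: y_def)
qed

text \<open>This provides a modulus for the transversal design: numbers congruent to 1 modulo a
  factorial behave like a prime for small differences and are dense enough to approximate sqrt r,
  without any result on prime gaps.\<close>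

lemma coprime_Suc_fact_multiple: "1 \<le> t \<Longrightarrow> t < k \<Longrightarrow> coprime t (1 + fact k * j)" for t :: nat
proof -
  assume t: "1 \<le> t" "t < k"
  have "t dvd fact k" using t by (intro dvd_fact) auto
  then obtain c where "fact k = t * c" by (auto elim: dvdE)
  then have eq: "1 + fact k * j = t * (c * j) + 1" by (simp add: mult_ac)
  show ?thesis
    unfolding eq
  proof (rule coprimeI)
    fix d assume "d dvd t" "d dvd t * (c * j) + 1"
    then show "is_unit d" using dvd_add_right_iff[of d "t * (c * j)" 1] dvd_mult2[of d t "c * j"] by blast
  qed
qed

text \<open>The design gives the fraction s/m and needs m^2 + 2 k P^2 colours with P about m/k, that
  is about m^2 (1 + 2/k). For a large fixed \<open>k\<close> one can therefore take m close to sqrt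
  r.\<close>

lemma g_upper_small:
  assumes \<epsilon>: "0 < \<epsilon>"
  shows "\<forall>\<^sub>F r in at_top. \<forall>n s. 16 ^ r \<le> n \<longrightarrow> 1 \<le> s \<longrightarrow>
    real (g n r s) \<le> (1 + \<epsilon>) * (real s / sqrt (real r)) * real n"
proof -
  define e where "e = \<epsilon> / 2"
  have e: "0 < e" using \<epsilon> by (simp add: e_def)
  obtain k :: nat where k: "3 / e < real k" using reals_Archimedean2 by blast
  have "0 < 3 / e" using e by simp
  then have k0: "0 < real k" using k by linarith
  \<comment> \<open>Of the 3/k, a part 2/k is for the segments inside the groups; the last 1/k
    absorbs the lower-order terms 4 m + 2 k.\<close>
  define \<alpha> where "\<alpha> = sqrt (1 + 3 / real k)"
  have \<alpha>1: "1 \<le> \<alpha>" using k0 by (simp add: \<alpha>_def)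
  have \<alpha>e: "\<alpha> < 1 + e"
  proof -
    have "3 / real k < e" using k k0 e by (simp add: field_simps)
    moreover have "(1 + e)\<^sup>2 = 1 + 2 * e + e * e" by (simp add: power2_eq_square algebra_simps)
    moreover have "0 < e * e" using e by simp
    ultimately have "1 + 3 / real k < (1 + e)\<^sup>2" using e by linarith
    then have "\<alpha> < sqrt ((1 + e)\<^sup>2)" unfolding \<alpha>_def by (rule real_sqrt_less_mono)
    then show ?thesis using e by simp
  qed
  define f where "f = real (fact (2 * k) :: nat)"
  have f1: "1 \<le> f" unfolding f_def by (simp add: fact_ge_1)
  define c1 where "c1 = (1 + e) / \<alpha> - 1"
  have c1: "0 < c1" using \<alpha>e \<alpha>1 by (simp add: c1_def field_simps)
  have e1: "\<forall>\<^sub>F r::nat in at_top. (1 + e) * (f + 1) \<le> c1 * sqrt (real r)" using c1 by real_asymp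
  have e2: "\<forall>\<^sub>F r::nat in at_top. 2 + 4 * real k + 2 * real k * real k + f \<le> (1 / \<alpha>) * sqrt (real r) - f" using \<alpha>1 by real_asymp
  have e3: "\<forall>\<^sub>F r::nat in at_top. 2 * real k * real r * real r \<le> e * 16 ^ r"
    using e k0 by real_asymp
  have e4: "\<forall>\<^sub>F r::nat in at_top. 1 \<le> r" by (rule eventually_ge_at_top)
  show ?thesis
    using e1 e2 e3 e4
  proof eventually_elim
    case (elim r)
    have r1: "1 \<le> real r" using elim(4) by simp
    define q where "q = sqrt (real r)"
    have q1: "1 \<le> q" "q * q = real r" using r1 by (simp_all add: q_def)
    \<comment> \<open>This makes \<open>m\<close> the largest number congruent to 1 modulo
      \<open>fact (2 * k)\<close> that does not exceed q/\<alpha>; it falls short of q/\<alpha> by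
      at most the constant \<open>f\<close>.\<close>
    define j where "j = nat \<lfloor>(q / \<alpha> - 1) / f\<rfloor>"
    define m where "m = 1 + fact (2 * k) * j"
    have base: "0 \<le> (q / \<alpha> - 1) / f" 
    proof -
      have kk: "0 \<le> 2 * real k * real k" by simp
      have "2 + 4 * real k + 2 * real k * real k + f \<le> q / \<alpha> - f" using elim(2) by (simp add: q_def)
      then have "0 \<le> q / \<alpha> - 1" using kk f1 k0 by linarith
      then show ?thesis using f1 by simp
    qed
    have jle: "real j \<le> (q / \<alpha> - 1) / f" "(q / \<alpha> - 1) / f - 1 \<le> real j"
      unfolding j_def using base by (simp_all add: of_nat_floor) 
    have mreal: "real m = 1 + f * real j" by (simp add: m_def f_def)
    have mle: "real m \<le> q / \<alpha>"
      using jle(1) f1 unfolding mreal by (simp add: pos_le_divide_eq mult.commute)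
    have mge: "q / \<alpha> - f \<le> real m"
    proof -
      have "(q / \<alpha> - 1) / f * f - 1 * f \<le> real j * f" using jle(2) f1 mult_right_mono[OF jle(2), of f] by (simp add: left_diff_distrib)
      then show ?thesis unfolding mreal using f1 by (simp add: mult.commute)
    qed
    have mbig: "4 * real k + 2 * real k * real k + 1 \<le> real m"
      using mge elim(2) f1 unfolding q_def by simp
    have m0: "1 \<le> real m" unfolding mreal using f1 by simp
    define P where "P = m div k + 1"
    have rr: "m * m + 2 * k * (P * P) \<le> r"
    proof -
      have Pm: "real P \<le> real m / real k + 1" 
      proof -
        have "real (m div k * k) \<le> real m" by (intro of_nat_mono div_times_less_eq_dividend)
        then show ?thesis unfolding P_def using k0 by (simp add: pos_le_divide_eq)
      qed
      then have "real P * real P \<le> (real m / real k + 1) * (real m / real k + 1)" by (intro mult_mono) auto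
      then have "2 * real k * (real P * real P) \<le> 2 * real k * ((real m / real k + 1) * (real m / real k + 1))"
        using k0 by (intro mult_left_mono) auto
      also have "\<dots> = 2 * (real m * real m) / real k + 4 * real m + 2 * real k"
        using k0 by (simp add: field_simps)
      finally have P2: "2 * real k * (real P * real P) \<le> 2 * (real m * real m) / real k + 4 * real m + 2 * real k" .
      have "4 * real m + 2 * real k \<le> (real m * real m) / real k"
      proof -
        have "real k * (4 * real m + 2 * real k) \<le> (4 * real k + 2 * real k * real k) * real m"
          using m0 mult_left_mono[OF m0, of "2 * real k * real k"] by (simp add: algebra_simps)
        also have "\<dots> \<le> real m * real m" using mbig m0 by (intro mult_right_mono) auto
        finally show ?thesis using k0 by (simp add: pos_le_divide_eq mult.commute)
      qed
      moreover have "(real m * real m) * (1 + 3 / real k) = real m * real m + 2 * (real m * real m) / real k + (real m * real m) / real k"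
        by (simp add: field_simps)
      ultimately have "real m * real m + 2 * real k * (real P * real P) \<le> (real m * real m) * (1 + 3 / real k)"
        using P2 by linarith
      also have "(1 + 3 / real k) = \<alpha> * \<alpha>" using k0 by (simp add: \<alpha>_def)
      also have "(real m * real m) * (\<alpha> * \<alpha>) = (real m * \<alpha>) * (real m * \<alpha>)" by simp
      also have "\<dots> \<le> q * q" using q1(1) mle \<alpha>1 m0 by (intro mult_mono) (auto simp: pos_le_divide_eq)
      also have "\<dots> = real r" by (rule q1)
      finally have "real (m * m + 2 * k * (P * P)) \<le> real r" by simp
      then show ?thesis by (simp only: of_nat_le_iff)
    qed
    have qm: "q / real m \<le> 1 + e"
    proof -
      have "(1 + e) * f \<le> c1 * q" using elim(1) e f1 unfolding q_def by (simp add: algebra_simps)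
      then have "q \<le> (1 + e) * (q / \<alpha> - f)" using \<alpha>1 by (simp add: c1_def field_simps)
      also have "\<dots> \<le> (1 + e) * real m" using mge e by (intro mult_left_mono) auto
      finally show ?thesis using m0 by (simp add: pos_divide_le_eq)
    qed
    show ?case
    proof (intro allI impI)
      fix n s :: nat
      assume n: "16 ^ r \<le> n" and s: "1 \<le> s"
      have k1: "1 \<le> k" using k0 by simp
      have m1: "1 \<le> m" by (simp add: m_def)
      have gub: "g n r s \<le> n - (2 * k * m - s * (2 * k)) * (n div (2 * k * m))"
        by (rule g_upper_design[OF k1 m1 _ P_def rr]) (unfold m_def, rule coprime_Suc_fact_multiple)
      have km: "1 \<le> 2 * k * m" using k1 m1 by simp
      have sm: "real s / real m \<le> (1 + e) * (real s / q)"
      proof -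
        have "real s / real m = (real s / q) * (q / real m)" using q1 by simp
        also have "\<dots> \<le> (real s / q) * (1 + e)" using qm q1 by (intro mult_left_mono) auto
        finally show ?thesis by (simp add: mult.commute)
      qed
      have rest: "2 * real k * real m \<le> e * (real s / q) * real n"
      proof -
        have mr: "real m \<le> q" 
        proof -
          have "q / \<alpha> \<le> q / 1" using \<alpha>1 q1 by (intro divide_left_mono) auto
          then show ?thesis using mle by simp
        qed
        have qr: "q \<le> real r" using q1 mult_left_mono[OF q1(1), of q] by simp
        have "2 * real k * real m * q \<le> 2 * real k * real r * real r"
          using mr qr k0 q1 by (intro mult_mono) auto
        also have "\<dots> \<le> e * 16 ^ r" by (rule elim(3))
        also have "\<dots> \<le> e * real n" using n e by (intro mult_left_mono) (auto simp flip: of_nat_le_iff)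
        also have "\<dots> \<le> (e * real n) * real s" using s e mult_left_mono[of 1 "real s" "e * real n"] by simp
        finally show ?thesis using q1 by (simp add: field_simps)
      qed
      have "real (g n r s) \<le> real s / real m * real n + 2 * real k * real m"
      proof (cases "s \<le> m")
        case False
        have "1 \<le> r" using elim(4) .
        then have "real (g n r s) \<le> real n" using g_le_n by simp
        also have "\<dots> \<le> real s / real m * real n"
        proof -
          have "1 \<le> real s / real m" using False m0 by (simp add: pos_le_divide_eq)
          then show ?thesis using mult_right_mono[of 1 "real s / real m" "real n"] by simp
        qed
        finally show ?thesis using k0 m0 by (simp add: add_increasing2)
      next
        case True
        have sk: "s * (2 * k) \<le> 2 * k * m" using True by (simp add: mult.commute)
        define M where "M = 2 * k * m - s * (2 * k)"
        have M: "real M = 2 * real k * (real m - real s)" unfolding M_def using sk by (simp add: of_nat_diff algebra_simps)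
        have Mle: "real M \<le> 2 * real k * real m" unfolding M using k0 by (intro mult_left_mono) auto
        have "real M * (real n / real (2 * k * m) - 1) \<le> real M * real (n div (2 * k * m))"
          by (intro mult_left_mono real_div_ge[OF km]) auto
        moreover have "real (g n r s) \<le> real n - real M * real (n div (2 * k * m))"
        proof -
          have "M * (n div (2 * k * m)) \<le> (2 * k * m) * (n div (2 * k * m))" unfolding M_def by (intro mult_right_mono) auto
          also have "\<dots> \<le> n" by (rule times_div_less_eq_dividend)
          finally have "M * (n div (2 * k * m)) \<le> n" .
          then have "real (g n r s) \<le> real n - real (M * (n div (2 * k * m)))"
            using gub unfolding M_def[symmetric] by linarith
          then show ?thesis by simp
        qed
        moreover have "real M * (real n / real (2 * k * m) - 1) = real n - real s / real m * real n - real M"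
          unfolding M using k0 m0 by (simp add: field_simps)
        ultimately show ?thesis using Mle by linarith
      qed
      also have "\<dots> \<le> (1 + e) * (real s / q) * real n + e * (real s / q) * real n"
        using sm rest by (intro add_mono mult_right_mono) auto
      also have "\<dots> = ((1 + e) + e) * (real s / q) * real n" by (simp only: distrib_right)
      also have "(1 + e) + e = 1 + \<epsilon>" by (simp add: e_def)
      finally show "real (g n r s) \<le> (1 + \<epsilon>) * (real s / sqrt (real r)) * real n" by (simp add: q_def)
    qed
  qed
qed

text \<open>It turns the density K/card U of the sets below a given \<open>T\<close> into the ratio
  in (4).\<close>

lemma choose_ratio:
  "real ((r - s) choose (s + 1)) / real (r choose (s + 1)) = real ((r - s - 1) choose s) / real (r choose s)" if "s < r"
proof -
  have 1: "(s + 1) * ((r - s) choose (s + 1)) = (r - s) * ((r - s - 1) choose s)"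
    using that binomial_absorption[of s "r - s"] by simp
  have 2: "(s + 1) * (r choose (s + 1)) = (r - s) * (r choose s)"
    using that binomial_absorption[of s r] binomial_absorb_comp[of r s] by simp
  have "real ((r - s) choose (s + 1)) / real (r choose (s + 1)) =
     real ((s + 1) * ((r - s) choose (s + 1))) / real ((s + 1) * (r choose (s + 1)))"
    unfolding of_nat_mult by simp
  also have "\<dots> = real ((r - s - 1) choose s) / real (r choose s)"
    unfolding 1 2 of_nat_mult using that by simp
  finally show ?thesis .
qed

text \<open>Of the 8 \<epsilon>, seven come from \<open>kneser_family\<close>, as (1 - 7
  \<epsilon>)(1 + 3 \<epsilon>) \<le> 1 - 4 \<epsilon>, and one from rounding
  \<open>n\<close>.\<close>

lemma g_upper_half:
  fixes \<epsilon> :: real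
  assumes \<epsilon>: "0 < \<epsilon>" "\<epsilon> \<le> 1 / 8"
  shows "\<exists>\<kappa>>0. \<exists>r0. \<forall>r s n. r0 \<le> r \<longrightarrow> 1 \<le> s \<longrightarrow> 2 * s < r \<longrightarrow> \<kappa> * real (r - 2 * s - 1) \<le> real (r - s) \<longrightarrow> 16 ^ r \<le> n \<longrightarrow>
    (1 - 8 * \<epsilon>) * (real ((r - s - 1) choose s) / real (r choose s)) * real n \<le> real n - real (g n r s)"
proof -
  obtain \<kappa> where \<kappa>: "0 < \<kappa>" and fam: "\<And>s d. 1 \<le> d \<Longrightarrow> \<kappa> * real d \<le> real (s + 1 + d) \<Longrightarrow>
    \<exists>F Bad c. F \<subseteq> {A. A \<subseteq> {..<2 * s + 1 + d} \<and> card A = s + 1} \<and> (\<forall>A\<in>F. \<forall>B\<in>F. A \<inter> B \<noteq> {}) \<and>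
      Bad \<subseteq> {T. T \<subseteq> {..<2 * s + 1 + d} \<and> card T = s + 1 + d} \<and> 1 \<le> c \<and> c \<le> (s + 1 + d) choose (s + 1) \<and>
      (\<forall>T. T \<subseteq> {..<2 * s + 1 + d} \<longrightarrow> card T = s + 1 + d \<longrightarrow> T \<notin> Bad \<longrightarrow> c \<le> card {A\<in>F. A \<subseteq> T}) \<and>
      real (card F + c * card Bad) \<le> (1 + 3 * \<epsilon>) / (1 - 4 * \<epsilon>) * c *
        real ((2 * s + 1 + d) choose (s + 1)) / real ((s + 1 + d) choose (s + 1))"
    using kneser_family[OF \<epsilon>] by blast
  have "\<forall>\<^sub>F r::nat in at_top. 1 \<le> \<epsilon> * 4 ^ r" using \<epsilon>(1) by real_asymp
  then obtain r0 where r0: "\<And>r. r0 \<le> r \<Longrightarrow> 1 \<le> \<epsilon> * 4 ^ r"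
    unfolding eventually_at_top_linorder by blast
  show ?thesis
  proof (rule exI[of _ \<kappa>], rule conjI[OF \<kappa>], rule exI[of _ r0], intro allI impI)
    fix r s n :: nat
    assume r: "r0 \<le> r" and s: "1 \<le> s" "2 * s < r" and big: "\<kappa> * real (r - 2 * s - 1) \<le> real (r - s)" and n: "16 ^ r \<le> n"
    define Q where "Q = real ((r - s - 1) choose s) / real (r choose s)"
    have Q0: "1 \<le> (r - s - 1) choose s" using s by (simp add: Suc_le_eq zero_less_binomial)
    have two: "real (r choose j) \<le> 2 ^ r" "real ((r - j) choose i) \<le> 2 ^ r" for i j
    proof -
      show "real (r choose j) \<le> 2 ^ r" using of_nat_mono[OF binomial_le_pow2[of r j], where 'a = real] by simp
      have "(r - j) choose i \<le> 2 ^ (r - j)" by (rule binomial_le_pow2)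
      also have "\<dots> \<le> 2 ^ r" by (rule power_increasing) auto
      finally have "(r - j) choose i \<le> 2 ^ r" .
      from of_nat_mono[OF this, where 'a = real] show "real ((r - j) choose i) \<le> 2 ^ r" by simp
    qed
    have Cpos: "0 < real (r choose s)" using s by (simp add: zero_less_binomial)
    have Qge: "1 / 2 ^ r \<le> Q"
      unfolding Q_def using Q0 two(1)[of s] Cpos by (intro frac_le) auto
    have nreal: "16 ^ r \<le> real n" using of_nat_mono[OF n, where 'a = real] by simp
    \<comment> \<open>Rounding loses at most c \<le> 2^r vertices. This is negligible since Q \<ge>
      2^(-r) and 16^r = 2^r 2^r 4^r.\<close>
    have small: "2 ^ r \<le> \<epsilon> * (Q * real n)"
    proof -
      have "(2::real) ^ r = 2 ^ r * 1" by simp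
      also have "\<dots> \<le> 2 ^ r * (\<epsilon> * 4 ^ r)" by (intro mult_left_mono r0 r) auto
      also have "\<dots> = \<epsilon> * (1 / 2 ^ r * 16 ^ r)"
      proof -
        have "(16::real) ^ r = 2 ^ r * 2 ^ r * 4 ^ r" by (simp flip: power_mult_distrib)
        then show ?thesis by simp
      qed
      also have "\<dots> \<le> \<epsilon> * (Q * real n)"
        using \<epsilon> Qge nreal by (intro mult_left_mono mult_mono) (auto intro: order_trans[OF _ Qge])
      finally show ?thesis .
    qed
    have conclude: "(1 - 8 * \<epsilon>) * Q * real n \<le> real n - real (g n r s)"
      if k: "1 \<le> k" and c: "real c \<le> 2 ^ r" "c \<le> k" and gk: "g n r s \<le> n - c * (n div k)" and ck: "(1 - 7 * \<epsilon>) * Q \<le> real c / real k" for c k :: nat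
    proof -
      have "(1 - 7 * \<epsilon>) * Q * real n \<le> real c / real k * real n" using ck by (intro mult_right_mono) auto
      moreover have "real c * (real n / real k - 1) \<le> real c * real (n div k)"
        by (intro mult_left_mono real_div_ge k) auto
      moreover have "real c * (real n / real k - 1) = real c / real k * real n - real c" by (simp add: right_diff_distrib)
      moreover have "c * (n div k) \<le> k * (n div k)" using c(2) by (rule mult_right_mono) simp
      then have "c * (n div k) \<le> n" using times_div_less_eq_dividend[of k n] by linarith
      then have "real (g n r s) \<le> real n - real (c * (n div k))" using gk by linarith
      ultimately have "(1 - 7 * \<epsilon>) * Q * real n - 2 ^ r \<le> real n - real (g n r s)"
        using c(1) unfolding of_nat_mult by linarith
      moreover have "(1 - 8 * \<epsilon>) * Q * real n = (1 - 7 * \<epsilon>) * Q * real n - \<epsilon> * (Q * real n)" by (simp add: algebra_simps)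
      ultimately show ?thesis using small by linarith
    qed
    have Qn: "0 \<le> Q" using order_trans[OF _ Qge, of 0] by simp
    show "(1 - 8 * \<epsilon>) * (real ((r - s - 1) choose s) / real (r choose s)) * real n \<le> real n - real (g n r s)"
    \<comment> \<open>Here d = 0, outside the range of \<open>kneser_family\<close>; all (s +
      1)-sets form an intersecting family and are already optimal.\<close>
    proof (cases "r = 2 * s + 1")
      case True
      have "Q = 1 / real (r choose s)" unfolding Q_def True by simp
      then have ck: "(1 - 7 * \<epsilon>) * Q \<le> real 1 / real (r choose s)"
        using mult_right_mono[of "1 - 7 * \<epsilon>" 1 Q] \<epsilon> Qn by simp
      have "g n r s \<le> n - 1 * (n div (r choose s))" using g_upper_all_subsets[of n s] unfolding True by simp
      moreover have "1 \<le> r choose s" using s by (simp add: Suc_le_eq zero_less_binomial)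
      ultimately have "(1 - 8 * \<epsilon>) * Q * real n \<le> real n - real (g n r s)"
        using ck by (intro conclude[of "r choose s" 1]) auto
      then show ?thesis by (simp only: Q_def)
    next
      case False
      define d where "d = r - 2 * s - 1"
      have d: "1 \<le> d" "r = 2 * s + 1 + d" "s + 1 + d = r - s" using s False by (auto simp: d_def)
      have "\<kappa> * real d \<le> real (s + 1 + d)" using big by (simp only: d(3)) (simp add: d_def)
      from fam[OF d(1) this] obtain F Bad c where
        F: "F \<subseteq> {A. A \<subseteq> {..<2 * s + 1 + d} \<and> card A = s + 1}" "\<forall>A\<in>F. \<forall>B\<in>F. A \<inter> B \<noteq> {}"
        and Bad: "Bad \<subseteq> {T. T \<subseteq> {..<2 * s + 1 + d} \<and> card T = s + 1 + d}" and c: "1 \<le> c" "c \<le> (s + 1 + d) choose (s + 1)"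
        and good: "\<forall>T. T \<subseteq> {..<2 * s + 1 + d} \<longrightarrow> card T = s + 1 + d \<longrightarrow> T \<notin> Bad \<longrightarrow> c \<le> card {A\<in>F. A \<subseteq> T}"
        and size: "real (card F + c * card Bad) \<le> (1 + 3 * \<epsilon>) / (1 - 4 * \<epsilon>) * c *
          real ((2 * s + 1 + d) choose (s + 1)) / real ((s + 1 + d) choose (s + 1))"
        by (elim exE conjE) (rule that)
      define k where "k = card F + c * card Bad"
      have gk: "g n r s \<le> n - c * (n div k)" and k1: "1 \<le> k"
        using g_upper_kneser(1)[OF F Bad c(1) good, of n] g_upper_kneser(2)[OF F Bad c(1) good]
        by (simp_all only: k_def d(2))
      have cle: "c \<le> k"
      proof (cases "Bad = {}")
        case True
        have "{..<s + 1 + d} \<subseteq> {..<2 * s + 1 + d}" by auto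
        then have "c \<le> card {A\<in>F. A \<subseteq> {..<s + 1 + d}}" using good True by simp
        also have "\<dots> \<le> card F"
          using finite_subset[OF F(1)] by (intro card_mono) auto
        finally show ?thesis by (simp add: k_def)
      next
        case False
        then have "1 \<le> card Bad" using finite_subset[OF Bad] by (simp add: Suc_le_eq card_gt_0_iff)
        then have "c * 1 \<le> c * card Bad" by (rule mult_left_mono) simp
        then show ?thesis unfolding k_def by linarith
      qed
      have Qeq: "real ((s + 1 + d) choose (s + 1)) / real (r choose (s + 1)) = Q"
        unfolding d(3) Q_def by (rule choose_ratio) (use s in simp)
      have Qpos: "0 < Q" using Qge less_le_trans[of 0 "1 / 2 ^ r" Q] by simp
      have "real k \<le> (1 + 3 * \<epsilon>) / (1 - 4 * \<epsilon>) * c / Q"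
        using size unfolding k_def[symmetric] d(2)[symmetric] Qeq[symmetric] by simp
      then have "real k * Q \<le> (1 + 3 * \<epsilon>) / (1 - 4 * \<epsilon>) * c" by (simp only: pos_le_divide_eq[OF Qpos])
      then have "(1 - 7 * \<epsilon>) * (real k * Q) \<le> (1 - 7 * \<epsilon>) * ((1 + 3 * \<epsilon>) / (1 - 4 * \<epsilon>) * c)"
        using \<epsilon> by (intro mult_left_mono) auto
      also have "\<dots> \<le> 1 * real c"
      proof -
        have "(1 - 7 * \<epsilon>) * (1 + 3 * \<epsilon>) \<le> 1 - 4 * \<epsilon>" using \<epsilon> by (simp add: algebra_simps)
        then have "(1 - 7 * \<epsilon>) * ((1 + 3 * \<epsilon>) / (1 - 4 * \<epsilon>)) \<le> 1" using \<epsilon> by (simp add: pos_divide_le_eq)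
        from mult_right_mono[OF this, of "real c"] show ?thesis by (simp only: mult.assoc of_nat_0_le_iff)
      qed
      finally have "(1 - 7 * \<epsilon>) * Q * real k \<le> real c" by (simp add: mult_ac)
      then have ck: "(1 - 7 * \<epsilon>) * Q \<le> real c / real k" using k1 by (simp add: pos_le_divide_eq)
      have "real c \<le> real ((s + 1 + d) choose (s + 1))" using c(2) by simp
      also have "\<dots> \<le> 2 ^ r" unfolding d(3) by (rule two(2))
      finally have "(1 - 8 * \<epsilon>) * Q * real n \<le> real n - real (g n r s)"
        using conclude[OF k1 _ cle gk ck] by simp
      then show ?thesis by (simp only: Q_def)
    qed
  qed
qed

section \<open>Error terms and the exact cases\<close>

lemma g_asymptotic_small:
  assumes s: "\<forall>r\<ge>1. 1 \<le> s r \<and> s r \<le> r" and lim: "(\<lambda>r. real (s r) / sqrt (real r)) \<longlonglongrightarrow> 0"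
  shows "\<exists>\<eta>. vanishing (\<lambda>r. 16 ^ r) \<eta> \<and>
        (\<forall>r\<ge>1. \<forall>n\<ge>16 ^ r. real (g n r (s r)) = (1 + \<eta> r n) * real (s r) / sqrt (real r) * real n)"
proof -
  define x where "x r = real (s r) / sqrt (real r)" for r
  \<comment> \<open>Solving the claimed equation for the error makes it true by definition; only the
    uniform vanishing remains.\<close>
  define \<eta> where "\<eta> r n = real (g n r (s r)) / (x r * real n) - 1" for r n
  have xpos: "0 < x r" if "1 \<le> r" for r
  proof -
    have "1 \<le> s r" using s that by blast
    then show ?thesis using that by (simp add: x_def)
  qed
  have npos: "0 < real n" if "16 ^ r \<le> n" for r n :: nat
    using that less_le_trans[of 0 "16 ^ r" n] by simp
  have "vanishing (\<lambda>r. 16 ^ r) \<eta>"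
    unfolding vanishing_def
  proof (intro allI impI)
    fix \<epsilon> :: real assume \<epsilon>: "0 < \<epsilon>"
    then have e2: "0 < \<epsilon> / 2" by simp
    have ev1: "\<forall>\<^sub>F r in at_top. x r < \<epsilon>"
      using order_tendstoD(2)[OF lim \<epsilon>] by (simp add: x_def)
    show "\<forall>\<^sub>F r in at_top. \<forall>n\<ge>16 ^ r. \<bar>\<eta> r n\<bar> < \<epsilon>"
      using ev1 g_upper_small[OF e2] eventually_ge_at_top[of "1::nat"]
    proof eventually_elim
      case (elim r)
      show ?case
      proof (intro allI impI)
        fix n :: nat assume n: "16 ^ r \<le> n"
        have sr: "1 \<le> s r" "s r \<le> r" using s elim(3) by blast+
        have xn: "0 < x r * real n" using xpos[OF elim(3)] npos[OF n] by simp
        have "real (g n r (s r)) \<le> (1 + \<epsilon> / 2) * (x r * real n)"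
          using elim(2)[rule_format, OF n sr(1)] by (simp add: x_def mult.assoc)
        then have "real (g n r (s r)) / (x r * real n) \<le> 1 + \<epsilon> / 2" by (simp only: pos_divide_le_eq[OF xn])
        then have up: "\<eta> r n \<le> \<epsilon> / 2" unfolding \<eta>_def by linarith
        have n2: "2 \<le> n"
        proof -
          have "(16::nat) ^ 1 \<le> 16 ^ r" using elim(3) by (intro power_increasing) auto
          then show ?thesis using n by simp
        qed
        \<comment> \<open>As 1 - exp(- x) \<ge> x - x^2/2, the relative loss in the lower bound is
          x/2, which tends to 0 with s/sqrt r.\<close>
        have "(1 - x r / 2) * (x r * real n) \<le> (1 - exp (- x r)) * real n"
        proof -
          have "(1 - x r / 2) * x r \<le> 1 - exp (- x r)"
            using one_minus_exp_neg_ge[of "x r"] xpos[OF elim(3)] by (simp add: algebra_simps power2_eq_square)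
          then show ?thesis by (simp add: mult.assoc[symmetric] mult_right_mono)
        qed
        also have "\<dots> \<le> real (g n r (s r))" using g_lower_exp[OF n2 sr] by (simp add: x_def)
        finally have "1 - x r / 2 \<le> real (g n r (s r)) / (x r * real n)" by (simp only: pos_le_divide_eq[OF xn])
        then have "- (\<epsilon> / 2) < \<eta> r n" unfolding \<eta>_def using elim(1) by linarith
        then show "\<bar>\<eta> r n\<bar> < \<epsilon>" using up \<epsilon> by simp
      qed
    qed
  qed
  moreover have "real (g n r (s r)) = (1 + \<eta> r n) * real (s r) / sqrt (real r) * real n" if "1 \<le> r" "16 ^ r \<le> n" for r n
  proof -
    have "(1 + \<eta> r n) * (x r * real n) = real (g n r (s r))"
      using xpos[OF that(1)] npos[OF that(2)] by (simp add: \<eta>_def)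
    then show ?thesis by (simp add: x_def)
  qed
  ultimately show ?thesis by blast
qed

lemma sixteen_pow_ge_2: "2 \<le> n" if "16 ^ r \<le> n" "1 \<le> r" for n r :: nat
proof -
  have "(16::nat) ^ 1 \<le> 16 ^ r" using that(2) by (intro power_increasing) auto
  then show ?thesis using that(1) by simp
qed

lemma g_eq_n:
  assumes "1 \<le> s" "s \<le> r" "2 \<le> n" "r \<le> 2 * s"
  shows "g n r s = n"
proof -
  have "(r - s - 1) choose s = 0" using assms by (intro binomial_eq_0) linarith
  from g_lower_binomial[OF assms(3,1,2), unfolded this] have "real n \<le> real (g n r s)" by simp
  then show ?thesis using g_le_n[of r n s] assms by simp
qed

lemma g_asymptotic_half:
  assumes s: "\<forall>r\<ge>1. 1 \<le> s r \<and> s r \<le> r" and \<delta>: "\<delta> \<longlonglongrightarrow> 0" and half: "\<forall>r\<ge>1. (1 - \<delta> r) * (real r / 2) \<le> real (s r)"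
  shows "\<exists>\<eta>. vanishing (\<lambda>r. 16 ^ r) \<eta> \<and>
        (\<forall>r\<ge>1. \<forall>n\<ge>16 ^ r. real (g n r (s r)) =
            (1 - (1 - \<eta> r n) * (real ((r - s r - 1) choose (s r)) / real (r choose (s r)))) * real n)"
proof -
  define Q where "Q r = real ((r - s r - 1) choose (s r)) / real (r choose (s r))" for r
  \<comment> \<open>For s \<ge> r/2 the binomial in the numerator is 0 and \<open>g\<close> equals
    \<open>n\<close>, so the error may be set to 0 and the division by \<open>Q r\<close> is
    avoided.\<close>
  define \<eta> where "\<eta> r n = (if r \<le> 2 * s r then 0 else 1 - (real n - real (g n r (s r))) / (Q r * real n))" for r n
  have Qpos: "0 < Q r" if "2 * s r < r" for r
    unfolding Q_def using that by (intro divide_pos_pos) (simp_all add: zero_less_binomial)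
  have npos: "0 < real n" if "16 ^ r \<le> n" for r n :: nat
    using that less_le_trans[of 0 "16 ^ r" n] by simp
  have "vanishing (\<lambda>r. 16 ^ r) \<eta>"
    unfolding vanishing_def
  proof (intro allI impI)
    fix \<epsilon> :: real assume \<epsilon>: "0 < \<epsilon>"
    define e where "e = min (1 / 8) (\<epsilon> / 9)"
    have e: "0 < e" "e \<le> 1 / 8" "8 * e < \<epsilon>" using \<epsilon> by (auto simp: e_def min_def)
    obtain \<kappa> r0 where \<kappa>: "0 < \<kappa>" and up: "\<And>r s n. r0 \<le> r \<Longrightarrow> 1 \<le> s \<Longrightarrow> 2 * s < r \<Longrightarrow> \<kappa> * real (r - 2 * s - 1) \<le> real (r - s) \<Longrightarrow> 16 ^ r \<le> n \<Longrightarrow>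
      (1 - 8 * e) * (real ((r - s - 1) choose s) / real (r choose s)) * real n \<le> real n - real (g n r s)"
      using g_upper_half[OF e(1,2)] by blast
    \<comment> \<open>For s < r/2 one has r - 2 s \<le> \<delta> r and r - s \<ge> r/2, so \<delta>
      < 1/(2 \<kappa>) is what \<open>g_upper_half\<close> requires.\<close>
    have "0 < 1 / (2 * \<kappa>)" using \<kappa> by simp
    from order_tendstoD(2)[OF \<delta> this]
    show "\<forall>\<^sub>F r in at_top. \<forall>n\<ge>16 ^ r. \<bar>\<eta> r n\<bar> < \<epsilon>"
      using eventually_ge_at_top[of r0] eventually_ge_at_top[of "1::nat"]
    proof eventually_elim
      case (elim r)
      show ?case
      proof (intro allI impI)
        fix n :: nat assume n: "16 ^ r \<le> n"
        have sr: "1 \<le> s r" "s r \<le> r" using s elim(3) by blast+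
        show "\<bar>\<eta> r n\<bar> < \<epsilon>"
        proof (cases "r \<le> 2 * s r")
          case True
          then show ?thesis using \<epsilon> by (simp add: \<eta>_def)
        next
          case False
          have Qn: "0 < Q r * real n" using Qpos[of r] npos[OF n] False by simp
          have "\<kappa> * real (r - 2 * s r - 1) \<le> real (r - s r)"
          proof -
            have "real (r - 2 * s r - 1) \<le> real r - 2 * real (s r)" using False by linarith
            also have "\<dots> \<le> \<delta> r * real r" using half[rule_format, OF elim(3)] by (simp add: algebra_simps)
            also have "\<dots> \<le> 1 / (2 * \<kappa>) * real r" using elim(1) by (intro mult_right_mono) auto
            finally have "\<kappa> * real (r - 2 * s r - 1) \<le> \<kappa> * (1 / (2 * \<kappa>) * real r)"
              using \<kappa> by (intro mult_left_mono) auto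
            also have "\<dots> = real r / 2" using \<kappa> by simp
            also have "\<dots> \<le> real (r - s r)" using False by linarith
            finally show ?thesis .
          qed
          then have "(1 - 8 * e) * Q r * real n \<le> real n - real (g n r (s r))"
            unfolding Q_def using up[OF elim(2) sr(1) _ _ n] False by simp
          then have "1 - 8 * e \<le> (real n - real (g n r (s r))) / (Q r * real n)"
            by (simp only: pos_le_divide_eq[OF Qn] mult.assoc)
          then have "\<eta> r n \<le> 8 * e" using False by (simp add: \<eta>_def)
          moreover have "(1 - Q r) * real n \<le> real (g n r (s r))"
            unfolding Q_def by (rule g_lower_binomial[OF sixteen_pow_ge_2[OF n elim(3)] sr])
          then have "real n - real (g n r (s r)) \<le> Q r * real n" by (simp add: algebra_simps)
          then have "(real n - real (g n r (s r))) / (Q r * real n) \<le> 1" by (simp only: pos_divide_le_eq[OF Qn] mult_1_left)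
          then have "0 \<le> \<eta> r n" using False by (simp add: \<eta>_def)
          ultimately show ?thesis using e by simp
        qed
      qed
    qed
  qed
  moreover have "real (g n r (s r)) = (1 - (1 - \<eta> r n) * (real ((r - s r - 1) choose (s r)) / real (r choose (s r)))) * real n"
    if r: "1 \<le> r" and n: "16 ^ r \<le> n" for r n
  proof (cases "r \<le> 2 * s r")
    case True
    have s1: "1 \<le> s r" "s r \<le> r" using s r by blast+
    have "(r - s r - 1) choose (s r) = 0" using True s1(1) by (intro binomial_eq_0) linarith
    moreover have "g n r (s r) = n" using g_eq_n[OF s1 sixteen_pow_ge_2[OF n r] True] by simp
    ultimately show ?thesis by (simp only: of_nat_0 div_0 mult_zero_right diff_zero mult_1_left)
  next
    case False
    have "(1 - \<eta> r n) * Q r * real n = real n - real (g n r (s r))"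
      using False Qpos[of r] npos[OF n] by (simp add: \<eta>_def)
    then have "real (g n r (s r)) = (1 - (1 - \<eta> r n) * Q r) * real n" by (simp add: algebra_simps)
    then show ?thesis by (simp only: Q_def)
  qed
  ultimately show ?thesis by blast
qed

lemma g_lower_quadratic_exp:
  assumes s: "1 \<le> s" "s \<le> r" and n: "2 \<le> n"
  shows "(1 - exp (- (1 * (real s)\<^sup>2 / real r))) * real n \<le> real (g n r s)"
proof -
  have r: "1 \<le> r" using s by simp
  have pos: "0 < real (r choose s)" using s by (simp add: zero_less_binomial)
  have "real ((r - s - 1) choose s) / real (r choose s) \<le> exp (- (1 * (real s)\<^sup>2 / real r))"
  proof -
    have "(r - s - 1) choose s \<le> (r - s) choose s" by (rule binomial_right_mono) simp
    then have "real ((r - s - 1) choose s) \<le> exp (- (real s * real s / real r)) * real (r choose s)"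
      using binomial_exp_bound[OF s(2,2) r] by linarith
    then show ?thesis using pos by (simp add: pos_divide_le_eq power2_eq_square)
  qed
  then have "(1 - exp (- (1 * (real s)\<^sup>2 / real r))) * real n \<le> (1 - real ((r - s - 1) choose s) / real (r choose s)) * real n"
    by (intro mult_right_mono) auto
  also have "\<dots> \<le> real (g n r s)" by (rule g_lower_binomial[OF n s])
  finally show ?thesis .
qed

text \<open>Both bounds are sharp after rounding: the lower one may be rounded up as
  \<open>g\<close> is an integer, and n minus the floor of n/k is the ceiling of n - n/k.\<close>

lemma g_odd_half:
  assumes s: "1 \<le> s" and n: "2 \<le> n"
  shows "int (g n (2 * s + 1) s) = \<lceil>(1 - 1 / real ((2 * s + 1) choose s)) * real n\<rceil>"
proof -
  let ?k = "(2 * s + 1) choose s"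
  have k: "0 < ?k" by (simp add: zero_less_binomial)
  have "(1 - real ((2 * s + 1 - s - 1) choose s) / real ?k) * real n \<le> real (g n (2 * s + 1) s)"
    by (rule g_lower_binomial[OF n s]) simp
  then have "(1 - 1 / real ?k) * real n \<le> real_of_int (int (g n (2 * s + 1) s))" by simp
  then have "\<lceil>(1 - 1 / real ?k) * real n\<rceil> \<le> int (g n (2 * s + 1) s)" by (simp only: ceiling_le_iff)
  moreover have "int (g n (2 * s + 1) s) \<le> \<lceil>(1 - 1 / real ?k) * real n\<rceil>"
  proof -
    have "g n (2 * s + 1) s \<le> n - n div ?k" by (rule g_upper_all_subsets)
    moreover have "n div ?k \<le> n" by (rule div_le_dividend)
    ultimately have "int (g n (2 * s + 1) s) \<le> int n - int (n div ?k)" by linarith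
    also have "int (n div ?k) = \<lfloor>real n / real ?k\<rfloor>" by (simp add: floor_divide_of_nat_eq)
    also have "int n - \<lfloor>real n / real ?k\<rfloor> = \<lceil>real n - real n / real ?k\<rceil>"
      by (simp add: ceiling_def) linarith
    also have "real n - real n / real ?k = (1 - 1 / real ?k) * real n" by (simp add: left_diff_distrib)
    finally show ?thesis .
  qed
  ultimately show ?thesis by linarith
qed

section \<open>The theorem\<close>

theorem theorem1p4:
  "\<exists>N :: nat \<Rightarrow> nat.
    \<comment> \<open>(1)\<close>
    (\<forall>s :: nat \<Rightarrow> nat.
      (\<forall>r\<ge>1. 1 \<le> s r \<and> s r \<le> r) \<longrightarrow>
      (\<lambda>r. real (s r) / sqrt (real r)) \<longlonglongrightarrow> 0 \<longrightarrow>
      (\<exists>\<eta>. vanishing N \<eta> \<and>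
        (\<forall>r\<ge>1. \<forall>n\<ge>N r.
          real (g n r (s r)) = (1 + \<eta> r n) * real (s r) / sqrt (real r) * real n))) \<and>
    \<comment> \<open>(2)\<close>
    (\<forall>a b :: real. 0 < a \<longrightarrow> 0 < b \<longrightarrow>
      (\<exists>c C :: real. 0 < c \<and> 0 < C \<and>
        (\<forall>r s n. 1 \<le> s \<longrightarrow> s \<le> r \<longrightarrow> N r \<le> n \<longrightarrow>
          a * sqrt (real r) \<le> real s \<longrightarrow> real s \<le> b * sqrt (real r) \<longrightarrow>
          c * real n \<le> real (g n r s) \<and> real (g n r s) \<le> C * real n))) \<and>
    \<comment> \<open>(3)\<close>
    (\<exists>c C :: real. 0 < c \<and> 0 < C \<and>
      (\<forall>r s n. 1 \<le> s \<longrightarrow> s \<le> r \<longrightarrow> N r \<le> n \<longrightarrow>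
        sqrt (real r * log 2 (real r)) \<le> real s \<longrightarrow>
        (1 - exp (- (c * (real s)\<^sup>2 / real r))) * real n \<le> real (g n r s) \<and>
        (real s < real r / 2 \<longrightarrow>
          real (g n r s) \<le> (1 - exp (- (C * (real s)\<^sup>2 / real r))) * real n))) \<and>
    \<comment> \<open>(4)\<close>
    (\<forall>(s :: nat \<Rightarrow> nat) (\<delta> :: nat \<Rightarrow> real).
      (\<forall>r\<ge>1. 1 \<le> s r \<and> s r \<le> r) \<longrightarrow>
      \<delta> \<longlonglongrightarrow> 0 \<longrightarrow>
      (\<forall>r\<ge>1. (1 - \<delta> r) * (real r / 2) \<le> real (s r)) \<longrightarrow>
      (\<exists>\<eta>. vanishing N \<eta> \<and>
        (\<forall>r\<ge>1. \<forall>n\<ge>N r.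
          real (g n r (s r)) =
            (1 - (1 - \<eta> r n) * (real ((r - s r - 1) choose (s r)) / real (r choose (s r)))) * real n))) \<and>
    \<comment> \<open>(5)\<close>
    (\<forall>r s n. 1 \<le> s \<longrightarrow> s \<le> r \<longrightarrow> N r \<le> n \<longrightarrow> odd r \<longrightarrow> s = (r - 1) div 2 \<longrightarrow>
      int (g n r s) = \<lceil>(1 - 1 / real (r choose s)) * real n\<rceil>) \<and>
    \<comment> \<open>(6)\<close>
    (\<forall>r s n. 1 \<le> s \<longrightarrow> s \<le> r \<longrightarrow> N r \<le> n \<longrightarrow> real r / 2 \<le> real s \<longrightarrow>
      g n r s = n)"
\<comment> \<open>One bound for all parts: 16^r exceeds twice the size of the cross families and
  beats the rounding losses in (1) and (4).\<close>
proof (rule exI[of _ "\<lambda>r. 16 ^ r"], intro conjI allI impI)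
  fix s :: "nat \<Rightarrow> nat"
  assume "\<forall>r\<ge>1. 1 \<le> s r \<and> s r \<le> r" "(\<lambda>r. real (s r) / sqrt (real r)) \<longlonglongrightarrow> 0"
  then show "\<exists>\<eta>. vanishing (\<lambda>r. 16 ^ r) \<eta> \<and>
      (\<forall>r\<ge>1. \<forall>n\<ge>16 ^ r. real (g n r (s r)) = (1 + \<eta> r n) * real (s r) / sqrt (real r) * real n)"
    by (rule g_asymptotic_small)
next
  fix a b :: real
  assume ab: "0 < a" "0 < b"
  show "\<exists>c C :: real. 0 < c \<and> 0 < C \<and>
        (\<forall>r s n. 1 \<le> s \<longrightarrow> s \<le> r \<longrightarrow> 16 ^ r \<le> n \<longrightarrow>
          a * sqrt (real r) \<le> real s \<longrightarrow> real s \<le> b * sqrt (real r) \<longrightarrow>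
          c * real n \<le> real (g n r s) \<and> real (g n r s) \<le> C * real n)"
  \<comment> \<open>The lower constant is \<open>g_lower_exp\<close> evaluated at s/sqrt r \<ge> a;
    the upper one is the trivial g \<le> n.\<close>
  proof (rule exI[of _ "1 - exp (- a)"], rule exI[of _ 1], intro conjI allI impI)
    show "0 < 1 - exp (- a)" using ab by simp
    fix r s n :: nat
    assume s: "1 \<le> s" "s \<le> r" and n: "16 ^ r \<le> n" and as: "a * sqrt (real r) \<le> real s"
    have r: "1 \<le> r" using s by simp
    have "a \<le> real s / sqrt (real r)" using as r by (simp add: pos_le_divide_eq)
    then have "(1 - exp (- a)) * real n \<le> (1 - exp (- (real s / sqrt (real r)))) * real n"
      by (intro mult_right_mono) auto
    then show "(1 - exp (- a)) * real n \<le> real (g n r s)"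
      using g_lower_exp[OF sixteen_pow_ge_2[OF n r] s] by linarith
    show "real (g n r s) \<le> 1 * real n" using g_le_n[OF r] by simp
  qed simp
next
  show "\<exists>c C :: real. 0 < c \<and> 0 < C \<and>
      (\<forall>r s n. 1 \<le> s \<longrightarrow> s \<le> r \<longrightarrow> 16 ^ r \<le> n \<longrightarrow>
        sqrt (real r * log 2 (real r)) \<le> real s \<longrightarrow>
        (1 - exp (- (c * (real s)\<^sup>2 / real r))) * real n \<le> real (g n r s) \<and>
        (real s < real r / 2 \<longrightarrow>
          real (g n r s) \<le> (1 - exp (- (C * (real s)\<^sup>2 / real r))) * real n))"
  proof (rule exI[of _ 1], rule exI[of _ 4098], intro conjI allI impI)
    fix r s n :: nat
    assume s: "1 \<le> s" "s \<le> r" and n: "16 ^ r \<le> n" and sq: "sqrt (real r * log 2 (real r)) \<le> real s"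
    have r: "1 \<le> r" using s by simp
    show "(1 - exp (- (1 * (real s)\<^sup>2 / real r))) * real n \<le> real (g n r s)"
      by (rule g_lower_quadratic_exp[OF s sixteen_pow_ge_2[OF n r]])
    assume "real s < real r / 2"
    then have s2: "2 * s < r" by linarith
    have "real r * log 2 (real r) \<le> (real s)\<^sup>2" by (rule sqrt_le_D[OF sq])
    then have "log 2 (real r) \<le> (real s)\<^sup>2 / real r" using r by (simp add: pos_le_divide_eq mult.commute)
    from g_upper_exp[OF s(1) s2 this n]
    show "real (g n r s) \<le> (1 - exp (- (4098 * (real s)\<^sup>2 / real r))) * real n" by simp
  qed simp_all
next
  fix s :: "nat \<Rightarrow> nat" and \<delta> :: "nat \<Rightarrow> real"
  assume "\<forall>r\<ge>1. 1 \<le> s r \<and> s r \<le> r" "\<delta> \<longlonglongrightarrow> 0" "\<forall>r\<ge>1. (1 - \<delta> r) * (real r / 2) \<le> real (s r)"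
  then show "\<exists>\<eta>. vanishing (\<lambda>r. 16 ^ r) \<eta> \<and>
        (\<forall>r\<ge>1. \<forall>n\<ge>16 ^ r. real (g n r (s r)) =
            (1 - (1 - \<eta> r n) * (real ((r - s r - 1) choose (s r)) / real (r choose (s r)))) * real n)"
    by (rule g_asymptotic_half)
next
  fix r s n :: nat
  assume s: "1 \<le> s" "s \<le> r" and n: "16 ^ r \<le> n" and "odd r" "s = (r - 1) div 2"
  then have "r = 2 * s + 1" by (auto elim!: oddE)
  then show "int (g n r s) = \<lceil>(1 - 1 / real (r choose s)) * real n\<rceil>"
    using g_odd_half[OF s(1) sixteen_pow_ge_2[OF n]] s by simp
next
  fix r s n :: nat
  assume s: "1 \<le> s" "s \<le> r" and n: "16 ^ r \<le> n" and "real r / 2 \<le> real s"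
  then have "r \<le> 2 * s" by linarith
  then show "g n r s = n" using g_eq_n[OF s sixteen_pow_ge_2[OF n]] s by simp
qed

end
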